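(* Let $X\subset\mathbb{C}^m$ be an unbounded algebraic set of pure dimension $k$. Then $C_{3,\infty}(X)\subset C_{4,\infty}(X)\subset C_{5,\infty}(X)$.
   Context: Let $X\subset\mathbb{C}^m$ be an unbounded pure $k$-dimensional (complex, closed) algebraic set, $\mathrm{Sing}\,X$ its set of singular points, and $T_pX$ the complex tangent space at $p\in X\setminus\mathrm{Sing}\,X$, viewed as a linear subspace of $\mathbb{C}^m$. - $C_{3,\infty}(X)$ is the set of $v\in\mathbb{C}^m$ for which there exist sequences $(p_j)_j$ in $X$ and $(t_j)_j$ in $\mathbb{C}$ with $\lim_{j\to\infty}\|p_j\|=\infty$ and $\lim_{j\to\infty}t_jp_j=v$. - $C_{4,\infty}(X)$ is the set of $v\in\mathbb{C}^m$ for which there exist a sequence $(p_j)_j$ in $X\setminus\mathrm{Sing}\,X$ and vectors $v_j\in T_{p_j}X$ with $\lim_{j\to\infty}\|p_j\|=\infty$ and $\lim_{j\to\infty}v_j=v$. - $C_{5,\infty}(X)$ is the set of $v\in\mathbb{C}^m$ for which there exist sequences $(p_j)_j$ and $(q_j)_j$ in $X$ and $(t_j)_j$ in $\mathbb{C}$ with $\lim_{j\to\infty}\|p_j\|=\lim_{j\to\infty}\|q_j\|=\infty$ and $\lim_{j\to\infty}t_j(p_j-q_j)=v$. *)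

theory Defs
  imports "HOL-Analysis.Analysis"
begin

section \<open>Complex algebraic sets\<close>

definition polynomial_fun :: "(complex ^ 'n \<Rightarrow> complex) \<Rightarrow> bool" where
  "polynomial_fun f \<longleftrightarrow>
    (\<exists>A :: ('n \<Rightarrow> nat) set. \<exists>c. finite A \<and>
      (\<forall>z. f z = (\<Sum>\<alpha>\<in>A. c \<alpha> * (\<Prod>i\<in>UNIV. (z $ i) ^ \<alpha> i))))"

definition algebraic_set :: "(complex ^ 'n) set \<Rightarrow> bool" where
  "algebraic_set X \<longleftrightarrow>
    (\<exists>F. finite F \<and> (\<forall>f\<in>F. polynomial_fun f) \<and> X = {z. \<forall>f\<in>F. f z = 0})"

section \<open>Regular and singular points, tangent spaces\<close>

text \<open>
  The library's notion of a holomorphic function is restricted to one variable. Here a map of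
  several complex variables is holomorphic on an open set if it is differentiable with
  complex-linear derivative at each of its points. The prefix \<open>vec\<close> (as in \<open>vec.subspace\<close> and
  \<open>vec.dim\<close>) and the scalar multiplication \<open>*s\<close> refer to the vector space structure over the
  complex field.
\<close>

definition holomorphic_map_on ::
    "(complex ^ 'n \<Rightarrow> complex ^ 'n) \<Rightarrow> (complex ^ 'n) set \<Rightarrow> bool" where
  "holomorphic_map_on f U \<longleftrightarrow> open U \<and>
    (\<forall>z\<in>U. \<exists>D. Vector_Spaces.linear (*s) (*s) D \<and> (f has_derivative D) (at z))"

definition biholomorphic_on ::
    "(complex ^ 'n \<Rightarrow> complex ^ 'n) \<Rightarrow> (complex ^ 'n) set \<Rightarrow> bool" where
  "biholomorphic_on \<phi> U \<longleftrightarrow> holomorphic_map_on \<phi> U \<and>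
    (\<exists>\<psi>. holomorphic_map_on \<psi> (\<phi> ` U) \<and> (\<forall>z\<in>U. \<psi> (\<phi> z) = z))"

text \<open>
  Near \<open>p\<close>, the coordinates \<open>\<phi>\<close> straighten \<open>X\<close> to the complex linear subspace \<open>L\<close>;
  that is, \<open>X \<inter> U\<close> is a complex submanifold of \<open>U\<close> of dimension \<open>vec.dim L\<close>.
\<close>

definition submanifold_chart ::
    "(complex ^ 'n) set \<Rightarrow> complex ^ 'n \<Rightarrow> (complex ^ 'n) set \<Rightarrow>
      (complex ^ 'n \<Rightarrow> complex ^ 'n) \<Rightarrow> (complex ^ 'n) set \<Rightarrow> bool" where
  "submanifold_chart X p U \<phi> L \<longleftrightarrow>
    p \<in> U \<and> biholomorphic_on \<phi> U \<and> vec.subspace L \<and> \<phi> ` (X \<inter> U) = \<phi> ` U \<inter> L"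

definition regular_point_of_dim :: "(complex ^ 'n) set \<Rightarrow> nat \<Rightarrow> complex ^ 'n \<Rightarrow> bool" where
  "regular_point_of_dim X d p \<longleftrightarrow>
    p \<in> X \<and> (\<exists>U \<phi> L. submanifold_chart X p U \<phi> L \<and> vec.dim L = d)"

definition Sing :: "(complex ^ 'n) set \<Rightarrow> (complex ^ 'n) set" where
  "Sing X = {p \<in> X. \<not> (\<exists>d. regular_point_of_dim X d p)}"

text \<open>
  The preimage of \<open>L\<close> under the derivative at \<open>p\<close> of a chart; by the lemma
  \<open>tangent_space_eq\<close> below it does not depend on the chart.
\<close>

definition tangent_space :: "(complex ^ 'n) set \<Rightarrow> complex ^ 'n \<Rightarrow> (complex ^ 'n) set" where
  "tangent_space X p =
    {v. \<exists>U \<phi> L. submanifold_chart X p U \<phi> L \<and> frechet_derivative \<phi> (at p) v \<in> L}"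

text \<open>
  As usual in analytic geometry, the dimension of \<open>X\<close> at \<open>a\<close> is the limes superior of the
  dimensions of \<open>X\<close> at its regular points \<open>z\<close> as \<open>z\<close> tends to \<open>a\<close> (with \<open>z = a\<close> allowed), and
  \<open>X\<close> is of pure dimension \<open>k\<close> if it has dimension \<open>k\<close> at each of its points. As
  the dimensions are natural numbers, the limes superior is \<open>d\<close> iff eventually no value
  exceeds \<open>d\<close> and the value \<open>d\<close> occurs arbitrarily close to \<open>a\<close>.
\<close>

definition has_local_dim :: "(complex ^ 'n) set \<Rightarrow> complex ^ 'n \<Rightarrow> nat \<Rightarrow> bool" where
  "has_local_dim X a d \<longleftrightarrow>
    (\<exists>r>0. \<forall>z\<in>ball a r. \<forall>e. regular_point_of_dim X e z \<longrightarrow> e \<le> d) \<and>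
    (\<forall>r>0. \<exists>z\<in>ball a r. regular_point_of_dim X d z)"

definition pure_dimensional :: "nat \<Rightarrow> (complex ^ 'n) set \<Rightarrow> bool" where
  "pure_dimensional k X \<longleftrightarrow> (\<forall>a\<in>X. has_local_dim X a k)"

section \<open>Tangent cones at infinity\<close>

definition C3_inf :: "(complex ^ 'n) set \<Rightarrow> (complex ^ 'n) set" where
  "C3_inf X = {v. \<exists>(p :: nat \<Rightarrow> complex ^ 'n) (t :: nat \<Rightarrow> complex).
     (\<forall>j. p j \<in> X) \<and>
     filterlim (\<lambda>j. norm (p j)) at_top sequentially \<and>
     (\<lambda>j. t j *s p j) \<longlonglongrightarrow> v}"

definition C4_inf :: "(complex ^ 'n) set \<Rightarrow> (complex ^ 'n) set" where
  "C4_inf X = {v. \<exists>(p :: nat \<Rightarrow> complex ^ 'n) (w :: nat \<Rightarrow> complex ^ 'n).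
     (\<forall>j. p j \<in> X - Sing X \<and> w j \<in> tangent_space X (p j)) \<and>
     filterlim (\<lambda>j. norm (p j)) at_top sequentially \<and>
     w \<longlonglongrightarrow> v}"

definition C5_inf :: "(complex ^ 'n) set \<Rightarrow> (complex ^ 'n) set" where
  "C5_inf X = {v. \<exists>(p :: nat \<Rightarrow> complex ^ 'n) (q :: nat \<Rightarrow> complex ^ 'n) (t :: nat \<Rightarrow> complex).
     (\<forall>j. p j \<in> X \<and> q j \<in> X) \<and>
     filterlim (\<lambda>j. norm (p j)) at_top sequentially \<and>
     filterlim (\<lambda>j. norm (q j)) at_top sequentially \<and>
     (\<lambda>j. t j *s (p j - q j)) \<longlonglongrightarrow> v}"

section \<open>Tangent spaces do not depend on the chart\<close>

lemma submanifold_chart_derivative: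
  assumes "submanifold_chart X p U \<phi> L"
  shows "(\<phi> has_derivative frechet_derivative \<phi> (at p)) (at p)"
  using assms unfolding submanifold_chart_def biholomorphic_on_def holomorphic_map_on_def
  by (meson differentiableI frechet_derivative_works)

lemma submanifold_chart_real_subspace:
  assumes "submanifold_chart X p U \<phi> L"
  shows "subspace L"
proof -
  have sub: "vec.subspace L" using assms by (simp add: submanifold_chart_def)
  have "c *\<^sub>R x \<in> L" if "x \<in> L" for c x
  proof -
    have "c *\<^sub>R x = of_real c *s x" by (simp add: vec_eq_iff scaleR_conv_of_real[where 'a=complex])
    thus ?thesis using vec.subspace_scale[OF sub that] by simp
  qed
  thus ?thesis using sub
    by (simp add: subspace_def vec.subspace_0 vec.subspace_add)
qed

lemma tangent_chart_independent:
  assumes p: "p \<in> X"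
    and c1: "submanifold_chart X p U \<phi> L" and c2: "submanifold_chart X p U' \<phi>' L'"
    and v: "frechet_derivative \<phi> (at p) v \<in> L"
  shows "frechet_derivative \<phi>' (at p) v \<in> L'"
proof -
  define D where "D = frechet_derivative \<phi> (at p)"
  define D' where "D' = frechet_derivative \<phi>' (at p)"
  have D: "(\<phi> has_derivative D) (at p)" and D': "(\<phi>' has_derivative D') (at p)"
    unfolding D_def D'_def using submanifold_chart_derivative c1 c2 by blast+
  have subL: "subspace L" and subL': "subspace L'"
    using submanifold_chart_real_subspace c1 c2 by blast+
  have bi: "biholomorphic_on \<phi> U" and bi': "biholomorphic_on \<phi>' U'"
    and pU: "p \<in> U" and pU': "p \<in> U'"
    and im: "\<phi> ` (X \<inter> U) = \<phi> ` U \<inter> L" and im': "\<phi>' ` (X \<inter> U') = \<phi>' ` U' \<inter> L'"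
    using c1 c2 by (simp_all add: submanifold_chart_def)
  have U: "open U" "p \<in> U" and U': "open U'" "p \<in> U'"
    using bi bi' pU pU' by (simp_all add: biholomorphic_on_def holomorphic_map_on_def)
  obtain \<psi> where \<psi>: "holomorphic_map_on \<psi> (\<phi> ` U)" "\<And>z. z \<in> U \<Longrightarrow> \<psi> (\<phi> z) = z"
    using bi unfolding biholomorphic_on_def by metis
  have oV: "open (\<phi> ` U)" using \<psi>(1) by (simp add: holomorphic_map_on_def)
  obtain E where E: "(\<psi> has_derivative E) (at (\<phi> p))"
    using \<psi>(1) U(2) unfolding holomorphic_map_on_def by blast
  have "((\<lambda>z. \<psi> (\<phi> z)) has_derivative (\<lambda>x. E (D x))) (at p)"
    using has_derivative_compose[OF D] E by blast
  hence "((\<lambda>z. z) has_derivative (\<lambda>x. E (D x))) (at p)"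
    by (rule has_derivative_transform_within_open[OF _ U]) (simp add: \<psi>)
  hence "(\<lambda>x. E (D x)) = (\<lambda>x. x)"
    using has_derivative_unique has_derivative_ident by blast
  hence EDv: "E (D v) = v" by metis
  define \<gamma> where "\<gamma> t = \<psi> (\<phi> p + t *\<^sub>R D v)" for t :: real
  have \<psi>p: "\<psi> (\<phi> p) = p" using \<psi>(2) U(2) by simp
  have line: "((\<lambda>t. \<phi> p + t *\<^sub>R D v) has_derivative (\<lambda>t. t *\<^sub>R D v)) (at 0)"
    by (auto intro!: derivative_eq_intros)
  have \<gamma>: "(\<gamma> has_derivative (\<lambda>t. E (t *\<^sub>R D v))) (at 0)"
    unfolding \<gamma>_def using has_derivative_compose[OF line, of \<psi> E] E by simp
  have E_scale: "E (t *\<^sub>R D v) = t *\<^sub>R v" for t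
    using linear_scale[OF has_derivative_linear[OF E]] EDv by simp
  have \<gamma>0: "\<gamma> 0 = p" by (simp add: \<gamma>_def \<psi>p)
  have "((\<lambda>t. \<phi>' (\<gamma> t)) has_derivative (\<lambda>t. D' (t *\<^sub>R v))) (at 0)"
    using has_derivative_compose[OF \<gamma>, of \<phi>' D'] D' \<gamma>0 E_scale by simp
  hence "((\<lambda>t. norm (\<phi>' (\<gamma> t) - \<phi>' p - t *\<^sub>R D' v) / norm t) \<longlongrightarrow> 0) (at 0)"
    using \<gamma>0 linear_scale[OF has_derivative_linear[OF D']]
    by (simp add: has_derivative_iff_norm)
  moreover have "\<forall>\<^sub>F t in at 0. norm (\<phi>' (\<gamma> t) - \<phi>' p - t *\<^sub>R D' v) / norm t =
      norm ((\<phi>' (\<gamma> t) - \<phi>' p) /\<^sub>R t - D' v)"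
  proof (rule eventually_at_filter[THEN iffD2], rule always_eventually, intro allI impI)
    fix t :: real
    assume "t \<noteq> 0"
    hence "(\<phi>' (\<gamma> t) - \<phi>' p) /\<^sub>R t - D' v = (\<phi>' (\<gamma> t) - \<phi>' p - t *\<^sub>R D' v) /\<^sub>R t"
      by (simp add: scaleR_diff_right)
    thus "norm (\<phi>' (\<gamma> t) - \<phi>' p - t *\<^sub>R D' v) / norm t =
        norm ((\<phi>' (\<gamma> t) - \<phi>' p) /\<^sub>R t - D' v)"
      by (simp add: divide_inverse mult.commute)
  qed
  ultimately have "((\<lambda>t. norm ((\<phi>' (\<gamma> t) - \<phi>' p) /\<^sub>R t - D' v)) \<longlongrightarrow> 0) (at 0)"
    by (rule Lim_transform_eventually)
  hence lim: "((\<lambda>t. (\<phi>' (\<gamma> t) - \<phi>' p) /\<^sub>R t) \<longlongrightarrow> D' v) (at 0)"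
    by (rule LIM_zero_cancel[OF tendsto_norm_zero_cancel])
  have ev1: "\<forall>\<^sub>F t in at 0. \<phi> p + t *\<^sub>R D v \<in> \<phi> ` U"
  proof -
    have "((\<lambda>t. \<phi> p + t *\<^sub>R D v) \<longlongrightarrow> \<phi> p) (at 0)" by (auto intro!: tendsto_eq_intros)
    thus ?thesis using oV U(2) topological_tendstoD by fastforce
  qed
  have ev2: "\<forall>\<^sub>F t in at 0. \<gamma> t \<in> U'"
  proof -
    have "(\<gamma> \<longlongrightarrow> p) (at 0)"
      using has_derivative_continuous[OF \<gamma>] \<gamma>0 by (simp add: continuous_at)
    thus ?thesis using U' topological_tendstoD by blast
  qed
  have "\<phi> p \<in> \<phi> ` (X \<inter> U)" "\<phi>' p \<in> \<phi>' ` (X \<inter> U')"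
    using p pU pU' by (simp_all add: imageI)
  hence pL: "\<phi> p \<in> L" and pL': "\<phi>' p \<in> L'" by (simp_all add: im im')
  have ev: "\<forall>\<^sub>F t in at 0. (\<phi>' (\<gamma> t) - \<phi>' p) /\<^sub>R t \<in> L'"
    using ev1 ev2
  proof eventually_elim
    case (elim t)
    have "\<phi> p + t *\<^sub>R D v \<in> L"
      using pL v subL by (simp add: D_def subspace_add subspace_scale)
    then obtain x where x: "x \<in> X \<inter> U" "\<phi> x = \<phi> p + t *\<^sub>R D v"
      using elim im by (metis Int_iff imageE)
    have "\<gamma> t = x" using x \<psi>(2) by (metis \<gamma>_def Int_iff)
    hence "\<phi>' (\<gamma> t) \<in> \<phi>' ` (X \<inter> U')" using elim(2) x by (simp add: imageI)
    hence "\<phi>' (\<gamma> t) \<in> L'" by (simp add: im')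
    thus ?case using pL' subL' by (simp add: subspace_diff subspace_scale)
  qed
  show ?thesis
    using Lim_in_closed_set[OF closed_subspace[OF subL'] ev _ lim] by (simp add: D'_def)
qed

lemma tangent_space_eq:
  assumes "p \<in> X" "submanifold_chart X p U \<phi> L"
  shows "tangent_space X p = {v. frechet_derivative \<phi> (at p) v \<in> L}"
  using assms tangent_chart_independent unfolding tangent_space_def by blast

end

theory Submission
  imports Defs "HOL-Computational_Algebra.Fundamental_Theorem_Algebra"
    "HOL-Complex_Analysis.Complex_Analysis" "Jordan_Normal_Form.Determinant"
begin

text \<open>
  After a linear change of coordinates, \<open>X\<close> is finite and surjective over the coordinates in a set \<open>S\<close>
  (Noether normalization, obtained by eliminating coordinates with determinants), and it is locally a
  graph over them off the zeros of a polynomial \<open>D\<close>; as \<open>X\<close> is pure dimensional, the part with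
  \<open>D \<noteq> 0\<close> is dense in \<open>X\<close>. Let \<open>v\<close> be the limit of \<open>p j / x j\<close> with \<open>p j\<close> in \<open>X\<close>, and suppose that
  the tangent vectors of \<open>X\<close> far away stay \<open>\<epsilon>\<close>-far from \<open>v\<close>. Consider the points \<open>z\<close> of \<open>X\<close> over the
  points \<open>pr (p j + (s - x j) *s v)\<close> of a line and close to \<open>s *s v\<close>, with \<open>s\<close> near \<open>x j\<close>. There
  \<open>\<bar>D z\<bar> * exp (\<kappa> * (\<bar>z - s *s v\<bar>\<^sup>2 - \<eta> * \<bar>s - x j\<bar>\<^sup>2))\<close> attains its maximum in the interior and where
  \<open>D \<noteq> 0\<close>, because \<open>v\<close> is an isolated asymptotic direction. But along the holomorphic disc in \<open>X\<close>
  over the line, the gap \<open>\<epsilon>\<close> makes the exponent strictly subharmonic for small \<open>\<eta>\<close>, which contradicts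
  the maximum modulus principle. The second inclusion holds since tangent vectors are limits of secants.
\<close>

text \<open>If a single holomorphic branch of \<open>X\<close> lay over the line, its distance from
  \<open>s *s v\<close> would be small compared with \<open>norm (x j)\<close> on a disc of radius
  \<open>norm (x j) / 2\<close>, and Cauchy's estimate would give a tangent vector close to
  \<open>v\<close>. In general several branches ramify where \<open>D\<close> vanishes, so a branch
  cannot be followed over the whole disc. A maximum over all branches at once replaces Cauchy's
  estimate: a holomorphic disc is then needed only near the point of maximum. The factor
  \<open>D\<close> keeps this point away from the ramification and costs nothing there, since it is
  holomorphic along the disc. Its size is not controlled, so \<open>\<kappa>\<close> is taken so
  large that the exponential loss at the rim outweighs the ratio of the values of \<open>D\<close>.
  The definitions speak only of charts at regular points and of the dimensions of these charts.
  Hence it has to be proved that the points with \<open>D \<noteq> 0\<close> are regular and dense,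
  and dimension theory enters through Baire's theorem and invariance of domain.\<close>

no_notation fps_nth (infixl "$" 75)
no_notation Matrix.vec_index (infixl "$" 100)
hide_const (open) Matrix.mat Matrix.row Matrix.vec Determinant.det module.smult
hide_fact (open) Matrix.vec_eq_iff
hide_type (open) Matrix.mat Matrix.vec

section \<open>Polynomial functions of bounded degree\<close>

text \<open>Polynomials are functions here, so a degree is an upper bound certified by a
  construction. The set \<open>S\<close> lists the coordinates that may occur; eliminating a
  coordinate replaces \<open>S\<close> by \<open>S - {i}\<close> while the type
  \<open>complex ^ 'n\<close> stays.\<close>

inductive deg_le :: "'n set \<Rightarrow> nat \<Rightarrow> (complex ^ 'n \<Rightarrow> complex) \<Rightarrow> bool" for S where
  deg_le_const: "deg_le S d (\<lambda>_. c)"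
| deg_le_coord: "i \<in> S \<Longrightarrow> deg_le S (Suc d) (\<lambda>z. z $ i)"
| deg_le_add: "deg_le S d f \<Longrightarrow> deg_le S d g \<Longrightarrow> deg_le S d (\<lambda>z. f z + g z)"
| deg_le_mult: "deg_le S d f \<Longrightarrow> deg_le S e g \<Longrightarrow> deg_le S (d + e) (\<lambda>z. f z * g z)"

lemma deg_le_mono_degree: "deg_le S d f \<Longrightarrow> d \<le> e \<Longrightarrow> deg_le S e f"
  using deg_le_mult[of S d f "e - d" "\<lambda>_. 1"] deg_le_const[of S "e - d" 1] by simp

lemma deg_le_mono_set: "deg_le S d f \<Longrightarrow> S \<subseteq> T \<Longrightarrow> deg_le T d f"
  by (induction rule: deg_le.induct) (auto intro: deg_le.intros)

lemma deg_le_cong_coord: "deg_le S d f \<Longrightarrow> (\<And>i. i \<in> S \<Longrightarrow> z $ i = y $ i) \<Longrightarrow> f z = f y"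
  by (induction rule: deg_le.induct) auto

lemma deg_le_cmult: "deg_le S d f \<Longrightarrow> deg_le S d (\<lambda>z. c * f z)"
  using deg_le_mult[OF deg_le_const[of S 0 c]] by simp

lemma deg_le_uminus: "deg_le S d f \<Longrightarrow> deg_le S d (\<lambda>z. - f z)"
  using deg_le_cmult[of S d f "-1"] by simp

lemma deg_le_diff: "deg_le S d f \<Longrightarrow> deg_le S d g \<Longrightarrow> deg_le S d (\<lambda>z. f z - g z)"
  using deg_le_add[OF _ deg_le_uminus] by fastforce

lemma deg_le_sum: "(\<And>a. a \<in> A \<Longrightarrow> deg_le S d (f a)) \<Longrightarrow> deg_le S d (\<lambda>z. \<Sum>a\<in>A. f a z)"
  by (induction A rule: infinite_finite_induct) (auto intro: deg_le_const deg_le_add)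

lemma deg_le_power: "deg_le S d f \<Longrightarrow> deg_le S (n * d) (\<lambda>z. f z ^ n)"
  by (induction n) (auto intro: deg_le_const deg_le_mult)

lemma deg_le_coord1: "i \<in> S \<Longrightarrow> deg_le S 1 (\<lambda>z. z $ i)"
  using deg_le_coord[of i S 0] by simp

lemma deg_le_compose:
  assumes "deg_le S d f" and "\<And>i. i \<in> S \<Longrightarrow> deg_le T 1 (\<lambda>z. B z $ i)"
  shows "deg_le T d (\<lambda>z. f (B z))"
  using assms
proof (induction rule: deg_le.induct)
  case (deg_le_coord i d)
  then show ?case using deg_le_mono_degree[of T 1 _ "Suc d"] by simp
qed (auto intro: deg_le.intros)

definition is_poly :: "'n set \<Rightarrow> (complex ^ 'n \<Rightarrow> complex) \<Rightarrow> bool" where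
  "is_poly S f \<longleftrightarrow> (\<exists>d. deg_le S d f)"

lemma is_polyI: "deg_le S d f \<Longrightarrow> is_poly S f"
  by (auto simp: is_poly_def)

lemma is_poly_const: "is_poly S (\<lambda>_. c)"
  by (rule is_polyI[OF deg_le_const[of S 0]])

lemma is_poly_coord: "i \<in> S \<Longrightarrow> is_poly S (\<lambda>z. z $ i)"
  by (rule is_polyI[OF deg_le_coord1])

lemma is_poly_mult: "is_poly S f \<Longrightarrow> is_poly S g \<Longrightarrow> is_poly S (\<lambda>z. f z * g z)"
  unfolding is_poly_def using deg_le_mult by blast

lemma is_poly_add:
  assumes "is_poly S f" "is_poly S g" shows "is_poly S (\<lambda>z. f z + g z)"
proof -
  obtain d e where "deg_le S d f" "deg_le S e g" using assms by (auto simp: is_poly_def)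
  then have "deg_le S (max d e) f" "deg_le S (max d e) g"
    by (simp_all add: deg_le_mono_degree[where e = "max d e"])
  then show ?thesis by (intro is_polyI[OF deg_le_add])
qed

lemma is_poly_uminus: "is_poly S f \<Longrightarrow> is_poly S (\<lambda>z. - f z)"
  unfolding is_poly_def using deg_le_uminus by blast

lemma is_poly_sum: "(\<And>a. a \<in> A \<Longrightarrow> is_poly S (f a)) \<Longrightarrow> is_poly S (\<lambda>z. \<Sum>a\<in>A. f a z)"
  by (induction A rule: infinite_finite_induct) (auto intro: is_poly_const is_poly_add)

lemma is_poly_prod: "(\<And>a. a \<in> A \<Longrightarrow> is_poly S (f a)) \<Longrightarrow> is_poly S (\<lambda>z. \<Prod>a\<in>A. f a z)"
  by (induction A rule: infinite_finite_induct) (auto intro: is_poly_const is_poly_mult)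

lemma is_poly_power: "is_poly S f \<Longrightarrow> is_poly S (\<lambda>z. f z ^ n)"
  unfolding is_poly_def using deg_le_power by blast

lemma is_poly_mono_set: "is_poly S f \<Longrightarrow> S \<subseteq> T \<Longrightarrow> is_poly T f"
  unfolding is_poly_def using deg_le_mono_set by blast

lemma is_poly_cong_coord: "is_poly S f \<Longrightarrow> (\<And>i. i \<in> S \<Longrightarrow> z $ i = y $ i) \<Longrightarrow> f z = f y"
  unfolding is_poly_def using deg_le_cong_coord by blast

lemma polynomial_fun_is_poly:
  assumes "polynomial_fun f" shows "is_poly UNIV f"
proof -
  obtain A c where f: "\<And>z. f z = (\<Sum>\<alpha>\<in>A. c \<alpha> * (\<Prod>i\<in>UNIV. (z $ i) ^ \<alpha> i))"
    using assms unfolding polynomial_fun_def by blast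
  have "is_poly UNIV (\<lambda>z. \<Sum>\<alpha>\<in>A. c \<alpha> * (\<Prod>i\<in>UNIV. (z $ i) ^ \<alpha> i))"
    by (intro is_poly_sum is_poly_mult is_poly_const is_poly_prod is_poly_power is_poly_coord) simp
  then show ?thesis by (simp add: f[abs_def])
qed

text \<open>\<open>P z\<close> is \<open>f\<close> restricted to the multiples of \<open>z\<close>,
  so \<open>coeff (P z) e\<close> is the homogeneous part of degree \<open>e\<close> of
  \<open>f\<close>; a product of functions becomes a convolution of these parts.\<close>

lemma deg_le_homogeneous_parts:
  assumes "deg_le S d f"
  shows "\<exists>P. (\<forall>z c. f (c *s z) = poly (P z) c) \<and> (\<forall>z. degree (P z) \<le> d) \<and>
    (\<forall>e. deg_le S e (\<lambda>z. coeff (P z) e))"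
  using assms
proof (induction rule: deg_le.induct)
  case (deg_le_const d c)
  show ?case
    by (rule exI[of _ "\<lambda>_. [:c:]"]) (auto simp: coeff_pCons split: nat.splits intro: deg_le.deg_le_const)
next
  case (deg_le_coord i d)
  have "deg_le S e (\<lambda>z. coeff [:0, z $ i:] e)" for e
    using deg_le_coord by (cases e; cases "e - 1") (auto simp: coeff_pCons intro: deg_le.intros)
  then show ?case
    by (intro exI[of _ "\<lambda>z. [:0, z $ i:]"]) (auto simp: degree_pCons_eq_if)
next
  case (deg_le_add d f g)
  then obtain P Q where
    "\<forall>z c. f (c *s z) = poly (P z) c" "\<forall>z. degree (P z) \<le> d" "\<forall>e. deg_le S e (\<lambda>z. coeff (P z) e)"
    "\<forall>z c. g (c *s z) = poly (Q z) c" "\<forall>z. degree (Q z) \<le> d" "\<forall>e. deg_le S e (\<lambda>z. coeff (Q z) e)"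
    by blast
  then show ?case
    by (intro exI[of _ "\<lambda>z. P z + Q z"]) (auto intro: deg_le.deg_le_add degree_add_le)
next
  case (deg_le_mult d f e g)
  then obtain P Q where
    PQ: "\<forall>z c. f (c *s z) = poly (P z) c" "\<forall>z. degree (P z) \<le> d" "\<forall>e. deg_le S e (\<lambda>z. coeff (P z) e)"
    "\<forall>z c. g (c *s z) = poly (Q z) c" "\<forall>z. degree (Q z) \<le> e" "\<forall>e. deg_le S e (\<lambda>z. coeff (Q z) e)"
    by blast
  have "deg_le S k (\<lambda>z. coeff (P z * Q z) k)" for k
    unfolding coeff_mult
  proof (rule deg_le_sum)
    fix a assume "a \<in> {..k}"
    then show "deg_le S k (\<lambda>z. coeff (P z) a * coeff (Q z) (k - a))"
      using deg_le.deg_le_mult[of S a "\<lambda>z. coeff (P z) a" "k - a" "\<lambda>z. coeff (Q z) (k - a)"] PQ by simp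
  qed
  moreover have "degree (P z * Q z) \<le> d + e" for z
    using degree_mult_le[of "P z" "Q z"] PQ(2,5) by (meson add_mono le_trans)
  ultimately show ?case using PQ
    by (intro exI[of _ "\<lambda>z. P z * Q z"]) auto
qed

lemma homogeneous_coeff:
  fixes P :: "complex ^ 'n \<Rightarrow> complex poly"
  assumes "\<And>z c. f (c *s z) = poly (P z) c"
  shows "coeff (P (c *s z)) e = c ^ e * coeff (P z) e"
proof -
  have "poly (P (c *s z)) x = poly (pcompose (P z) [:0, c:]) x" for x
  proof -
    have "poly (P (c *s z)) x = f (x *s (c *s z))" by (rule assms[symmetric])
    also have "\<dots> = f ((c * x) *s z)" by (simp only: vector_smult_assoc mult.commute)
    also have "\<dots> = poly (P z) (c * x)" by (simp only: assms)
    finally have 1: "poly (P (c *s z)) x = poly (P z) (c * x)" .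
    have 2: "poly [:0, c:] x = c * x" by simp
    show ?thesis unfolding poly_pcompose 2 by (rule 1)
  qed
  then have "P (c *s z) = pcompose (P z) [:0, c:]" using poly_eq_poly_eq_iff by blast
  then show ?thesis by (simp add: coeff_pcompose_linear)
qed

text \<open>The bound for the coefficient of the \<open>l\<close>-th power of a variable in a
  polynomial of total degree \<open>d\<close>. For \<open>l > d\<close> the truncated difference
  \<open>d - l\<close> would still admit constants, hence the separate clause.\<close>

definition wdeg_le :: "'n set \<Rightarrow> nat \<Rightarrow> nat \<Rightarrow> (complex ^ 'n \<Rightarrow> complex) \<Rightarrow> bool" where
  "wdeg_le S d l f \<longleftrightarrow> (if l \<le> d then deg_le S (d - l) f else f = (\<lambda>_. 0))"

lemma wdeg_le_zero: "wdeg_le S d l (\<lambda>_. 0)"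
  by (auto simp: wdeg_le_def intro: deg_le_const)

lemma wdeg_le_imp_deg_le: "wdeg_le S d l f \<Longrightarrow> deg_le S (d - l) f"
  by (auto simp: wdeg_le_def intro: deg_le_const split: if_splits)

lemma wdeg_le_add: "wdeg_le S d l f \<Longrightarrow> wdeg_le S d l g \<Longrightarrow> wdeg_le S d l (\<lambda>z. f z + g z)"
  by (auto simp: wdeg_le_def intro: deg_le_add)

lemma wdeg_le_diff: "wdeg_le S d l f \<Longrightarrow> wdeg_le S d l g \<Longrightarrow> wdeg_le S d l (\<lambda>z. f z - g z)"
  by (auto simp: wdeg_le_def intro: deg_le_diff)

lemma wdeg_le_sum: "(\<And>a. a \<in> A \<Longrightarrow> wdeg_le S d l (f a)) \<Longrightarrow> wdeg_le S d l (\<lambda>z. \<Sum>a\<in>A. f a z)"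
  by (induction A rule: infinite_finite_induct) (auto intro: wdeg_le_zero wdeg_le_add)

lemma wdeg_le_mult:
  assumes "wdeg_le S d l f" "wdeg_le S e k g" shows "wdeg_le S (d + e) (l + k) (\<lambda>z. f z * g z)"
proof (cases "l \<le> d \<and> k \<le> e")
  case True
  then show ?thesis using assms deg_le_mult[of S "d - l" f "e - k" g] by (auto simp: wdeg_le_def)
next
  case False
  then have "(\<lambda>z. f z * g z) = (\<lambda>_. 0)" using assms by (auto simp: wdeg_le_def split: if_splits)
  then show ?thesis using wdeg_le_zero by metis
qed

lemma deg_le_univariate:
  assumes "deg_le S d f"
  shows "\<exists>Q. (\<forall>z. f z = poly (Q z) (z $ i)) \<and> (\<forall>z. degree (Q z) \<le> d) \<and>
    (\<forall>l. wdeg_le (S - {i}) d l (\<lambda>z. coeff (Q z) l))"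
  using assms
proof (induction rule: deg_le.induct)
  case (deg_le_const d c)
  have "wdeg_le (S - {i}) d l (\<lambda>z. coeff [:c:] l)" for l
    by (cases l) (auto simp: wdeg_le_def intro: deg_le.deg_le_const)
  then show ?case by (intro exI[of _ "\<lambda>_. [:c:]"]) auto
next
  case (deg_le_coord j d)
  show ?case
  proof (cases "j = i")
    case True
    have "wdeg_le (S - {i}) (Suc d) l (\<lambda>z. coeff [:0, 1:] l)" for l
      by (cases l; cases "l - 1") (auto simp: wdeg_le_def coeff_pCons intro: deg_le.deg_le_const)
    then show ?thesis using True by (intro exI[of _ "\<lambda>_. [:0, 1:]"]) auto
  next
    case False
    have "wdeg_le (S - {i}) (Suc d) l (\<lambda>z. coeff [:z $ j:] l)" for l
      using deg_le_coord False by (cases l) (auto simp: wdeg_le_def intro: deg_le.intros)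
    then show ?thesis using False by (intro exI[of _ "\<lambda>z. [:z $ j:]"]) auto
  qed
next
  case (deg_le_add d f g)
  then obtain P Q where
    "\<forall>z. f z = poly (P z) (z $ i)" "\<forall>z. degree (P z) \<le> d" "\<forall>l. wdeg_le (S - {i}) d l (\<lambda>z. coeff (P z) l)"
    "\<forall>z. g z = poly (Q z) (z $ i)" "\<forall>z. degree (Q z) \<le> d" "\<forall>l. wdeg_le (S - {i}) d l (\<lambda>z. coeff (Q z) l)"
    by blast
  then show ?case
    by (intro exI[of _ "\<lambda>z. P z + Q z"]) (auto intro: wdeg_le_add degree_add_le)
next
  case (deg_le_mult d f e g)
  then obtain P Q where PQ:
    "\<forall>z. f z = poly (P z) (z $ i)" "\<forall>z. degree (P z) \<le> d" "\<forall>l. wdeg_le (S - {i}) d l (\<lambda>z. coeff (P z) l)"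
    "\<forall>z. g z = poly (Q z) (z $ i)" "\<forall>z. degree (Q z) \<le> e" "\<forall>l. wdeg_le (S - {i}) e l (\<lambda>z. coeff (Q z) l)"
    by blast
  have "wdeg_le (S - {i}) (d + e) k (\<lambda>z. coeff (P z * Q z) k)" for k
    unfolding coeff_mult
  proof (rule wdeg_le_sum)
    fix a assume "a \<in> {..k}"
    then show "wdeg_le (S - {i}) (d + e) k (\<lambda>z. coeff (P z) a * coeff (Q z) (k - a))"
      using wdeg_le_mult[of "S - {i}" d a "\<lambda>z. coeff (P z) a" e "k - a" "\<lambda>z. coeff (Q z) (k - a)"] PQ
      by simp
  qed
  moreover have "degree (P z * Q z) \<le> d + e" for z
    using degree_mult_le[of "P z" "Q z"] PQ(2,5) by (meson add_mono le_trans)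
  ultimately show ?case using PQ
    by (intro exI[of _ "\<lambda>z. P z * Q z"]) auto
qed

text \<open>That the partial derivatives are polynomials gives the continuity needed by the inverse
  function theorem; that they vanish outside \<open>S\<close> gives the triangular shape of the
  Jacobian of the straightening map \<open>Phi\<close>.\<close>

lemma deg_le_gradient:
  assumes "deg_le S d f"
  shows "\<exists>g. (\<forall>i. is_poly S (g i)) \<and> (\<forall>i. i \<notin> S \<longrightarrow> g i = (\<lambda>_. 0)) \<and>
    (\<forall>z. (f has_derivative (\<lambda>h. \<Sum>i\<in>UNIV. g i z * h $ i)) (at z))"
  using assms
proof (induction rule: deg_le.induct)
  case (deg_le_const d c)
  show ?case by (rule exI[of _ "\<lambda>_ _. 0"]) (auto intro: is_poly_const)
next
  case (deg_le_coord j d)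
  have "((\<lambda>z. z $ j) has_derivative (\<lambda>h. \<Sum>i\<in>UNIV. (if i = j then 1 else 0) * h $ i)) (at z)"
    for z :: "complex ^ 'a"
    by (auto simp: if_distrib[of "\<lambda>x. x * _"] cong: if_cong
      intro!: bounded_linear_imp_has_derivative bounded_linear_vec_nth)
  then show ?case using deg_le_coord
    by (intro exI[of _ "\<lambda>i _. if i = j then 1 else 0"]) (auto intro: is_poly_const)
next
  case (deg_le_add d f g)
  then obtain F G where FG: "\<forall>i. is_poly S (F i)" "\<forall>i. i \<notin> S \<longrightarrow> F i = (\<lambda>_. 0)"
    "\<forall>z. (f has_derivative (\<lambda>h. \<Sum>i\<in>UNIV. F i z * h $ i)) (at z)"
    "\<forall>i. is_poly S (G i)" "\<forall>i. i \<notin> S \<longrightarrow> G i = (\<lambda>_. 0)"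
    "\<forall>z. (g has_derivative (\<lambda>h. \<Sum>i\<in>UNIV. G i z * h $ i)) (at z)" by blast
  have "((\<lambda>z. f z + g z) has_derivative (\<lambda>h. \<Sum>i\<in>UNIV. (F i z + G i z) * h $ i)) (at z)" for z
    using has_derivative_add[OF FG(3)[rule_format] FG(6)[rule_format], of z]
    by (simp add: distrib_right sum.distrib)
  then show ?case using FG by (intro exI[of _ "\<lambda>i z. F i z + G i z"]) (auto intro: is_poly_add)
next
  case (deg_le_mult d f e g)
  then obtain F G where FG: "\<forall>i. is_poly S (F i)" "\<forall>i. i \<notin> S \<longrightarrow> F i = (\<lambda>_. 0)"
    "\<forall>z. (f has_derivative (\<lambda>h. \<Sum>i\<in>UNIV. F i z * h $ i)) (at z)"
    "\<forall>i. is_poly S (G i)" "\<forall>i. i \<notin> S \<longrightarrow> G i = (\<lambda>_. 0)"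
    "\<forall>z. (g has_derivative (\<lambda>h. \<Sum>i\<in>UNIV. G i z * h $ i)) (at z)" by blast
  have "((\<lambda>z. f z * g z) has_derivative (\<lambda>h. \<Sum>i\<in>UNIV. (f z * G i z + F i z * g z) * h $ i)) (at z)"
    for z
  proof -
    have "(\<lambda>h. f z * (\<Sum>i\<in>UNIV. G i z * h $ i) + (\<Sum>i\<in>UNIV. F i z * h $ i) * g z) =
        (\<lambda>h. \<Sum>i\<in>UNIV. (f z * G i z + F i z * g z) * h $ i)"
      by (rule ext) (simp add: sum_distrib_left sum_distrib_right algebra_simps flip: sum.distrib)
    then show ?thesis
      using has_derivative_mult[OF FG(3)[rule_format] FG(6)[rule_format], of z] by simp
  qed
  moreover have "is_poly S f" "is_poly S g" using deg_le_mult.hyps by (auto intro: is_polyI)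
  then have "is_poly S (\<lambda>z. f z * G i z + F i z * g z)" for i
    using FG by (intro is_poly_add is_poly_mult) auto
  ultimately show ?case using FG
    by (intro exI[of _ "\<lambda>i z. f z * G i z + F i z * g z"]) simp
qed

lemma is_poly_continuous: "is_poly S f \<Longrightarrow> continuous_on A f"
  unfolding is_poly_def
  by (meson deg_le_gradient continuous_at_imp_continuous_on has_derivative_continuous)

lemma is_poly_line:
  assumes "is_poly S f"
  shows "\<exists>p. \<forall>s. f (a + s *s b) = poly p s"
proof -
  obtain d where "deg_le S d f" using assms by (auto simp: is_poly_def)
  then show ?thesis
  proof (induction rule: deg_le.induct)
    case (deg_le_const d c)
    then show ?case by (intro exI[of _ "[:c:]"]) simp
  next
    case (deg_le_coord i d)
    then show ?case by (intro exI[of _ "[:a $ i, b $ i:]"]) (simp add: mult.commute)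
  next
    case (deg_le_add d f g)
    then obtain p q where "\<forall>s. f (a + s *s b) = poly p s" "\<forall>s. g (a + s *s b) = poly q s"
      by blast
    then show ?case by (intro exI[of _ "p + q"]) simp
  next
    case (deg_le_mult d f e g)
    then obtain p q where "\<forall>s. f (a + s *s b) = poly p s" "\<forall>s. g (a + s *s b) = poly q s"
      by blast
    then show ?case by (intro exI[of _ "p * q"]) simp
  qed
qed

text \<open>On the line from \<open>w\<close> to \<open>y\<close> the function is a univariate
  polynomial that does not vanish at parameter \<open>1\<close>; its finitely many zeros cannot fill
  a disc.\<close>

lemma is_poly_nonzero_near:
  assumes f: "is_poly S f" and y: "f y \<noteq> 0" and e: "e > 0"
  shows "\<exists>s. norm s < e \<and> f (w + s *s (y - w)) \<noteq> 0"
proof -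
  obtain p where p: "\<And>s. f (w + s *s (y - w)) = poly p s"
    using is_poly_line[OF f] by blast
  have "poly p 1 = f y" using p[of 1] by simp
  then have "p \<noteq> 0" using y by auto
  then have "finite {s. poly p s = 0}" by (rule poly_roots_finite)
  moreover have "infinite (ball (0::complex) e)" using e
    by (simp add: uncountable_ball uncountable_infinite)
  ultimately have "\<not> ball 0 e \<subseteq> {s. poly p s = 0}" using finite_subset by blast
  then show ?thesis using p by (auto simp: subset_eq)
qed

section \<open>Determinants\<close>

text \<open>Matrices are indexed by \<open>nat\<close> because their size is a degree, hence a value
  and not a type.\<close>

definition detn :: "nat \<Rightarrow> (nat \<Rightarrow> nat \<Rightarrow> 'a) \<Rightarrow> 'a :: field" where
  "detn n A = Determinant.det (Matrix.mat n n (\<lambda>(i, j). A i j))"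

lemma detn_leibniz:
  "detn n A = (\<Sum>p | p permutes {0..<n}. signof p * (\<Prod>i = 0..<n. A i (p i)))"
proof -
  have "(\<Prod>i = 0..<n. Matrix.mat n n (\<lambda>(i, j). A i j) $$ (i, p i)) = (\<Prod>i = 0..<n. A i (p i))"
    if "p permutes {0..<n}" for p
    by (rule prod.cong) (use permutes_in_image[OF that] in auto)
  then show ?thesis
    unfolding detn_def by (subst det_def'[of _ n]) (auto intro!: sum.cong)
qed

lemma detn_zero_iff:
  "detn n A = 0 \<longleftrightarrow> (\<exists>x. (\<exists>i<n. x i \<noteq> 0) \<and> (\<forall>i<n. (\<Sum>j<n. A i j * x j) = 0))"
proof -
  let ?M = "Matrix.mat n n (\<lambda>(i, j). A i j)"
  have prod: "Matrix.vec_index (?M *\<^sub>v v) i = (\<Sum>j<n. A i j * Matrix.vec_index v j)"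
    if "v \<in> carrier_vec n" "i < n" for v i
    using that by (auto simp: scalar_prod_def atLeast0LessThan)
  have "detn n A = 0 \<longleftrightarrow> (\<exists>v\<in>carrier_vec n. v \<noteq> 0\<^sub>v n \<and> ?M *\<^sub>v v = 0\<^sub>v n)"
    unfolding detn_def by (subst det_0_iff_vec_prod_zero_field[of _ n]) auto
  also have "\<dots> \<longleftrightarrow> (\<exists>x. (\<exists>i<n. x i \<noteq> 0) \<and> (\<forall>i<n. (\<Sum>j<n. A i j * x j) = 0))"
  proof
    assume "\<exists>v\<in>carrier_vec n. v \<noteq> 0\<^sub>v n \<and> ?M *\<^sub>v v = 0\<^sub>v n"
    then obtain v where v: "v \<in> carrier_vec n" "v \<noteq> 0\<^sub>v n" "?M *\<^sub>v v = 0\<^sub>v n" by blast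
    have "\<exists>i<n. Matrix.vec_index v i \<noteq> 0"
    proof (rule ccontr)
      assume "\<not> ?thesis"
      then have "v = 0\<^sub>v n" using v(1) by (intro eq_vecI) auto
      then show False using v(2) by simp
    qed
    moreover have "(\<Sum>j<n. A i j * Matrix.vec_index v j) = 0" if "i < n" for i
      using prod[OF v(1) that] v(3) that by simp
    ultimately show "\<exists>x. (\<exists>i<n. x i \<noteq> 0) \<and> (\<forall>i<n. (\<Sum>j<n. A i j * x j) = 0)" by blast
  next
    assume "\<exists>x. (\<exists>i<n. x i \<noteq> 0) \<and> (\<forall>i<n. (\<Sum>j<n. A i j * x j) = 0)"
    then obtain x i where x: "i < n" "x i \<noteq> 0" "\<forall>i<n. (\<Sum>j<n. A i j * x j) = 0" by blast
    let ?v = "Matrix.vec n x"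
    have v: "?v \<in> carrier_vec n" by simp
    have "?v \<noteq> 0\<^sub>v n"
    proof
      assume "?v = 0\<^sub>v n"
      then have "Matrix.vec_index ?v i = Matrix.vec_index (0\<^sub>v n) i" by simp
      then show False using x(1,2) by simp
    qed
    moreover have "?M *\<^sub>v ?v = 0\<^sub>v n"
    proof (rule eq_vecI)
      fix i assume "i < dim_vec (0\<^sub>v n)"
      then have i: "i < n" by simp
      have "(\<Sum>j<n. A i j * Matrix.vec_index ?v j) = (\<Sum>j<n. A i j * x j)" by (rule sum.cong) auto
      then show "Matrix.vec_index (?M *\<^sub>v ?v) i = Matrix.vec_index (0\<^sub>v n) i"
        using prod[OF v i] x(3) i by simp
    qed simp
    ultimately show "\<exists>v\<in>carrier_vec n. v \<noteq> 0\<^sub>v n \<and> ?M *\<^sub>v v = 0\<^sub>v n" using v by blast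
  qed
  finally show ?thesis .
qed

lemma detn_cramer:
  assumes "k < n"
  shows "detn n (\<lambda>i j. if j = k then \<Sum>l<n. A i l * x l else A i j) = x k * detn n A"
proof -
  let ?M = "Matrix.mat n n (\<lambda>(i, j). A i j)" and ?v = "Matrix.vec n x"
  have "replace_col ?M (?M *\<^sub>v ?v) k =
      Matrix.mat n n (\<lambda>(i, j). if j = k then \<Sum>l<n. A i l * x l else A i j)"
    by (rule eq_matI) (auto simp: replace_col_def scalar_prod_def atLeast0LessThan intro!: sum.cong)
  then show ?thesis
    unfolding detn_def using cramer_lemma_mat[of ?M n ?v k] assms by simp
qed

lemma is_poly_detn:
  assumes "\<And>i j. i < n \<Longrightarrow> j < n \<Longrightarrow> is_poly S (\<lambda>z. A z i j)"
  shows "is_poly S (\<lambda>z. detn n (A z))"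
  unfolding detn_leibniz
proof (intro is_poly_sum is_poly_mult is_poly_const is_poly_prod)
  fix p i assume "p \<in> {p. p permutes {0..<n}}" "i \<in> {0..<n}"
  then show "is_poly S (\<lambda>z. A z i (p i))"
    using permutes_in_image[of p "{0..<n}" i] by (intro assms) auto
qed

text \<open>If the rows and columns carry weights \<open>\<omega>\<close>, an entry of degree at most
  \<open>1 + \<omega> i - \<omega> j\<close> (and zero where this is negative) gives a determinant of degree at most \<open>n\<close>.\<close>

lemma deg_le_detn_weighted:
  assumes A: "\<And>i j. i < n \<Longrightarrow> j < n \<Longrightarrow> wdeg_le S (Suc (\<omega> i)) (\<omega> j) (\<lambda>z. A z i j)"
  shows "deg_le S n (\<lambda>z. detn n (A z))"
  unfolding detn_leibniz
proof (rule deg_le_sum)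
  fix p assume "p \<in> {p. p permutes {0..<n}}"
  then have p: "p permutes {0..<n}" by simp
  have lt: "p i < n" if "i < n" for i using permutes_in_image[OF p] that by auto
  have "wdeg_le S (\<Sum>i = 0..<n. Suc (\<omega> i)) (\<Sum>i = 0..<n. \<omega> (p i)) (\<lambda>z. \<Prod>i = 0..<n. A z i (p i))"
  proof -
    have "wdeg_le S (\<Sum>i\<in>I. Suc (\<omega> i)) (\<Sum>i\<in>I. \<omega> (p i)) (\<lambda>z. \<Prod>i\<in>I. A z i (p i))"
      if "finite I" "I \<subseteq> {0..<n}" for I
      using that
    proof (induction I rule: finite_induct)
      case empty
      then show ?case by (auto simp: wdeg_le_def intro: deg_le_const)
    next
      case (insert a I)
      have "wdeg_le S (Suc (\<omega> a)) (\<omega> (p a)) (\<lambda>z. A z a (p a))"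
        using insert.prems by (intro A lt) auto
      from wdeg_le_mult[OF this insert.IH] insert show ?case by simp
    qed
    then show ?thesis by simp
  qed
  \<comment> \<open>A permutation of the columns leaves the total weight unchanged, so row and
    column weights cancel and only one unit of degree per row remains.\<close>
  moreover have "(\<Sum>i = 0..<n. \<omega> (p i)) = (\<Sum>i = 0..<n. \<omega> i)"
    using sum.permute[OF p, of \<omega>] by (simp add: comp_def)
  moreover have "(\<Sum>i = 0..<n. Suc (\<omega> i)) = n + (\<Sum>i = 0..<n. \<omega> i)" by (induction n) auto
  ultimately have "wdeg_le S (n + (\<Sum>i = 0..<n. \<omega> i)) (\<Sum>i = 0..<n. \<omega> i) (\<lambda>z. \<Prod>i = 0..<n. A z i (p i))"
    by simp
  then have "deg_le S n (\<lambda>z. \<Prod>i = 0..<n. A z i (p i))" using wdeg_le_imp_deg_le by fastforce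
  then show "deg_le S n (\<lambda>z. signof p * (\<Prod>i = 0..<n. A z i (p i)))" by (rule deg_le_cmult)
qed

section \<open>Families of univariate polynomials\<close>

text \<open>The bounds on the coefficients give the polynomial total degree \<open>d\<close> in
  parameter and unknown together, which is more than a monic equation. They survive the linear
  changes used below and make the leading form of the equation monic again, so that it controls the
  directions at infinity.\<close>

definition monic_family :: "'n set \<Rightarrow> nat \<Rightarrow> (complex ^ 'n \<Rightarrow> complex poly) \<Rightarrow> bool" where
  "monic_family S d H \<longleftrightarrow> (\<forall>z. degree (H z) = d \<and> coeff (H z) d = 1) \<and>
    (\<forall>l. wdeg_le S d l (\<lambda>z. coeff (H z) l))"

lemma monic_familyD:
  assumes "monic_family S d H"
  shows "degree (H z) = d" "coeff (H z) d = 1" "H z \<noteq> 0" "wdeg_le S d l (\<lambda>z. coeff (H z) l)"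
proof -
  show 1: "degree (H z) = d" "coeff (H z) d = 1" "wdeg_le S d l (\<lambda>z. coeff (H z) l)"
    using assms unfolding monic_family_def by blast+
  show "H z \<noteq> 0" using 1(2) by auto
qed

lemma monic_family_0:
  assumes "monic_family S 0 H" shows "H z = 1"
proof -
  obtain a where "H z = [:a:]" using monic_familyD(1)[OF assms] by (rule degree_eq_zeroE)
  then show ?thesis using monic_familyD(2)[OF assms, of z] by (simp add: one_pCons)
qed

lemma monic_family_cong:
  assumes "monic_family S d H" "\<And>i. i \<in> S \<Longrightarrow> z $ i = y $ i" shows "H z = H y"
proof (rule poly_eqI)
  fix l show "coeff (H z) l = coeff (H y) l"
    using wdeg_le_imp_deg_le[OF monic_familyD(4)[OF assms(1)]] assms(2) by (rule deg_le_cong_coord)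
qed

text \<open>Multiplying a remainder by the variable shifts its coefficients and, if degree
  \<open>d\<close> is reached, a multiple of \<open>H z\<close> is subtracted. As \<open>H z\<close>
  is monic no division occurs, and both operations respect the weights.\<close>

lemma wdeg_le_coeff_monom_mod:
  assumes H: "monic_family S d H"
  shows "wdeg_le S l b (\<lambda>z. coeff (monom 1 l mod H z) b)"
proof (induction l arbitrary: b)
  case 0
  have "coeff (monom 1 0 mod H z) b = (if d = 0 then 0 else if b = 0 then 1 else 0)" for z
  proof (cases "d = 0")
    case True
    then have "H z = 1" using monic_family_0 H by blast
    then show ?thesis using True by simp
  next
    case False
    then have "monom 1 0 mod H z = 1"
      using monic_familyD(1)[OF H, of z] by (simp add: mod_poly_less flip: one_poly_eq_simps(1))
    then show ?thesis using False by simp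
  qed
  then show ?case by (auto simp: wdeg_le_def intro: deg_le_const)
next
  case (Suc l)
  define r where "r z = monom 1 l mod H z" for z
  show ?case
  proof (cases "d = 0")
    case True
    then have "H z = 1" for z using monic_family_0 H by blast
    then have "monom 1 (Suc l) mod H z = 0" for z by simp
    then show ?thesis using wdeg_le_zero by simp
  next
    case False
    have eq: "monom 1 (Suc l) mod H z = pCons 0 (r z) - smult (coeff (r z) (d - 1)) (H z)" for z
    proof -
      let ?q = "pCons 0 (r z) - smult (coeff (r z) (d - 1)) (H z)"
      have r: "degree (r z) < d"
        using degree_mod_less[OF monic_familyD(3)[OF H], of "monom 1 l" z] monic_familyD(1)[OF H, of z] False
        by (auto simp: r_def)
      have "coeff ?q i = 0" if "i > d - 1" for i
      proof (cases "i = d")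
        case True
        then show ?thesis using False monic_familyD(2)[OF H, of z] by (cases d) (auto simp: coeff_pCons)
      next
        case i: False
        then have "i > d" using that by simp
        then show ?thesis using r monic_familyD(1)[OF H, of z]
          by (cases i) (auto simp: coeff_eq_0 coeff_pCons)
      qed
      then have "degree ?q \<le> d - 1" by (intro degree_le) auto
      then have q: "?q mod H z = ?q"
        using False monic_familyD(1)[OF H, of z] by (intro mod_poly_less) auto
      have "monom 1 (Suc l) mod H z = (monom 1 1 * monom 1 l) mod H z" by (simp add: mult_monom)
      also have "\<dots> = (monom 1 1 * r z) mod H z" by (simp add: r_def mod_mult_right_eq)
      also have "\<dots> = (?q + [:coeff (r z) (d - 1):] * H z) mod H z"
        by (simp add: monom_Suc monom_0)
      also have "\<dots> = ?q" using q by (simp only: mod_mult_self1)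
      finally show ?thesis .
    qed
    have 1: "wdeg_le S (Suc l) b (\<lambda>z. coeff (pCons 0 (r z)) b)"
    proof (cases b)
      case 0
      then show ?thesis using wdeg_le_zero by simp
    next
      case (Suc b')
      then show ?thesis using Suc.IH[of b'] by (simp add: r_def wdeg_le_def)
    qed
    have "wdeg_le S (l + d) (d - 1 + b) (\<lambda>z. coeff (r z) (d - 1) * coeff (H z) b)"
      using wdeg_le_mult[OF Suc.IH[of "d - 1"] monic_familyD(4)[OF H, of b]] by (simp add: r_def)
    \<comment> \<open>The coefficient of index \<open>d - 1\<close> is pushed over the top, and its
      weight \<open>l - (d - 1)\<close> and the weight \<open>d - b\<close> from \<open>H z\<close>
      add up to \<open>Suc l - b\<close>.\<close>
    moreover have "wdeg_le S (l + d) (d - 1 + b) g = wdeg_le S (Suc l) b g" for g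
    proof -
      have "(d - 1 + b \<le> l + d) = (b \<le> Suc l)" "l + d - (d - 1 + b) = Suc l - b"
        using False by linarith+
      then show ?thesis by (simp add: wdeg_le_def)
    qed
    ultimately have 2: "wdeg_le S (Suc l) b (\<lambda>z. coeff (r z) (d - 1) * coeff (H z) b)" by simp
    show ?thesis using wdeg_le_diff[OF 1 2] by (simp add: eq)
  qed
qed

section \<open>Multiplication modulo a monic polynomial\<close>

lemma poly_mod_sum: "(\<Sum>a\<in>A. f a) mod (h :: complex poly) = (\<Sum>a\<in>A. f a mod h)"
  by (induction A rule: infinite_finite_induct) (auto simp: poly_mod_add_left)

definition poly_family :: "'n set \<Rightarrow> nat \<Rightarrow> (complex ^ 'n \<Rightarrow> complex poly) \<Rightarrow> bool" where
  "poly_family S e F \<longleftrightarrow> (\<forall>z. degree (F z) \<le> e) \<and> (\<forall>l. is_poly S (\<lambda>z. coeff (F z) l))"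

lemma coeff_mod_expand:
  fixes p h :: "complex poly"
  assumes "degree p \<le> e"
  shows "coeff (p mod h) b = (\<Sum>l\<le>e. coeff p l * coeff (monom 1 l mod h) b)"
proof -
  have "p = (\<Sum>l\<le>e. smult (coeff p l) (monom 1 l))"
    using poly_as_sum_of_monoms'[OF assms] by (simp add: smult_monom)
  then have "p mod h = (\<Sum>l\<le>e. smult (coeff p l) (monom 1 l)) mod h" by (rule arg_cong)
  then show ?thesis by (simp only: poly_mod_sum mod_smult_left coeff_sum coeff_smult)
qed

lemma is_poly_coeff_mod:
  assumes H: "monic_family S d H" and F: "poly_family S e F"
  shows "is_poly S (\<lambda>z. coeff (F z mod H z) b)"
proof -
  have "coeff (F z mod H z) b = (\<Sum>l\<le>e. coeff (F z) l * coeff (monom 1 l mod H z) b)" for z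
    using F by (intro coeff_mod_expand) (simp add: poly_family_def)
  moreover have "is_poly S (\<lambda>z. \<Sum>l\<le>e. coeff (F z) l * coeff (monom 1 l mod H z) b)"
    using F wdeg_le_imp_deg_le[OF wdeg_le_coeff_monom_mod[OF H]]
    by (intro is_poly_sum is_poly_mult) (auto simp: poly_family_def intro: is_polyI)
  ultimately show ?thesis by simp
qed

lemma poly_family_mult:
  assumes "poly_family S d F" "poly_family S e G" shows "poly_family S (d + e) (\<lambda>z. F z * G z)"
proof -
  have "degree (F z * G z) \<le> d + e" for z
    using degree_mult_le[of "F z" "G z"] assms by (meson add_mono le_trans poly_family_def)
  moreover have "is_poly S (\<lambda>z. coeff (F z * G z) l)" for l
    unfolding coeff_mult using assms
    by (intro is_poly_sum is_poly_mult) (auto simp: poly_family_def)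
  ultimately show ?thesis by (simp add: poly_family_def)
qed

lemma poly_family_const: "degree p \<le> e \<Longrightarrow> poly_family S e (\<lambda>_. p)"
  by (auto simp: poly_family_def intro: is_poly_const)

lemma monic_family_imp_poly_family: "monic_family S d H \<Longrightarrow> poly_family S d H"
  unfolding poly_family_def using monic_familyD(1,4) is_polyI wdeg_le_imp_deg_le by fastforce

lemma poly_family_pderiv:
  assumes "poly_family S e F" shows "poly_family S e (\<lambda>z. pderiv (F z))"
proof -
  have "degree (pderiv (F z)) \<le> e" for z
    using assms by (metis degree_pderiv diff_le_self le_trans poly_family_def)
  moreover have "is_poly S (\<lambda>z. coeff (pderiv (F z)) l)" for l
    unfolding coeff_pderiv using assms by (intro is_poly_mult is_poly_const) (auto simp: poly_family_def)
  ultimately show ?thesis by (simp add: poly_family_def)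
qed

text \<open>The left side is a matrix times the vector \<open>x\<close>: the matrix of
  multiplication by \<open>p\<close> modulo \<open>h\<close> in the basis of monomials, applied to
  the polynomial with the coefficients \<open>x\<close>.\<close>

lemma sum_mod_mult_monom:
  fixes p h :: "complex poly"
  shows "(\<Sum>a<n. coeff (p * monom 1 a mod h) b * x a) = coeff (p * (\<Sum>a<n. monom (x a) a) mod h) b"
proof -
  have "p * (\<Sum>a<n. monom (x a) a) = (\<Sum>a<n. smult (x a) (p * monom 1 a))"
    by (simp add: sum_distrib_left smult_monom flip: mult_smult_right)
  then show ?thesis by (simp add: poly_mod_sum mod_smult_left coeff_sum mult.commute)
qed

lemma coeff_sum_monom: "coeff (\<Sum>a<n. monom (x a) a) k = (if k < n then x k else 0)"
  by (simp add: coeff_sum coeff_monom)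

lemma sum_monom_coeff:
  assumes "degree q < n" shows "(\<Sum>a<n. monom (coeff q a) a) = q"
  by (rule poly_eqI) (use assms in \<open>auto simp: coeff_sum_monom coeff_eq_0\<close>)

text \<open>The determinant is the norm of \<open>p\<close> in the algebra of polynomials modulo \<open>h\<close>.\<close>

lemma det_mult_mod_eq_0_iff:
  fixes p h :: "complex poly"
  assumes "h \<noteq> 0"
  shows "detn (degree h) (\<lambda>b a. coeff (p * monom 1 a mod h) b) = 0 \<longleftrightarrow>
    (\<exists>q. q \<noteq> 0 \<and> degree q < degree h \<and> h dvd p * q)"
proof
  assume "detn (degree h) (\<lambda>b a. coeff (p * monom 1 a mod h) b) = 0"
  then obtain x i where x: "i < degree h" "x i \<noteq> 0"
    "\<And>b. b < degree h \<Longrightarrow> (\<Sum>a<degree h. coeff (p * monom 1 a mod h) b * x a) = 0"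
    unfolding detn_zero_iff by blast
  define q where "q = (\<Sum>a<degree h. monom (x a) a)"
  have "coeff q i = x i" using x(1) by (simp add: q_def coeff_sum_monom)
  then have "q \<noteq> 0" using x(2) by auto
  moreover have "degree q < degree h"
    using x(1) by (intro degree_lessI) (auto simp: q_def coeff_sum_monom)
  moreover have "p * q mod h = 0"
  proof (rule poly_eqI)
    fix b
    have "degree (p * q mod h) < degree h" using x(1) degree_mod_less[OF assms, of "p * q"] by auto
    then show "coeff (p * q mod h) b = coeff 0 b"
      using x(3)[of b] unfolding sum_mod_mult_monom q_def[symmetric]
      by (cases "b < degree h") (auto simp: coeff_eq_0)
  qed
  ultimately show "\<exists>q. q \<noteq> 0 \<and> degree q < degree h \<and> h dvd p * q" by blast
next
  assume "\<exists>q. q \<noteq> 0 \<and> degree q < degree h \<and> h dvd p * q"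
  then obtain q where q: "q \<noteq> 0" "degree q < degree h" "h dvd p * q" by blast
  have "(\<Sum>a<degree h. coeff (p * monom 1 a mod h) b * coeff q a) = 0" for b
    unfolding sum_mod_mult_monom sum_monom_coeff[OF q(2)] using q(3) by simp
  moreover have "coeff q (degree q) \<noteq> 0" using q(1) by simp
  ultimately show "detn (degree h) (\<lambda>b a. coeff (p * monom 1 a mod h) b) = 0"
    unfolding detn_zero_iff using q(2) by blast
qed

text \<open>A root of \<open>h\<close> is not a root of \<open>p\<close>, so it is one of
  \<open>q\<close>, and a linear factor can be cancelled from both \<open>h\<close> and
  \<open>q\<close>.\<close>

lemma dvd_of_no_common_root:
  fixes h p q :: "complex poly"
  assumes "\<And>t. poly h t = 0 \<Longrightarrow> poly p t \<noteq> 0" "h dvd p * q" "h \<noteq> 0"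
  shows "h dvd q"
  using assms
proof (induction "degree h" arbitrary: h q)
  case 0
  then show ?case by (simp add: is_unit_iff_degree unit_imp_dvd)
next
  case (Suc n)
  then obtain t where t: "poly h t = 0"
    using alg_closed_imp_poly_has_root[of h] by auto
  then obtain h1 where h1: "h = [:-t, 1:] * h1" unfolding poly_eq_0_iff_dvd by (rule dvdE)
  have "poly (p * q) t = 0" using Suc.prems(2) t by (meson dvd_trans poly_eq_0_iff_dvd)
  then have "poly q t = 0" using Suc.prems(1)[OF t] by simp
  then obtain q1 where q1: "q = [:-t, 1:] * q1" unfolding poly_eq_0_iff_dvd by (rule dvdE)
  have nz: "h1 \<noteq> 0" "[:-t, 1:] \<noteq> 0" using Suc.prems(3) h1 by auto
  have "h1 dvd q1"
  proof (rule Suc.hyps(1))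
    have "degree h = degree [:-t, 1:] + degree h1" unfolding h1 using nz by (intro degree_mult_eq) auto
    then show "n = degree h1" using Suc.hyps(2) by simp
    show "poly p u \<noteq> 0" if "poly h1 u = 0" for u
      by (rule Suc.prems(1)) (simp add: h1 that)
    have "[:-t, 1:] * h1 dvd [:-t, 1:] * (p * q1)"
      using Suc.prems(2) unfolding h1 q1 by (simp only: mult.left_commute)
    then have "[:-t, 1:] = 0 \<or> h1 dvd p * q1" by (simp only: dvd_mult_cancel_left)
    then show "h1 dvd p * q1" using nz(2) by blast
  qed (use nz in auto)
  then show ?case unfolding h1 q1 by (rule mult_dvd_mono[OF dvd_refl])
qed

lemma det_mult_mod_eq_0_iff_common_root:
  fixes p h :: "complex poly"
  assumes "h \<noteq> 0"
  shows "detn (degree h) (\<lambda>b a. coeff (p * monom 1 a mod h) b) = 0 \<longleftrightarrow>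
    (\<exists>t. poly h t = 0 \<and> poly p t = 0)"
  unfolding det_mult_mod_eq_0_iff[OF assms]
proof
  assume "\<exists>q. q \<noteq> 0 \<and> degree q < degree h \<and> h dvd p * q"
  then obtain q where q: "q \<noteq> 0" "degree q < degree h" "h dvd p * q" by blast
  show "\<exists>t. poly h t = 0 \<and> poly p t = 0"
  proof (rule ccontr)
    assume "\<not> ?thesis"
    then have "poly h t = 0 \<Longrightarrow> poly p t \<noteq> 0" for t by blast
    then have "h dvd q" using q(3) assms by (rule dvd_of_no_common_root)
    then have "degree h \<le> degree q" using q(1) by (rule dvd_imp_degree_le)
    then show False using q(2) by simp
  qed
next
  assume "\<exists>t. poly h t = 0 \<and> poly p t = 0"
  then obtain t where t: "[:-t, 1:] dvd h" "[:-t, 1:] dvd p" unfolding poly_eq_0_iff_dvd by blast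
  \<comment> \<open>The cofactor of the common linear factor in \<open>h\<close> is the required
    \<open>q\<close>: its product with \<open>p\<close> is \<open>h * p1\<close>.\<close>
  obtain h1 where h1: "h = [:-t, 1:] * h1" using t(1) by (rule dvdE)
  obtain p1 where p1: "p = [:-t, 1:] * p1" using t(2) by (rule dvdE)
  have "h1 \<noteq> 0" using h1 assms by auto
  moreover have "degree h = Suc (degree h1)" using h1 \<open>h1 \<noteq> 0\<close> by (simp add: degree_mult_eq del: mult_pCons_left)
  moreover have "h dvd p * h1" 
  proof -
    have "p * h1 = h * p1" unfolding h1 p1 by (simp only: mult.assoc mult.commute mult.left_commute)
    then show ?thesis by simp
  qed
  ultimately show "\<exists>q. q \<noteq> 0 \<and> degree q < degree h \<and> h dvd p * q" by auto
qed

section \<open>Finite projections and Noether normalization\<close>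

definition upd :: "complex ^ 'n \<Rightarrow> 'n \<Rightarrow> complex \<Rightarrow> complex ^ 'n" where
  "upd y i t = (\<chi> j. if j = i then t else y $ j)"

lemma upd_nth [simp]: "upd y i t $ j = (if j = i then t else y $ j)"
  by (simp add: upd_def)

lemma norm_upd: "norm (upd z i t - z) = norm (t - z $ i)"
proof -
  have "upd z i t - z = axis i (t - z $ i)" by (auto simp: vec_eq_iff axis_def)
  then show ?thesis by (simp add: norm_eq_sqrt_inner inner_axis_axis)
qed

lemma poly_family_cong:
  assumes "poly_family S d H" "\<And>i. i \<in> S \<Longrightarrow> z $ i = y $ i" shows "H z = H y"
proof (rule poly_eqI)
  fix l
  have "is_poly S (\<lambda>z. coeff (H z) l)" using assms(1) by (simp add: poly_family_def)
  then show "coeff (H z) l = coeff (H y) l" using assms(2) by (rule is_poly_cong_coord)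
qed

definition integral_over :: "(complex ^ 'n) set \<Rightarrow> 'n set \<Rightarrow> 'n \<Rightarrow> bool" where
  "integral_over X S i \<longleftrightarrow> (\<exists>d H. monic_family S d H \<and> (\<forall>z\<in>X. poly (H z) (z $ i) = 0))"

text \<open>The projection of \<open>X\<close> to the coordinates in \<open>S\<close> is Zariski
  closed. Vectors indexed by \<open>S\<close> have no type of their own; only the coordinates in
  \<open>S\<close> of the point \<open>y\<close> matter.\<close>

definition closed_image :: "(complex ^ 'n) set \<Rightarrow> 'n set \<Rightarrow> bool" where
  "closed_image X S \<longleftrightarrow> (\<forall>y. (\<forall>z\<in>X. \<exists>i\<in>S. z $ i \<noteq> y $ i) \<longrightarrow>
    (\<exists>f. is_poly S f \<and> (\<forall>z\<in>X. f z = 0) \<and> f y \<noteq> 0))"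

definition finite_projection :: "(complex ^ 'n) set \<Rightarrow> 'n set \<Rightarrow> bool" where
  "finite_projection X S \<longleftrightarrow> closed_image X S \<and> (\<forall>i. i \<notin> S \<longrightarrow> integral_over X S i)"

text \<open>A space over an infinite field is not a finite union of proper subspaces: with
  \<open>f\<close> nonzero on \<open>R\<close> and \<open>g\<close> nonzero at the new point
  \<open>r\<close>, each point excludes at most one value of \<open>c\<close>.\<close>

lemma nonvanishing_combination:
  fixes V :: "('a \<Rightarrow> complex) set"
  assumes "finite R" "V \<noteq> {}"
    and "\<And>f g c. f \<in> V \<Longrightarrow> g \<in> V \<Longrightarrow> (\<lambda>z. f z + c * g z) \<in> V"
    and "\<And>r. r \<in> R \<Longrightarrow> \<exists>f\<in>V. f r \<noteq> 0"
  shows "\<exists>f\<in>V. \<forall>r\<in>R. f r \<noteq> 0"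
  using assms(1,4)
proof (induction R rule: finite_induct)
  case empty
  then show ?case using assms(2) by blast
next
  case (insert r R)
  have "\<exists>f\<in>V. \<forall>r\<in>R. f r \<noteq> 0" by (rule insert.IH) (simp add: insert.prems)
  then obtain f where f: "f \<in> V" "\<forall>r\<in>R. f r \<noteq> 0" by blast
  obtain g where g: "g \<in> V" "g r \<noteq> 0" using insert.prems[of r] by auto
  have "finite (\<Union>x\<in>insert r R. {c. f x + c * g x = 0})"
  proof (intro finite_UN_I)
    fix x assume x: "x \<in> insert r R"
    show "finite {c. f x + c * g x = 0}"
    proof (cases "g x = 0")
      case True
      then have "f x \<noteq> 0" using x f(2) g(2) by auto
      then show ?thesis using True by simp
    next
      case False
      have "{c. f x + c * g x = 0} \<subseteq> {- f x / g x}"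
        using False by (auto simp: field_simps add_eq_0_iff)
      then show ?thesis using finite_subset by blast
    qed
  qed (use insert in auto)
  then obtain c where c: "c \<notin> (\<Union>x\<in>insert r R. {c. f x + c * g x = 0})"
    using infinite_UNIV_char_0 ex_new_if_finite by blast
  show ?case
    by (rule bexI[of _ "\<lambda>z. f z + c * g z"]) (use c assms(3)[OF f(1) g(1)] in auto)
qed

text \<open>The norm of a polynomial vanishing on \<open>X\<close>, taken along the monic equation of the
  eliminated coordinate, vanishes on \<open>X\<close> and no longer involves that coordinate.\<close>

lemma closed_image_eliminate:
  assumes X: "closed_image X S" and i: "i \<in> S" and int: "integral_over X (S - {i}) i"
  shows "closed_image X (S - {i})"
  unfolding closed_image_def
proof (intro allI impI)
  fix y
  assume y: "\<forall>z\<in>X. \<exists>j\<in>S - {i}. z $ j \<noteq> y $ j"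
  obtain d H where H: "monic_family (S - {i}) d H" "\<And>z. z \<in> X \<Longrightarrow> poly (H z) (z $ i) = 0"
    using int by (auto simp: integral_over_def)
  define V where "V = {f. is_poly S f \<and> (\<forall>z\<in>X. f z = 0)}"
  \<comment> \<open>The points over \<open>y\<close> that satisfy the monic equation. One
    \<open>f\<close> has to be nonzero at all of them, since the norm at \<open>y\<close> vanishes
    as soon as \<open>f\<close> vanishes at one.\<close>
  define R where "R = upd y i ` {t. poly (H y) t = 0}"
  have "\<exists>f\<in>V. \<forall>r\<in>R. f r \<noteq> 0"
  proof (rule nonvanishing_combination)
    show "finite R" unfolding R_def
      by (intro finite_imageI poly_roots_finite monic_familyD(3)[OF H(1)])
    show "V \<noteq> {}" unfolding V_def using is_poly_const[of S 0] by blast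
    show "(\<lambda>z. f z + c * g z) \<in> V" if "f \<in> V" "g \<in> V" for f g c
      using that is_poly_add[of S f "\<lambda>z. c * g z"] is_poly_mult[OF is_poly_const, of S g c]
      unfolding V_def by auto
    fix r assume "r \<in> R"
    then have "\<forall>j\<in>S - {i}. r $ j = y $ j" by (auto simp: R_def split: if_splits)
    then have "\<exists>j\<in>S. z $ j \<noteq> r $ j" if "z \<in> X" for z using bspec[OF y that] by auto
    then show "\<exists>f\<in>V. f r \<noteq> 0" using X unfolding closed_image_def V_def by blast
  qed
  then obtain f where f: "is_poly S f" "\<And>z. z \<in> X \<Longrightarrow> f z = 0" "\<And>r. r \<in> R \<Longrightarrow> f r \<noteq> 0"
    unfolding V_def by blast
  obtain e where "deg_le S e f" using f(1) by (auto simp: is_poly_def)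
  then obtain Q where Q: "\<And>z. f z = poly (Q z) (z $ i)" "\<And>z. degree (Q z) \<le> e"
    "\<And>l. wdeg_le (S - {i}) e l (\<lambda>z. coeff (Q z) l)"
    using deg_le_univariate[of S e f i] by blast
  have fam: "poly_family (S - {i}) e Q"
    unfolding poly_family_def using Q(2) is_polyI[OF wdeg_le_imp_deg_le[OF Q(3)]] by blast
  define N where "N z = detn d (\<lambda>b a. coeff (Q z * monom 1 a mod H z) b)" for z
  have N0: "N z = 0 \<longleftrightarrow> (\<exists>t. poly (H z) t = 0 \<and> poly (Q z) t = 0)" for z
    using det_mult_mod_eq_0_iff_common_root[OF monic_familyD(3)[OF H(1)], where z1 = z and p = "Q z"]
    unfolding monic_familyD(1)[OF H(1)] N_def by simp
  have "is_poly (S - {i}) N"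
    unfolding N_def
  proof (rule is_poly_detn)
    show "is_poly (S - {i}) (\<lambda>z. coeff (Q z * monom 1 a mod H z) b)" for a b
      by (rule is_poly_coeff_mod[OF H(1) poly_family_mult[OF fam
              poly_family_const[OF degree_monom_le]]])
  qed
  moreover have "N z = 0" if "z \<in> X" for z
    unfolding N0 using f(2)[OF that] H(2)[OF that] Q(1)[of z] by auto
  moreover have "N y \<noteq> 0"
  proof
    assume "N y = 0"
    then obtain t where t: "poly (H y) t = 0" "poly (Q y) t = 0" unfolding N0 by blast
    have "Q (upd y i t) = Q y" by (rule poly_family_cong[OF fam]) auto
    then have "f (upd y i t) = 0" using Q(1)[of "upd y i t"] t(2) by simp
    then show False using f(3) t(1) unfolding R_def by blast
  qed
  ultimately show "\<exists>f. is_poly (S - {i}) f \<and> (\<forall>z\<in>X. f z = 0) \<and> f y \<noteq> 0" by blast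
qed

lemma deg_le_0_const:
  assumes "deg_le S 0 f" shows "f z = f y"
proof -
  have "deg_le S d f \<Longrightarrow> d = 0 \<Longrightarrow> f z = f y" for d by (induction rule: deg_le.induct) auto
  then show ?thesis using assms by blast
qed

text \<open>Substituting \<open>t = 1 / x\<close> and multiplying by \<open>x ^ n\<close> turns the
  determinant into that of the unit matrix minus \<open>x\<close> times \<open>M\<close>. The
  equality of \<open>r\<close> and \<open>s\<close> extends to \<open>x = 0\<close> by continuity,
  where it reads \<open>coeff q n = 1\<close>.\<close>

lemma detn_char_poly_leading:
  fixes q :: "complex poly"
  assumes "\<And>t. poly q t = detn n (\<lambda>i j. (if i = j then t else 0) - M i j)" "degree q \<le> n"
  shows "coeff q n = 1"
proof -
  define r where "r x = (\<Sum>l\<le>n. coeff q l * x ^ (n - l))" for x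
  define s where "s x = detn n (\<lambda>i j. (if i = j then 1 else 0) - x * M i j)" for x
  have "r x = s x" if "x \<noteq> 0" for x
  proof -
    have "poly q (1 / x) = poly (\<Sum>l\<le>n. monom (coeff q l) l) (1 / x)"
      by (simp only: poly_as_sum_of_monoms'[OF assms(2)])
    then have q: "poly q (1 / x) = (\<Sum>l\<le>n. coeff q l * (1 / x) ^ l)"
      by (simp only: poly_sum poly_monom)
    have "r x = x ^ n * poly q (1 / x)"
      unfolding r_def q sum_distrib_left
      by (rule sum.cong) (use that in \<open>auto simp: power_diff power_one_over field_simps\<close>)
    also have "\<dots> = (\<Sum>p | p permutes {0..<n}. x ^ n * (signof p *
        (\<Prod>i = 0..<n. (if i = p i then 1 / x else 0) - M i (p i))))"
      unfolding assms(1) detn_leibniz sum_distrib_left ..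
    also have "\<dots> = s x"
      unfolding s_def detn_leibniz
    proof (rule sum.cong)
      fix p
      have "x ^ n * (\<Prod>i = 0..<n. (if i = p i then 1 / x else 0) - M i (p i)) =
          (\<Prod>i = 0..<n. x * ((if i = p i then 1 / x else 0) - M i (p i)))"
        by (simp add: prod.distrib)
      also have "\<dots> = (\<Prod>i = 0..<n. (if i = p i then 1 else 0) - x * M i (p i))"
        by (rule prod.cong) (use that in \<open>auto simp: field_simps\<close>)
      finally show "x ^ n * (signof p * (\<Prod>i = 0..<n. (if i = p i then 1 / x else 0) - M i (p i))) =
          signof p * (\<Prod>i = 0..<n. (if i = p i then 1 else 0) - x * M i (p i))"
        by (simp add: mult.left_commute)
    qed simp
    finally show ?thesis .
  qed
  then have "(s \<longlongrightarrow> r 0) (at 0)"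
  proof -
    have "(r \<longlongrightarrow> r 0) (at 0)" unfolding r_def by (intro tendsto_intros)
    then show ?thesis
      by (rule Lim_transform_eventually) (auto simp: eventually_at_filter \<open>\<And>x. x \<noteq> 0 \<Longrightarrow> r x = s x\<close>)
  qed
  moreover have "(s \<longlongrightarrow> s 0) (at 0)" unfolding s_def detn_leibniz by (intro tendsto_intros)
  ultimately have "r 0 = s 0" using tendsto_unique at_neq_bot by blast
  moreover have "r 0 = coeff q n"
  proof -
    have "r 0 = (\<Sum>l\<in>{n}. coeff q l * 0 ^ (n - l))" unfolding r_def
      by (rule sum.mono_neutral_right) auto
    then show ?thesis by simp
  qed
  moreover have "s 0 = 1"
  proof -
    have "Matrix.mat n n (\<lambda>(i, j). (if i = j then 1 else 0) - 0 * M i j) = 1\<^sub>m n"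
      by (rule eq_matI) auto
    then show ?thesis by (simp add: s_def detn_def)
  qed
  ultimately show ?thesis by simp
qed

lemma wdeg_le_mono_set: "wdeg_le S d l f \<Longrightarrow> S \<subseteq> T \<Longrightarrow> wdeg_le T d l f"
  by (auto simp: wdeg_le_def intro: deg_le_mono_set)

lemma integral_over_empty: "integral_over {} S i"
proof -
  have "monic_family S 0 (\<lambda>_. 1)"
    by (auto simp: monic_family_def wdeg_le_def coeff_1 intro: deg_le_const)
  then show ?thesis unfolding integral_over_def by blast
qed

text \<open>The monomials \<open>(z $ i) ^ a * (z $ j) ^ b\<close> with \<open>a < d\<close>, \<open>b < e\<close> span a module which is
  stable under multiplication by \<open>z $ j\<close>, so \<open>z $ j\<close> is an eigenvalue of a matrix of polynomials in
  the coordinates \<open>S\<close>; the weights of the monomials control the degrees.\<close>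

lemma integral_over_trans:
  assumes i: "i \<notin> S" "j \<notin> S" "i \<noteq> j"
    and inti: "integral_over X S i" and intj: "integral_over X (insert i S) j"
  shows "integral_over X S j"
proof (cases "X = {}")
  case True
  then show ?thesis using integral_over_empty by simp
next
  case False
  obtain d h where h: "monic_family S d h" "\<And>z. z \<in> X \<Longrightarrow> poly (h z) (z $ i) = 0"
    using inti by (auto simp: integral_over_def)
  obtain e H where H: "monic_family (insert i S) e H" "\<And>z. z \<in> X \<Longrightarrow> poly (H z) (z $ j) = 0"
    using intj by (auto simp: integral_over_def)
  obtain x where x: "x \<in> X" using False by blast
  have d: "d > 0" using h(2)[OF x] monic_family_0[of S h] h(1) by (cases d) auto
  have e: "e > 0" using H(2)[OF x] monic_family_0[of "insert i S" H] H(1) by (cases e) auto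
  define N where "N = d * e"
  \<comment> \<open>The index \<open>s\<close> encodes the monomial with exponents
    \<open>s div e\<close> and \<open>s mod e\<close>; \<open>\<omega> s\<close> is its total
    degree.\<close>
  define \<omega> where "\<omega> s = s div e + s mod e" for s
  define \<beta> where "\<beta> s z = (z $ i) ^ (s div e) * (z $ j) ^ (s mod e)" for s and z :: "complex ^ 'a"
  \<comment> \<open>On \<open>X\<close> the function \<open>q\<close> is a combination of the
    monomials with coefficients in the coordinates \<open>S\<close>, of total degree at most
    \<open>n\<close> if \<open>\<beta> s\<close> counts with degree
    \<open>\<omega> s\<close>.\<close>
  define Rep where "Rep n q \<longleftrightarrow> (\<exists>m. (\<forall>s<N. wdeg_le S n (\<omega> s) (m s)) \<and>
    (\<forall>z\<in>X. q z = (\<Sum>s<N. m s z * \<beta> s z)))" for n q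
  have N: "N > 0" using d e by (simp add: N_def)
  have Rep_cong: "Rep n q'" if "Rep n q" "\<And>z. z \<in> X \<Longrightarrow> q z = q' z" for n q q'
    using that unfolding Rep_def by simp
  have Rep_zero: "Rep n (\<lambda>_. 0)" for n
    unfolding Rep_def by (rule exI[of _ "\<lambda>_ _. 0"]) (simp add: wdeg_le_zero)
  have Rep_add: "Rep n (\<lambda>z. q z + q' z)" if "Rep n q" "Rep n q'" for n q q'
  proof -
    obtain m m' where "\<forall>s<N. wdeg_le S n (\<omega> s) (m s)" "\<forall>z\<in>X. q z = (\<Sum>s<N. m s z * \<beta> s z)"
      "\<forall>s<N. wdeg_le S n (\<omega> s) (m' s)" "\<forall>z\<in>X. q' z = (\<Sum>s<N. m' s z * \<beta> s z)"
      using \<open>Rep n q\<close> \<open>Rep n q'\<close> unfolding Rep_def by blast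
    then show ?thesis unfolding Rep_def
      by (intro exI[of _ "\<lambda>s z. m s z + m' s z"]) (simp add: wdeg_le_add distrib_right sum.distrib)
  qed
  have Rep_sum: "Rep n (\<lambda>z. \<Sum>a\<in>A. q a z)" if "\<And>a. a \<in> A \<Longrightarrow> Rep n (q a)" for n q and A :: "nat set"
    using that by (induction A rule: infinite_finite_induct) (auto intro: Rep_zero Rep_add)
  have Rep_mult: "Rep (k + n) (\<lambda>z. c z * q z)" if "deg_le S k c" "Rep n q" for k n c q
  proof -
    obtain m where m: "\<forall>s<N. wdeg_le S n (\<omega> s) (m s)" "\<forall>z\<in>X. q z = (\<Sum>s<N. m s z * \<beta> s z)"
      using \<open>Rep n q\<close> unfolding Rep_def by blast
    have "wdeg_le S k 0 c" using that(1) by (simp add: wdeg_le_def)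
    then have "wdeg_le S (k + n) (\<omega> s) (\<lambda>z. c z * m s z)" if "s < N" for s
      using wdeg_le_mult[of S k 0 c n "\<omega> s" "m s"] m(1) that by simp
    then show ?thesis unfolding Rep_def using m(2)
      by (intro exI[of _ "\<lambda>s z. c z * m s z"]) (simp add: sum_distrib_left mult.assoc)
  qed
  have Rep_wmult: "Rep n (\<lambda>z. c z * q z)" if "wdeg_le S n l c" "Rep l q" for l n c q
  proof (cases "l \<le> n")
    case True
    then show ?thesis using Rep_mult[of "n - l" c l q] that by (simp add: wdeg_le_def)
  next
    case False
    then have "c = (\<lambda>_. 0)" using that(1) by (simp add: wdeg_le_def)
    then show ?thesis using Rep_zero by simp
  qed
  have Rep_basis: "Rep (\<omega> s) (\<beta> s)" if "s < N" for s
  proof -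
    have "wdeg_le S (\<omega> s) (\<omega> t) (\<lambda>_. if t = s then 1 else 0)" for t
      by (auto simp: wdeg_le_def intro: deg_le_const)
    moreover have "(\<Sum>t<N. (if t = s then 1 else 0) * \<beta> t z) = \<beta> s z" for z
    proof -
      have "(\<Sum>t<N. (if t = s then 1 else 0) * \<beta> t z) = (\<Sum>t<N. if t = s then \<beta> t z else 0)"
        by (rule sum.cong) auto
      then show ?thesis using that by simp
    qed
    ultimately show ?thesis unfolding Rep_def
      by (intro exI[of _ "\<lambda>t _. if t = s then 1 else 0"]) simp
  qed
  have Rep_mon: "Rep (a + b) (\<lambda>z. (z $ i) ^ a * (z $ j) ^ b)" if "a < d" "b < e" for a b
  proof -
    have "a * e + b < N"
    proof -
      have "a * e + b < Suc a * e" using that by simp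
      also have "\<dots> \<le> N" unfolding N_def using that by (intro mult_le_mono1) simp
      finally show ?thesis .
    qed
    moreover have "(a * e + b) div e = a" "(a * e + b) mod e = b" using that by auto
    ultimately show ?thesis using Rep_basis[of "a * e + b"] by (simp add: \<omega>_def \<beta>_def[abs_def])
  qed
  have Rep_pow: "Rep (l + b) (\<lambda>z. (z $ i) ^ l * (z $ j) ^ b)" if b: "b < e" for l b
  proof (rule Rep_cong)
    show "Rep (l + b) (\<lambda>z. \<Sum>a<d. coeff (monom 1 l mod h z) a * ((z $ i) ^ a * (z $ j) ^ b))"
    proof (rule Rep_sum)
      fix a assume a: "a \<in> {..<d}"
      show "Rep (l + b) (\<lambda>z. coeff (monom 1 l mod h z) a * ((z $ i) ^ a * (z $ j) ^ b))"
      proof (rule Rep_wmult)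
        show "wdeg_le S (l + b) (a + b) (\<lambda>z. coeff (monom 1 l mod h z) a)"
          using wdeg_le_coeff_monom_mod[OF h(1), of l a] by (simp add: wdeg_le_def)
        show "Rep (a + b) (\<lambda>z. (z $ i) ^ a * (z $ j) ^ b)" using a b by (intro Rep_mon) auto
      qed
    qed
    fix z assume z: "z \<in> X"
    have "degree (monom 1 l mod h z) < d"
      using degree_mod_less[OF monic_familyD(3)[OF h(1)], of "monom 1 l" z] monic_familyD(1)[OF h(1), of z] d
      by auto
    then have "(\<Sum>a<d. monom (coeff (monom 1 l mod h z) a) a) = monom 1 l mod h z"
      by (rule sum_monom_coeff)
    then have "poly (monom 1 l mod h z) (z $ i) = poly (\<Sum>a<d. monom (coeff (monom 1 l mod h z) a) a) (z $ i)"
      by simp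
    also have "\<dots> = (\<Sum>a<d. coeff (monom 1 l mod h z) a * (z $ i) ^ a)"
      by (simp only: poly_sum poly_monom)
    finally have "(\<Sum>a<d. coeff (monom 1 l mod h z) a * (z $ i) ^ a) = poly (monom 1 l mod h z) (z $ i)" ..
    also have "\<dots> = poly (monom 1 l) (z $ i)"
    proof -
      have "poly (monom 1 l) (z $ i) = poly (h z * (monom 1 l div h z) + monom 1 l mod h z) (z $ i)"
        by simp
      then show ?thesis by (simp only: poly_add poly_mult h(2)[OF z] mult_zero_left add_0)
    qed
    finally show "(\<Sum>a<d. coeff (monom 1 l mod h z) a * ((z $ i) ^ a * (z $ j) ^ b)) = (z $ i) ^ l * (z $ j) ^ b"
      by (simp add: poly_monom mult.assoc[symmetric] sum_distrib_right[symmetric])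
  qed
  have Rep_deg_le: "Rep (n + b) (\<lambda>z. f z * (z $ j) ^ b)" if f: "deg_le (insert i S) n f" and b: "b < e" for n b f
  proof -
    obtain Q where Q: "\<forall>z. f z = poly (Q z) (z $ i)" "\<forall>z. degree (Q z) \<le> n"
      "\<forall>l. wdeg_le (insert i S - {i}) n l (\<lambda>z. coeff (Q z) l)"
      using deg_le_univariate[OF f, of i] by blast
    have S: "insert i S - {i} = S" using i by auto
    show ?thesis
    proof (rule Rep_cong)
      show "Rep (n + b) (\<lambda>z. \<Sum>l\<le>n. coeff (Q z) l * ((z $ i) ^ l * (z $ j) ^ b))"
      proof (rule Rep_sum)
        fix l
        show "Rep (n + b) (\<lambda>z. coeff (Q z) l * ((z $ i) ^ l * (z $ j) ^ b))"
        proof (rule Rep_wmult)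
          show "wdeg_le S (n + b) (l + b) (\<lambda>z. coeff (Q z) l)"
            using Q(3)[rule_format, of l] unfolding S by (simp add: wdeg_le_def)
          show "Rep (l + b) (\<lambda>z. (z $ i) ^ l * (z $ j) ^ b)" using b by (rule Rep_pow)
        qed
      qed
      fix z
      have "f z = poly (\<Sum>l\<le>n. monom (coeff (Q z) l) l) (z $ i)"
        using Q(1,2) by (simp only: poly_as_sum_of_monoms')
      also have "\<dots> = (\<Sum>l\<le>n. coeff (Q z) l * (z $ i) ^ l)" by (simp only: poly_sum poly_monom)
      finally show "(\<Sum>l\<le>n. coeff (Q z) l * ((z $ i) ^ l * (z $ j) ^ b)) = f z * (z $ j) ^ b"
        by (simp add: mult.assoc[symmetric] sum_distrib_right[symmetric])
    qed
  qed
  have Rep_step: "Rep (Suc (\<omega> s)) (\<lambda>z. z $ j * \<beta> s z)" if s: "s < N" for s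
  proof -
    define a b where "a = s div e" and "b = s mod e"
    have ab: "a < d" "b < e" using s e unfolding a_def b_def N_def
      by (auto simp: less_mult_imp_div_less)
    show ?thesis
    proof (cases "Suc b < e")
      case True
      have "(\<lambda>z. z $ j * \<beta> s z) = (\<lambda>z. (z $ i) ^ a * (z $ j) ^ Suc b)"
        by (simp add: \<beta>_def a_def b_def mult_ac)
      then show ?thesis using Rep_mon[OF ab(1) True] by (simp add: \<omega>_def a_def b_def)
    next
      case False
      then have b: "Suc b = e" using ab by simp
      \<comment> \<open>The exponent of \<open>z $ j\<close> overflows to \<open>e\<close>, and the
        equation \<open>H\<close> lowers it again. The coefficients of \<open>H\<close> involve
        \<open>z $ i\<close>, whose powers \<open>Rep_deg_le\<close> reduces by means of
        \<open>h\<close>.\<close>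
      have "Rep (Suc (\<omega> s)) (\<lambda>z. \<Sum>l<e. (- (coeff (H z) l) * (z $ i) ^ a) * (z $ j) ^ l)"
      proof (rule Rep_sum)
        fix l assume l: "l \<in> {..<e}"
        have "deg_le (insert i S) (e - l) (\<lambda>z. - coeff (H z) l)"
          using wdeg_le_imp_deg_le[OF monic_familyD(4)[OF H(1)]] by (rule deg_le_uminus)
        moreover have "deg_le (insert i S) a (\<lambda>z. (z $ i) ^ a)"
          using deg_le_power[OF deg_le_coord1[of i "insert i S"], of a] by simp
        ultimately have "deg_le (insert i S) (e - l + a) (\<lambda>z. - coeff (H z) l * (z $ i) ^ a)"
          by (rule deg_le_mult)
        then have "Rep (e - l + a + l) (\<lambda>z. (- coeff (H z) l * (z $ i) ^ a) * (z $ j) ^ l)"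
          using l by (intro Rep_deg_le) auto
        moreover have "e - l + a + l = Suc (\<omega> s)" using l b by (simp add: \<omega>_def a_def b_def)
        ultimately show "Rep (Suc (\<omega> s)) (\<lambda>z. (- coeff (H z) l * (z $ i) ^ a) * (z $ j) ^ l)" by simp
      qed
      moreover have "(\<Sum>l<e. (- coeff (H z) l * (z $ i) ^ a) * (z $ j) ^ l) = z $ j * \<beta> s z"
        if z: "z \<in> X" for z
      proof -
        have "0 = poly (\<Sum>l\<le>e. monom (coeff (H z) l) l) (z $ j)"
          using H(2)[OF z] monic_familyD(1)[OF H(1), of z] by (simp add: poly_as_sum_of_monoms')
        also have "\<dots> = (\<Sum>l\<le>e. coeff (H z) l * (z $ j) ^ l)" by (simp only: poly_sum poly_monom)
        also have "{..e} = insert e {..<e}" by auto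
        also have "(\<Sum>l\<in>insert e {..<e}. coeff (H z) l * (z $ j) ^ l) =
            (z $ j) ^ e + (\<Sum>l<e. coeff (H z) l * (z $ j) ^ l)"
          using monic_familyD(2)[OF H(1), of z] by simp
        finally have "(z $ j) ^ e = - (\<Sum>l<e. coeff (H z) l * (z $ j) ^ l)"
          by (simp add: eq_neg_iff_add_eq_0)
        moreover have "z $ j * \<beta> s z = (z $ i) ^ a * (z $ j) ^ Suc b"
          by (simp add: \<beta>_def a_def b_def)
        then have "z $ j * \<beta> s z = (z $ i) ^ a * (z $ j) ^ e" unfolding b .
        ultimately show ?thesis by (simp add: sum_distrib_left sum_negf mult_ac)
      qed
      ultimately show ?thesis by (rule Rep_cong)
    qed
  qed
  then have "\<forall>s. \<exists>m. s < N \<longrightarrow> (\<forall>t<N. wdeg_le S (Suc (\<omega> s)) (\<omega> t) (m t)) \<and>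
    (\<forall>z\<in>X. z $ j * \<beta> s z = (\<Sum>t<N. m t z * \<beta> t z))"
    unfolding Rep_def by blast
  then obtain M where M: "\<And>s t. s < N \<Longrightarrow> t < N \<Longrightarrow> wdeg_le S (Suc (\<omega> s)) (\<omega> t) (M s t)"
    "\<And>s z. s < N \<Longrightarrow> z \<in> X \<Longrightarrow> z $ j * \<beta> s z = (\<Sum>t<N. M s t z * \<beta> t z)"
    by metis
  define T where "T = insert j S"
  \<comment> \<open>The variable of the characteristic polynomial of \<open>M\<close> is represented
    by the coordinate \<open>j\<close> itself, on which \<open>M\<close> does not depend. So the
    weighted degree bound applies to \<open>D\<close>, and splitting off the powers of
    \<open>z $ j\<close> recovers the polynomial as \<open>Q\<close>.\<close>
  define D where "D z = detn N (\<lambda>s t. (if s = t then z $ j else 0) - M s t z)" for z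
  have "deg_le T N D"
    unfolding D_def
  proof (rule deg_le_detn_weighted[where \<omega> = \<omega>])
    fix s t assume st: "s < N" "t < N"
    have "wdeg_le T (Suc (\<omega> s)) (\<omega> t) (M s t)"
      using wdeg_le_mono_set[OF M(1)[OF st]] by (simp add: T_def subset_insertI)
    moreover have "wdeg_le T (Suc (\<omega> s)) (\<omega> t) (\<lambda>z. if s = t then z $ j else 0)"
    proof (cases "s = t")
      case True
      then show ?thesis using deg_le_coord1[of j T] by (simp add: wdeg_le_def T_def Suc_diff_le)
    qed (simp add: wdeg_le_zero)
    ultimately show "wdeg_le T (Suc (\<omega> s)) (\<omega> t) (\<lambda>z. (if s = t then z $ j else 0) - M s t z)"
      using wdeg_le_diff by blast
  qed
  then obtain Q where Q: "\<And>z. D z = poly (Q z) (z $ j)" "\<And>z. degree (Q z) \<le> N"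
    "\<And>l. wdeg_le (T - {j}) N l (\<lambda>z. coeff (Q z) l)"
    using deg_le_univariate[of T N D j] by blast
  have T: "T - {j} = S" using i by (auto simp: T_def)
  have famQ: "poly_family S N Q"
    unfolding poly_family_def using Q(2) is_polyI[OF wdeg_le_imp_deg_le[OF Q(3)]] T by auto
  have lead: "coeff (Q z) N = 1" for z
  proof (rule detn_char_poly_leading)
    fix t
    have "Q (upd z j t) = Q z" by (rule poly_family_cong[OF famQ]) (use i in auto)
    then have "poly (Q z) t = D (upd z j t)" using Q(1)[of "upd z j t"] by simp
    also have "\<dots> = detn N (\<lambda>s u. (if s = u then t else 0) - M s u z)"
      unfolding D_def detn_leibniz
    proof (rule sum.cong)
      fix p assume "p \<in> {p. p permutes {0..<N}}"
      then have p: "p permutes {0..<N}" by simp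
      have "M s (p s) (upd z j t) = M s (p s) z" if "s \<in> {0..<N}" for s
      proof -
        have "p s < N" using permutes_in_image[OF p, of s] that by auto
        then show ?thesis using wdeg_le_imp_deg_le[OF M(1)[of s "p s"]] that i
          by (intro deg_le_cong_coord[of S _ "M s (p s)"]) auto
      qed
      then show "signof p * (\<Prod>s = 0..<N. (if s = p s then upd z j t $ j else 0) - M s (p s) (upd z j t)) =
        signof p * (\<Prod>s = 0..<N. (if s = p s then t else 0) - M s (p s) z)"
        by (intro arg_cong2[where f = times] prod.cong) auto
    qed simp
    finally show "poly (Q z) t = detn N (\<lambda>s u. (if s = u then t else 0) - M s u z)" .
  qed (rule Q(2))
  have "degree (Q z) = N" for z
    using Q(2)[of z] lead[of z] by (intro antisym le_degree) auto
  then have "monic_family S N Q" using lead Q(3) T by (simp add: monic_family_def)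
  moreover have "poly (Q z) (z $ j) = 0" if z: "z \<in> X" for z
  proof -
    have "(\<Sum>t<N. ((if s = t then z $ j else 0) - M s t z) * \<beta> t z) = 0" if s: "s < N" for s
    proof -
      have "(\<Sum>t<N. ((if s = t then z $ j else 0) - M s t z) * \<beta> t z) =
        (\<Sum>t<N. (if s = t then z $ j * \<beta> t z else 0)) - (\<Sum>t<N. M s t z * \<beta> t z)"
        unfolding sum_subtractf[symmetric] by (rule sum.cong) (auto simp: left_diff_distrib)
      then show ?thesis using M(2)[OF s z] s by simp
    qed
    \<comment> \<open>Index \<open>0\<close> encodes the monomial \<open>1\<close>, so the vector of
      monomials is a nonzero kernel vector at every point of \<open>X\<close>.\<close>
    moreover have "\<beta> 0 z \<noteq> 0" by (simp add: \<beta>_def)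
    ultimately have "D z = 0"
      unfolding D_def detn_zero_iff using N by (intro exI[of _ "\<lambda>t. \<beta> t z"]) auto
    then show ?thesis using Q(1)[of z] by simp
  qed
  ultimately show ?thesis unfolding integral_over_def by blast
qed

lemma finite_projection_eliminate:
  assumes X: "finite_projection X S" and i: "i \<in> S" and int: "integral_over X (S - {i}) i"
  shows "finite_projection X (S - {i})"
  unfolding finite_projection_def
proof (intro conjI allI impI)
  show "closed_image X (S - {i})"
    using X i int by (intro closed_image_eliminate) (auto simp: finite_projection_def)
  fix j assume j: "j \<notin> S - {i}"
  show "integral_over X (S - {i}) j"
  proof (cases "j = i")
    case False
    then have "integral_over X S j" using X j by (auto simp: finite_projection_def)
    then show ?thesis using integral_over_trans[of i "S - {i}" j X] int j i False
      by (simp add: insert_absorb)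
  qed (use int in simp)
qed

section \<open>Linear changes of coordinates and normalization\<close>

abbreviation vec_linear :: "(complex ^ 'n \<Rightarrow> complex ^ 'n) \<Rightarrow> bool" where
  "vec_linear \<equiv> Vector_Spaces.linear (*s) (*s)"

definition lin_iso :: "(complex ^ 'n \<Rightarrow> complex ^ 'n) \<Rightarrow> (complex ^ 'n \<Rightarrow> complex ^ 'n) \<Rightarrow> bool" where
  "lin_iso A B \<longleftrightarrow> vec_linear A \<and> vec_linear B \<and>
    (\<forall>z. A (B z) = z) \<and> (\<forall>z. B (A z) = z)"

lemma vec_linearI:
  fixes A :: "complex ^ 'n \<Rightarrow> complex ^ 'n"
  assumes "\<And>x y. A (x + y) = A x + A y" "\<And>c x. A (c *s x) = c *s A x"
  shows "vec_linear A"
  using assms by unfold_locales auto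

lemma vec_linearD:
  fixes A :: "complex ^ 'n \<Rightarrow> complex ^ 'n"
  assumes "vec_linear A"
  shows "A (x + y) = A x + A y" "A (c *s x) = c *s A x"
  using assms by (simp_all add: vec.linear_add vec.linear_scale)

lemma lin_iso_id: "lin_iso (\<lambda>z. z) (\<lambda>z. z)"
  by (auto simp: lin_iso_def intro!: vec_linearI)

lemma lin_iso_sym: "lin_iso A B \<Longrightarrow> lin_iso B A"
  by (auto simp: lin_iso_def)

lemma lin_iso_compose: "lin_iso A B \<Longrightarrow> lin_iso C D \<Longrightarrow> lin_iso (\<lambda>z. A (C z)) (\<lambda>z. D (B z))"
  unfolding lin_iso_def by (auto intro!: vec_linearI simp: vec_linearD)

lemma finite_projection_change:
  assumes X: "finite_projection X S" and BB: "\<And>z. B (B' z) = z" "\<And>z. B' (B z) = z"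
    and B: "\<And>i. i \<in> S \<Longrightarrow> deg_le S 1 (\<lambda>y. B y $ i)" "\<And>i y. i \<notin> S \<Longrightarrow> B y $ i = y $ i"
    and B': "\<And>i. i \<in> S \<Longrightarrow> deg_le S 1 (\<lambda>y. B' y $ i)"
  shows "finite_projection (B' ` X) S"
  unfolding finite_projection_def
proof (intro conjI allI impI)
  show "closed_image (B' ` X) S"
    unfolding closed_image_def
  proof (intro allI impI)
    fix y
    assume y: "\<forall>z\<in>B' ` X. \<exists>i\<in>S. z $ i \<noteq> y $ i"
    have "\<exists>i\<in>S. z $ i \<noteq> B y $ i" if z: "z \<in> X" for z
    proof (rule ccontr)
      assume "\<not> ?thesis"
      then have "B' z $ i = B' (B y) $ i" if "i \<in> S" for i
        using deg_le_cong_coord[OF B'[OF that], of z "B y"] by blast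
      then show False using y z BB by auto
    qed
    then obtain f where f: "is_poly S f" "\<forall>z\<in>X. f z = 0" "f (B y) \<noteq> 0"
      using X unfolding finite_projection_def closed_image_def by blast
    obtain d where "deg_le S d f" using f(1) by (auto simp: is_poly_def)
    then have "is_poly S (\<lambda>y. f (B y))" using deg_le_compose[OF _ B(1)] is_polyI by blast
    moreover have "\<forall>z\<in>B' ` X. f (B z) = 0" using f(2) BB by auto
    ultimately show "\<exists>f. is_poly S f \<and> (\<forall>z\<in>B' ` X. f z = 0) \<and> f y \<noteq> 0" using f(3)
      by (intro exI[of _ "\<lambda>y. f (B y)"]) auto
  qed
  fix i assume i: "i \<notin> S"
  then obtain d H where H: "monic_family S d H" "\<forall>z\<in>X. poly (H z) (z $ i) = 0"
    using X by (auto simp: finite_projection_def integral_over_def)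
  have "wdeg_le S d l (\<lambda>z. coeff (H (B z)) l)" for l
  proof (cases "l \<le> d")
    case True
    then have "deg_le S (d - l) (\<lambda>z. coeff (H z) l)" using monic_familyD(4)[OF H(1), of l] by (simp add: wdeg_le_def)
    then show ?thesis using deg_le_compose[of S "d - l" "\<lambda>z. coeff (H z) l" S B] B(1) True by (simp add: wdeg_le_def)
  next
    case False
    then have "(\<lambda>z. coeff (H z) l) = (\<lambda>_. 0)" using monic_familyD(4)[OF H(1), of l] by (simp add: wdeg_le_def)
    then have "coeff (H z) l = 0" for z by meson
    then show ?thesis using False by (simp add: wdeg_le_def)
  qed
  then have "monic_family S d (\<lambda>z. H (B z))" using monic_familyD(1,2)[OF H(1)] by (simp add: monic_family_def)
  moreover have "poly (H (B z)) (z $ i) = 0" if "z \<in> B' ` X" for z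
  proof -
    have "B z \<in> X" using that BB by auto
    then show ?thesis using H(2) B(2)[OF i, of z] by force
  qed
  ultimately show "integral_over (B' ` X) S i" unfolding integral_over_def by blast
qed

text \<open>A direction \<open>u\<close> in which the leading form of \<open>f\<close> does not vanish becomes a coordinate axis
  after a linear change of coordinates; then \<open>f\<close> is monic in that coordinate.\<close>

lemma integral_after_shear:
  assumes X: "finite_projection X S" "X \<noteq> {}"
    and f: "is_poly S f" "\<And>z. z \<in> X \<Longrightarrow> f z = 0" "f y \<noteq> 0"
  shows "\<exists>B B' i. lin_iso B B' \<and> i \<in> S \<and> finite_projection (B' ` X) S \<and>
    integral_over (B' ` X) (S - {i}) i"
proof -
  obtain d where "deg_le S d f" using f(1) by (auto simp: is_poly_def)
  then obtain P where P: "\<And>z c. f (c *s z) = poly (P z) c" "\<And>z. degree (P z) \<le> d"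
    "\<And>e. deg_le S e (\<lambda>z. coeff (P z) e)"
    using deg_le_homogeneous_parts[of S d f] by blast
  \<comment> \<open>The degrees in which \<open>f\<close> has a nonzero homogeneous part. The
    largest one, \<open>m\<close>, is the exact degree of \<open>f\<close>, which the bound
    \<open>d\<close> may overestimate.\<close>
  define E where "E = {e. e \<le> d \<and> (\<exists>z. coeff (P z) e \<noteq> 0)}"
  have fP: "f z = poly (P z) 1" for z using P(1)[of 1 z] by simp
  have "P y \<noteq> 0" using f(3) fP[of y] by auto
  then have "degree (P y) \<in> E" unfolding E_def using P(2)[of y] leading_coeff_neq_0[of "P y"] by blast
  moreover have "finite E" unfolding E_def by simp
  ultimately have mE: "Max E \<in> E" "\<And>e. e \<in> E \<Longrightarrow> e \<le> Max E" by (auto intro: Max_in)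
  define m where "m = Max E"
  have deg: "degree (P z) \<le> m" for z
  proof (rule degree_le, intro allI impI)
    fix l assume "m < l"
    then have "l \<notin> E" using mE(2)[of l] unfolding m_def by auto
    then show "coeff (P z) l = 0"
      unfolding E_def using P(2)[of z] by (cases "l \<le> d") (auto simp: coeff_eq_0)
  qed
  obtain u0 where u0: "coeff (P u0) m \<noteq> 0" using mE(1) unfolding E_def m_def by blast
  define u :: "complex ^ 'a" where "u = (\<chi> i. if i \<in> S then u0 $ i else 0)"
  have uS: "u $ i = 0" if "i \<notin> S" for i using that by (simp add: u_def)
  have "coeff (P u) m = coeff (P u0) m" by (rule deg_le_cong_coord[OF P(3)]) (simp add: u_def)
  then have u: "coeff (P u) m \<noteq> 0" using u0 by simp
  have hom: "coeff (P (c *s z)) e = c ^ e * coeff (P z) e" for c z e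
    by (rule homogeneous_coeff[of f P]) (rule P(1))
  \<comment> \<open>Otherwise the leading form is nonzero at \<open>0\<close>, so
    \<open>m = 0\<close> and \<open>f\<close> is constant. It vanishes on the nonempty set
    \<open>X\<close>, contrary to \<open>coeff (P u) m \<noteq> 0\<close>.\<close>
  have "\<exists>i\<in>S. u $ i \<noteq> 0"
  proof (rule ccontr)
    assume "\<not> ?thesis"
    then have "u = 0" using uS by (auto simp: vec_eq_iff)
    then have "coeff (P u) m = 0 ^ m * coeff (P u) m" using hom[of 0 u m] by simp
    then have m0: "m = 0" using u by (cases m) auto
    obtain x where "x \<in> X" using X(2) by blast
    then have "coeff (P x) 0 = 0" using f(2)[of x] fP[of x] deg[of x] m0 by (auto elim!: degree_eq_zeroE)
    moreover have "coeff (P x) 0 = coeff (P u) 0" using deg_le_0_const[OF P(3)[of 0]] .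
    ultimately show False using u m0 by simp
  qed
  then obtain i where i: "i \<in> S" "u $ i \<noteq> 0" by blast
  \<comment> \<open>\<open>B\<close> maps the \<open>i\<close>-th axis to the line spanned by
    \<open>u\<close>, as \<open>B (upd 0 i t) = t *s u\<close>. Coordinates outside \<open>S\<close>
    stay fixed because \<open>u\<close> vanishes there.\<close>
  define B where "B y = (\<chi> j. if j = i then u $ i * y $ i else y $ j + u $ j * y $ i)" for y :: "complex ^ 'a"
  define B' where "B' z = (\<chi> j. if j = i then z $ i / u $ i else z $ j - u $ j * (z $ i / u $ i))"
    for z :: "complex ^ 'a"
  have BB: "B (B' z) = z" "B' (B z) = z" for z using i by (auto simp: B_def B'_def vec_eq_iff)
  have iso: "lin_iso B B'"
    unfolding lin_iso_def using BB
    by (auto intro!: vec_linearI simp: B_def B'_def vec_eq_iff field_simps add_divide_distrib)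
  have Bpd: "deg_le S 1 (\<lambda>y. B y $ j)" if "j \<in> S" for j
  proof -
    have 1: "deg_le S 1 (\<lambda>y. c * y $ i)" for c using i(1) by (intro deg_le_cmult deg_le_coord1)
    show ?thesis using 1[of "u $ i"] deg_le_add[OF deg_le_coord1[OF that] 1[of "u $ j"]]
      by (cases "j = i") (simp_all add: B_def)
  qed
  have B'pd: "deg_le S 1 (\<lambda>y. B' y $ j)" if "j \<in> S" for j
  proof -
    have 1: "deg_le S 1 (\<lambda>y. c * y $ i)" for c using i(1) by (intro deg_le_cmult deg_le_coord1)
    show ?thesis
    proof (cases "j = i")
      case True
      then show ?thesis using 1[of "1 / u $ i"] by (simp add: B'_def)
    next
      case False
      then have "(\<lambda>y. B' y $ j) = (\<lambda>y. y $ j - (u $ j / u $ i) * y $ i)" by (simp add: B'_def)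
      then show ?thesis using deg_le_diff[OF deg_le_coord1[OF that] 1[of "u $ j / u $ i"]] by simp
    qed
  qed
  have fin: "finite_projection (B' ` X) S"
    by (rule finite_projection_change[OF X(1) BB Bpd _ B'pd]) (use i uS in \<open>auto simp: B_def\<close>)
  have "deg_le S m f"
  proof -
    have "f z = (\<Sum>e\<le>m. coeff (P z) e)" for z
    proof -
      have "f z = poly (\<Sum>e\<le>m. monom (coeff (P z) e) e) 1"
        using fP[of z] deg by (simp only: poly_as_sum_of_monoms')
      then show ?thesis by (simp add: poly_sum poly_monom)
    qed
    moreover have "deg_le S m (\<lambda>z. \<Sum>e\<le>m. coeff (P z) e)"
      using P(3) by (intro deg_le_sum) (auto intro: deg_le_mono_degree)
    ultimately show ?thesis by presburger
  qed
  then have "deg_le S m (\<lambda>y. f (B y))" using Bpd by (rule deg_le_compose)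
  then obtain Q where Q: "\<And>z. f (B z) = poly (Q z) (z $ i)" "\<And>z. degree (Q z) \<le> m"
    "\<And>l. wdeg_le (S - {i}) m l (\<lambda>z. coeff (Q z) l)"
    using deg_le_univariate[of S m "\<lambda>y. f (B y)" i] by blast
  have famQ: "poly_family (S - {i}) m Q"
    unfolding poly_family_def using Q(2) is_polyI[OF wdeg_le_imp_deg_le[OF Q(3)]] by blast
  define \<kappa> where "\<kappa> = coeff (P u) m"
  \<comment> \<open>The coefficient of the top power has degree at most \<open>m - m = 0\<close>,
    hence is constant; on the \<open>i\<close>-th axis it is seen to be the leading form at
    \<open>u\<close>.\<close>
  have lead: "coeff (Q z) m = \<kappa>" for z
  proof -
    have "poly (Q 0) t = poly (P u) t" for t
    proof -
      have "B (upd 0 i t) = t *s u" by (auto simp: B_def vec_eq_iff)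
      then have "f (B (upd 0 i t)) = poly (P u) t" using P(1)[of t u] by simp
      moreover have "Q (upd 0 i t) = Q 0" by (rule poly_family_cong[OF famQ]) auto
      ultimately show ?thesis using Q(1)[of "upd 0 i t"] by simp
    qed
    then have "poly (Q 0) = poly (P u)" by (rule ext)
    then have "Q 0 = P u" by (simp only: poly_eq_poly_eq_iff)
    moreover have "deg_le (S - {i}) 0 (\<lambda>z. coeff (Q z) m)" using Q(3)[of m] by (simp add: wdeg_le_def)
    then have "coeff (Q z) m = coeff (Q 0) m" by (rule deg_le_0_const)
    ultimately show ?thesis by (simp add: \<kappa>_def)
  qed
  have \<kappa>: "\<kappa> \<noteq> 0" using u by (simp add: \<kappa>_def)
  have "monic_family (S - {i}) m (\<lambda>z. smult (1 / \<kappa>) (Q z))"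
    unfolding monic_family_def
  proof (intro conjI allI)
    fix z
    show "coeff (smult (1 / \<kappa>) (Q z)) m = 1" using lead \<kappa> by simp
    have "degree (Q z) = m" using Q(2)[of z] lead[of z] \<kappa> by (intro antisym le_degree) auto
    then show "degree (smult (1 / \<kappa>) (Q z)) = m" using \<kappa> by simp
  next
    fix l
    have "wdeg_le (S - {i}) 0 0 (\<lambda>_. 1 / \<kappa>)" by (auto simp: wdeg_le_def intro: deg_le_const)
    from wdeg_le_mult[OF this Q(3)[of l]] show "wdeg_le (S - {i}) m l (\<lambda>z. coeff (smult (1 / \<kappa>) (Q z)) l)" by simp
  qed
  moreover have "poly (smult (1 / \<kappa>) (Q z)) (z $ i) = 0" if "z \<in> B' ` X" for z
  proof -
    have "B z \<in> X" using that BB by auto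
    then show ?thesis using f(2) Q(1)[of z] by simp
  qed
  ultimately have "integral_over (B' ` X) (S - {i}) i" unfolding integral_over_def by blast
  then show ?thesis using iso i(1) fin by blast
qed

lemma finite_projection_UNIV:
  assumes "X = {z. \<forall>f\<in>F. f z = 0}" "\<And>f. f \<in> F \<Longrightarrow> is_poly UNIV f"
  shows "finite_projection X UNIV"
  unfolding finite_projection_def closed_image_def
proof (intro conjI allI impI)
  fix y assume "\<forall>z\<in>X. \<exists>i\<in>UNIV. z $ i \<noteq> y $ i"
  then have "y \<notin> X" by auto
  then show "\<exists>f. is_poly UNIV f \<and> (\<forall>z\<in>X. f z = 0) \<and> f y \<noteq> 0" using assms by auto
qed simp

text \<open>If the projection to the coordinates in \<open>S\<close> is not onto, then
  \<open>closed_image\<close> yields a polynomial in these coordinates that vanishes on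
  \<open>X\<close> but not everywhere. After a shear it eliminates one coordinate, and
  \<open>S\<close> shrinks.\<close>

lemma noether_normalization:
  assumes "finite_projection X S" "X \<noteq> {}"
  shows "\<exists>A A' S. lin_iso A A' \<and> finite_projection (A ` X) S \<and> (\<forall>y. \<exists>z\<in>A ` X. \<forall>i\<in>S. z $ i = y $ i)"
  using assms
proof (induction "card S" arbitrary: X S rule: less_induct)
  case less
  show ?case
  proof (cases "\<forall>y. \<exists>z\<in>X. \<forall>i\<in>S. z $ i = y $ i")
    case True
    then show ?thesis using lin_iso_id less.prems
      by (intro exI[of _ "\<lambda>z. z"] exI[of _ S]) auto
  next
    case False
    then obtain y where "\<forall>z\<in>X. \<exists>i\<in>S. z $ i \<noteq> y $ i" by blast
    then obtain f where f: "is_poly S f" "\<And>z. z \<in> X \<Longrightarrow> f z = 0" "f y \<noteq> 0"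
      using less.prems(1) unfolding finite_projection_def closed_image_def by blast
    obtain B B' i where B: "lin_iso B B'" "i \<in> S" "finite_projection (B' ` X) S"
      "integral_over (B' ` X) (S - {i}) i"
      using integral_after_shear[OF less.prems f] by blast
    have "finite_projection (B' ` X) (S - {i})" using B by (intro finite_projection_eliminate)
    moreover have "card (S - {i}) < card S" using B(2) by (intro psubset_card_mono) auto
    ultimately obtain A A' T where A: "lin_iso A A'" "finite_projection (A ` B' ` X) T"
      "\<forall>y. \<exists>z\<in>A ` B' ` X. \<forall>i\<in>T. z $ i = y $ i"
      using less.hyps[of "S - {i}" "B' ` X"] less.prems(2) by auto
    then have "lin_iso (\<lambda>z. A (B' z)) (\<lambda>z. B (A' z))"
      using lin_iso_compose[OF A(1) lin_iso_sym[OF B(1)]] by simp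
    then show ?thesis using A(2,3) unfolding image_image by blast
  qed
qed

section \<open>Separable equations\<close>

abbreviation radical :: "complex poly \<Rightarrow> complex poly" where
  "radical h \<equiv> (\<Prod>t | poly h t = 0. [:-t, 1:])"

lemma degree_prod_linear: "degree (\<Prod>t\<in>R. [:-t, 1 :: complex:]) = card R"
proof -
  have "degree (\<Prod>t\<in>R. [:-t, 1 :: complex:]) = (\<Sum>t\<in>R. degree [:-t, 1 :: complex:])"
    by (rule degree_prod_eq_sum_degree) auto
  then show ?thesis by simp
qed

lemma lead_coeff_prod_linear: "lead_coeff (\<Prod>t\<in>R. [:-t, 1 :: complex:]) = 1"
  unfolding lead_coeff_prod by simp

text \<open>At a root of order \<open>m\<close> the derivative vanishes to order
  \<open>m - 1\<close>, and the radical supplies the missing factor. In the product rule for the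
  factorization \<open>g\<close>, each summand lacks just one linear factor of
  \<open>g\<close>.\<close>

lemma dvd_pderiv_mult_radical:
  assumes "h \<noteq> 0" shows "h dvd pderiv h * radical h"
proof -
  define R where "R = {t. poly h t = 0}"
  define m where "m t = order t h" for t
  have fin: "finite R" unfolding R_def using assms by (rule poly_roots_finite)
  have m: "m t > 0" if "t \<in> R" for t
    using that assms by (auto simp: R_def m_def order_root)
  define g where "g = (\<Prod>t\<in>R. [:-t, 1:] ^ m t)"
  have h: "h = smult (lead_coeff h) g"
    using complex_poly_decompose[of h] by (simp add: g_def R_def m_def)
  have "g dvd (prod (\<lambda>t. [:-t, 1:] ^ m t) (R - {a}) * pderiv ([:-a, 1:] ^ m a)) * (\<Prod>t\<in>R. [:-t, 1:])"
    if a: "a \<in> R" for a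
  proof -
    obtain k where k: "m a = Suc k" using m[OF a] by (cases "m a") auto
    have "pderiv ([:-a, 1:] ^ Suc k) = smult (of_nat (Suc k)) ([:-a, 1:] ^ k)"
      unfolding pderiv_power_Suc by (simp add: pderiv_pCons)
    moreover have "(\<Prod>t\<in>R. [:-t, 1:]) = [:-a, 1:] * (\<Prod>t\<in>R - {a}. [:-t, 1:])"
      using fin a by (rule prod.remove)
    moreover have "g = [:-a, 1:] ^ Suc k * prod (\<lambda>t. [:-t, 1:] ^ m t) (R - {a})"
      unfolding g_def k[symmetric] using fin a by (rule prod.remove)
    ultimately have e: "(prod (\<lambda>t. [:-t, 1:] ^ m t) (R - {a}) * pderiv ([:-a, 1:] ^ m a)) * (\<Prod>t\<in>R. [:-t, 1:]) =
      g * smult (of_nat (Suc k)) (\<Prod>t\<in>R - {a}. [:-t, 1:])"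
      unfolding k by (simp only: mult_smult_right mult_smult_left power_Suc mult_ac)
    show ?thesis by (subst e) (rule dvd_triv_left)
  qed
  then have "g dvd pderiv g * (\<Prod>t\<in>R. [:-t, 1:])"
    unfolding g_def pderiv_prod sum_distrib_right by (intro dvd_sum) blast
  then have "smult (lead_coeff h) g dvd smult (lead_coeff h) (pderiv g * (\<Prod>t\<in>R. [:-t, 1:]))"
    using assms by (simp add: smult_dvd_iff dvd_smult_iff)
  then have "smult (lead_coeff h) g dvd pderiv (smult (lead_coeff h) g) * (\<Prod>t\<in>R. [:-t, 1:])"
    by (simp add: pderiv_smult)
  then show ?thesis unfolding h[symmetric] R_def .
qed

text \<open>The order at a root drops by exactly one under differentiation, so \<open>q\<close> has
  to contribute at each root. A nonzero cofactor thus has at least as many roots as \<open>h\<close>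
  has distinct ones, which makes the radical one of least degree.\<close>

lemma root_of_cofactor:
  fixes h q :: "complex poly"
  assumes "h \<noteq> 0" "h dvd pderiv h * q" "poly h t = 0"
  shows "poly q t = 0"
proof (cases "q = 0")
  case False
  have ord: "order t h = Suc (order t (pderiv h))" using assms(1,3) by (rule order_pderiv)
  have "pderiv h \<noteq> 0"
  proof
    assume "pderiv h = 0"
    then have "degree h = 0" by (simp add: pderiv_eq_0_iff)
    then show False using assms(1,3) by (auto elim!: degree_eq_zeroE)
  qed
  then have nz: "pderiv h * q \<noteq> 0" using False by simp
  have "order t h \<le> order t (pderiv h * q)" using nz assms(2) by (rule dvd_imp_order_le)
  then have "order t q \<noteq> 0" using ord nz by (simp add: order_mult)
  then show ?thesis by (simp add: order_root)
qed simp

lemma poly_pderiv_radical_nonzero: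
  assumes "h \<noteq> 0" "poly h t = 0" shows "poly (pderiv (radical h)) t \<noteq> 0"
proof -
  define R where "R = {t. poly h t = 0}"
  have fin: "finite R" unfolding R_def using assms(1) by (rule poly_roots_finite)
  have t: "t \<in> R" using assms(2) by (simp add: R_def)
  define p where "p = (\<Prod>s\<in>R - {t}. [:-s, 1:])"
  have "radical h = [:-t, 1:] * p" unfolding R_def[symmetric] p_def using fin t by (rule prod.remove)
  then have "poly (pderiv (radical h)) t = poly p t"
    by (simp only: pderiv_mult) (simp add: pderiv_pCons)
  also have "\<dots> = (\<Prod>s\<in>R - {t}. t - s)" by (simp add: p_def poly_prod)
  also have "\<dots> \<noteq> 0" using fin by (simp add: prod_zero_iff)
  finally show ?thesis .
qed

text \<open>Where the number \<open>n\<close> of distinct roots is maximal, the coefficients of the radical are the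
  solution of a linear system: \<open>radical h\<close> is the only monic \<open>q\<close> of degree \<open>n\<close> such that \<open>h\<close> divides
  \<open>pderiv h * q\<close>. Cramer's rule makes it polynomial in the parameter, up to the denominator \<open>D\<close>.\<close>

lemma radical_family:
  assumes H: "monic_family S d H"
  shows "\<exists>D K e. is_poly S D \<and> (\<exists>z. D z \<noteq> 0) \<and> poly_family S e K \<and>
    (\<forall>z t. D z \<noteq> 0 \<longrightarrow> poly (H z) t = 0 \<longrightarrow> poly (K z) t = 0 \<and> poly (pderiv (K z)) t \<noteq> 0)"
proof -
  note H0 = monic_familyD(3)[OF H]
  define n where "n z = card {t. poly (H z) t = 0}" for z
  have "n z \<le> d" for z
    using card_poly_roots_bound[OF H0[of z]] monic_familyD(1)[OF H, of z] by (simp add: n_def)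
  then obtain z0 where z0: "\<And>z. n z \<le> n z0"
    using ex_has_greatest_nat[of "\<lambda>_. True" undefined n "Suc d"] le_imp_less_Suc by blast
  define N where "N = n z0"
  define M where "M z b a = coeff (pderiv (H z) * monom 1 a mod H z) b" for z b a
  \<comment> \<open>That \<open>H z\<close> divides \<open>pderiv (H z) * q\<close> is a linear
    system with \<open>d\<close> rows, in general too many for Cramer's rule. Multiplication by the
    conjugate transpose of the columns of \<open>M z0\<close> makes it square; as the conjugation
    takes place at the fixed point \<open>z0\<close>, the entries remain polynomial in
    \<open>z\<close>.\<close>
  define G where "G z i a = (\<Sum>b<d. cnj (M z0 b i) * M z b a)" for z i a
  define D where "D z = detn N (G z)" for z
  have polyM: "is_poly S (\<lambda>z. M z b a)" for a b
    unfolding M_def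
    by (rule is_poly_coeff_mod[OF H poly_family_mult[OF poly_family_pderiv[OF
          monic_family_imp_poly_family[OF H]] poly_family_const[OF degree_monom_le]]])
  have polyG: "is_poly S (\<lambda>z. G z i a)" for i a
    unfolding G_def by (intro is_poly_sum is_poly_mult is_poly_const polyM)
  have polyD: "is_poly S D" unfolding D_def by (intro is_poly_detn polyG)
  have Gx: "(\<Sum>a<k. G z i a * x a) =
      (\<Sum>b<d. cnj (M z0 b i) * coeff (pderiv (H z) * (\<Sum>a<k. monom (x a) a) mod H z) b)" for z i k x
  proof -
    have "(\<Sum>a<k. G z i a * x a) = (\<Sum>b<d. cnj (M z0 b i) * (\<Sum>a<k. M z b a * x a))"
      unfolding G_def sum_distrib_left sum_distrib_right by (subst sum.swap) (simp add: mult_ac)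
    then show ?thesis unfolding M_def sum_mod_mult_monom .
  qed
  have "D z0 \<noteq> 0"
  proof
    assume "D z0 = 0"
    then obtain x i where x: "i < N" "x i \<noteq> 0" "\<And>i. i < N \<Longrightarrow> (\<Sum>a<N. G z0 i a * x a) = 0"
      unfolding D_def detn_zero_iff by blast
    define q where "q = (\<Sum>a<N. monom (x a) a)"
    define c where "c b = coeff (pderiv (H z0) * q mod H z0) b" for b
    have "coeff q i = x i" using x(1) by (simp add: q_def coeff_sum_monom)
    then have q: "q \<noteq> 0" using x(2) by auto
    have c: "c b = (\<Sum>a<N. M z0 b a * x a)" for b
      unfolding c_def q_def M_def sum_mod_mult_monom ..
    \<comment> \<open>At \<open>z0\<close> the matrix \<open>G\<close> is a Gram matrix, so a kernel
      vector has image of squared norm zero under \<open>M z0\<close>. This gives a nonzero cofactor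
      of degree below \<open>N\<close>, which has too few roots.\<close>
    have "0 = (\<Sum>i<N. cnj (x i) * (\<Sum>a<N. G z0 i a * x a))" using x(3) by simp
    also have "\<dots> = (\<Sum>i<N. cnj (x i) * (\<Sum>b<d. cnj (M z0 b i) * c b))"
      unfolding Gx c_def q_def ..
    also have "\<dots> = (\<Sum>b<d. (\<Sum>i<N. cnj (M z0 b i * x i)) * c b)"
      unfolding sum_distrib_left sum_distrib_right by (subst sum.swap) (simp add: mult_ac)
    also have "\<dots> = (\<Sum>b<d. cnj (c b) * c b)" unfolding c cnj_sum ..
    also have "\<dots> = of_real (\<Sum>b<d. (cmod (c b))\<^sup>2)"
      by (simp only: of_real_sum complex_norm_square mult.commute)
    finally have "complex_of_real (\<Sum>b<d. (cmod (c b))\<^sup>2) = 0" ..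
    then have "(\<Sum>b<d. (cmod (c b))\<^sup>2) = 0" by (simp only: of_real_eq_0_iff)
    then have cz: "c b = 0" if "b < d" for b
      using that by (simp add: sum_nonneg_eq_0_iff)
    have "pderiv (H z0) * q mod H z0 = 0"
    proof (rule poly_eqI)
      fix b
      show "coeff (pderiv (H z0) * q mod H z0) b = coeff 0 b"
      proof (cases "b < d")
        case True
        then show ?thesis using cz by (simp add: c_def)
      next
        case False
        then show ?thesis
          using degree_mod_less[OF H0, of "pderiv (H z0) * q" z0] monic_familyD(1)[OF H, of z0]
          by (auto simp: coeff_eq_0)
      qed
    qed
    then have "H z0 dvd pderiv (H z0) * q" by (rule mod_0_imp_dvd)
    then have "{t. poly (H z0) t = 0} \<subseteq> {t. poly q t = 0}"
      using root_of_cofactor[OF H0] by blast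
    then have "N \<le> card {t. poly q t = 0}"
      unfolding N_def n_def using poly_roots_finite[OF q] by (intro card_mono)
    also have "\<dots> \<le> degree q" using q by (rule card_poly_roots_bound)
    finally have "N \<le> degree q" .
    moreover have "degree q < N" unfolding q_def
      using x(1) by (intro degree_lessI) (auto simp: coeff_sum_monom)
    ultimately show False by simp
  qed
  \<comment> \<open>Cramer's numerators are the lower coefficients and the common denominator
    \<open>D\<close> is the leading one, so \<open>K z\<close> will be \<open>D z\<close> times the
    radical wherever \<open>D z \<noteq> 0\<close>.\<close>
  moreover define K where "K z = (\<Sum>k<N. monom (detn N (\<lambda>i j. if j = k then - G z i N else G z i j)) k) +
    monom (D z) N" for z
  have "poly_family S N K"
    unfolding poly_family_def
  proof (intro conjI allI)
    fix z
    show "degree (K z) \<le> N"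
      unfolding K_def
      by (intro degree_add_le degree_monom_le degree_sum_le) (auto intro: le_trans[OF degree_monom_le])
  next
    fix l
    have "is_poly S (\<lambda>z. coeff (\<Sum>k<N. monom (detn N (\<lambda>i j. if j = k then - G z i N else G z i j)) k) l)"
    proof (cases "l < N")
      case True
      have "is_poly S (\<lambda>z. if j = l then - G z i N else G z i j)" for i j
        using polyG[of i j] is_poly_uminus[OF polyG[of i N]] by (cases "j = l") auto
      then show ?thesis unfolding coeff_sum_monom using True by (simp add: is_poly_detn)
    next
      case False
      then show ?thesis unfolding coeff_sum_monom by (simp add: is_poly_const)
    qed
    moreover have "is_poly S (\<lambda>z. coeff (monom (D z) N) l)"
      using polyD is_poly_const[of S 0] by (cases "l = N") auto
    ultimately show "is_poly S (\<lambda>z. coeff (K z) l)" unfolding K_def coeff_add by (rule is_poly_add)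
  qed
  moreover have "poly (K z) t = 0 \<and> poly (pderiv (K z)) t \<noteq> 0"
    if D: "D z \<noteq> 0" and t: "poly (H z) t = 0" for z t
  proof -
    define P where "P = radical (H z)"
    have "P \<noteq> 0" unfolding P_def using lead_coeff_prod_linear[of "{t. poly (H z) t = 0}"] by auto
    have dvd: "H z dvd pderiv (H z) * P" unfolding P_def by (rule dvd_pderiv_mult_radical[OF H0])
    have deg: "degree P = n z" unfolding P_def n_def by (rule degree_prod_linear)
    have kernel: "(\<Sum>a<k. G z i a * coeff P a) = 0" if "n z < k" for k i
      unfolding Gx sum_monom_coeff[of P k, unfolded deg, OF that] using dvd by simp
    \<comment> \<open>With fewer than \<open>N\<close> distinct roots the radical would have degree
      below \<open>N\<close> and be a kernel vector of the square matrix \<open>G z\<close>.\<close>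
    have nN: "n z = N"
    proof (rule ccontr)
      assume "n z \<noteq> N"
      then have "n z < N" using z0[of z] by (simp add: N_def)
      moreover have "coeff P (n z) \<noteq> 0" using \<open>P \<noteq> 0\<close> deg by (metis leading_coeff_0_iff)
      ultimately have "D z = 0" unfolding D_def detn_zero_iff using kernel by blast
      then show False using D by simp
    qed
    have "coeff P N = 1" using lead_coeff_prod_linear[of "{t. poly (H z) t = 0}"] deg nN
      by (simp add: P_def)
    have neg: "- G z i N = (\<Sum>l<N. G z i l * coeff P l)" for i
    proof -
      have "(\<Sum>a<Suc N. G z i a * coeff P a) = 0" by (rule kernel) (simp add: nN)
      then show ?thesis using \<open>coeff P N = 1\<close> by (simp add: eq_neg_iff_add_eq_0 neg_eq_iff_add_eq_0 add.commute)
    qed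
    have cr: "detn N (\<lambda>i j. if j = k then - G z i N else G z i j) = coeff P k * D z" if "k < N" for k
      unfolding neg D_def using that by (rule detn_cramer)
    have "K z = smult (D z) P"
    proof (rule poly_eqI)
      fix l
      show "coeff (K z) l = coeff (smult (D z) P) l"
        using cr[of l] \<open>coeff P N = 1\<close> deg nN
        unfolding K_def coeff_add coeff_sum_monom
        by (cases "l < N"; cases "l = N") (auto simp: coeff_eq_0)
    qed
    moreover have "poly P t = 0"
      unfolding P_def poly_prod using t poly_roots_finite[OF H0[of z]] by (auto simp: prod_zero_iff)
    ultimately show ?thesis
      using poly_pderiv_radical_nonzero[OF H0[of z] t] D by (simp add: pderiv_smult P_def)
  qed
  ultimately show ?thesis using polyD by blast
qed

section \<open>Analytic preliminaries\<close>

lemma vec_linear_imp_linear: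
  fixes A :: "complex ^ 'n \<Rightarrow> complex ^ 'n"
  assumes "vec_linear A" shows "linear A"
proof (rule linearI)
  show "A (x + y) = A x + A y" for x y by (rule vec_linearD(1)[OF assms])
  have "c *\<^sub>R x = of_real c *s x" for c and x :: "complex ^ 'n"
    by (simp add: vec_eq_iff scaleR_conv_of_real[where 'a=complex])
  then show "A (c *\<^sub>R x) = c *\<^sub>R A x" for c x using vec_linearD(2)[OF assms] by simp
qed

text \<open>Invariance of domain speaks of real dimensions. The space of smaller complex dimension
  is copied into the other one by a complex linear isomorphism, which is also real linear.\<close>

lemma dim_mono_vec_dim:
  fixes U V :: "(complex ^ 'n) set"
  assumes "vec.subspace U" "vec.subspace V" "vec.dim V \<le> vec.dim U"
  shows "dim V \<le> dim U"
proof -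
  obtain T where T: "vec.subspace T" "T \<subseteq> vec.span U" "vec.dim T = vec.dim V"
    using vec.choose_subspace_of_subspace[OF assms(3)] by blast
  obtain f where f: "vec_linear f" "f ` V = T" "inj_on f V"
    using vec.subspace_isomorphism[OF assms(2) T(1)] T(3) by auto
  have "subspace V"
  proof (rule subspaceI)
    show "c *\<^sub>R x \<in> V" if "x \<in> V" for c x
    proof -
      have "c *\<^sub>R x = of_real c *s x"
        by (simp add: vec_eq_iff scaleR_conv_of_real[where 'a=complex])
      then show ?thesis using vec.subspace_scale[OF assms(2) that] by simp
    qed
  qed (use assms(2) in \<open>auto simp: vec.subspace_0 vec.subspace_add\<close>)
  then have "inj_on f (span V)" using f(3) by (simp only: span_eq_iff[THEN iffD2])
  then have "dim (f ` V) = dim V"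
    by (intro dim_image_eq vec_linear_imp_linear f(1))
  moreover have "T \<subseteq> U" using T(2) vec.span_minimal[OF subset_refl assms(1)] by blast
  then have "dim T \<le> dim U" by (rule dim_subset)
  ultimately show ?thesis using f(2) by simp
qed

lemma vec_linear_inv:
  fixes A :: "complex ^ 'n \<Rightarrow> complex ^ 'n"
  assumes "vec_linear A" "bij A"
  shows "vec_linear (inv_into UNIV A)"
proof (rule vec_linearI)
  have inj: "inj A" and AB: "A (inv_into UNIV A y) = y" for y
    using assms(2) by (auto simp: bij_is_inj bij_is_surj surj_f_inv_f)
  show "inv_into UNIV A (x + y) = inv_into UNIV A x + inv_into UNIV A y" for x y
    by (rule injD[OF inj]) (simp add: AB vec_linearD[OF assms(1)])
  show "inv_into UNIV A (c *s x) = c *s inv_into UNIV A x" for c x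
    by (rule injD[OF inj]) (simp add: AB vec_linearD[OF assms(1)])
qed

text \<open>The real inverse function theorem provides the inverse; its derivatives are inverses of
  complex linear bijections and hence complex linear.\<close>

lemma holomorphic_inverse_function:
  fixes f :: "complex ^ 'n \<Rightarrow> complex ^ 'n"
  assumes lin: "\<And>z. vec_linear (f' z)"
    and der: "\<And>z. (f has_derivative f' z) (at z)"
    and cont: "\<And>h. continuous_on UNIV (\<lambda>z. f' z h)"
    and inj: "inj (f' q)"
  shows "\<exists>U V g. open U \<and> q \<in> U \<and> open V \<and> homeomorphism U V f g \<and>
    (\<forall>y\<in>V. \<exists>E. vec_linear E \<and> (g has_derivative E) (at y))"
proof -
  define F where "F z = Blinfun (f' z)" for z
  have bl: "bounded_linear (f' z)" for z using der by (rule has_derivative_bounded_linear)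
  have F: "blinfun_apply (F z) = f' z" for z unfolding F_def using bl by (rule bounded_linear_Blinfun_apply)
  obtain g0 where g0: "linear g0" "g0 \<circ> f' q = id"
    using linear_injective_left_inverse[OF vec_linear_imp_linear[OF lin] inj] by blast
  have "bounded_linear g0" using g0(1) by (simp add: linear_conv_bounded_linear)
  then have G0: "blinfun_apply (Blinfun g0) = g0" by (rule bounded_linear_Blinfun_apply)
  have inv: "Blinfun g0 o\<^sub>L F q = id_blinfun"
  proof (rule blinfun_eqI)
    fix i
    show "blinfun_apply (Blinfun g0 o\<^sub>L F q) i = blinfun_apply id_blinfun i"
      using fun_cong[OF g0(2), of i] by (simp add: F G0)
  qed
  have contF: "continuous_on UNIV F"
    by (rule continuous_on_blinfun_componentwise) (simp add: F cont)
  obtain U V g g' where g: "open U" "q \<in> U" "open V" "homeomorphism U V f g"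
    "\<And>y. y \<in> V \<Longrightarrow> (g has_derivative (g' y)) (at y)"
    "\<And>y. y \<in> V \<Longrightarrow> g' y = inv_into UNIV (blinfun_apply (F (g y)))"
    "\<And>y. y \<in> V \<Longrightarrow> bij (blinfun_apply (F (g y)))"
    by (rule inverse_function_theorem[of UNIV f F q "Blinfun g0"])
      (use der contF inv in \<open>auto simp: F\<close>)
  have "vec_linear (g' y)" if "y \<in> V" for y
    using g(6,7)[OF that] vec_linear_inv[OF lin] by (simp add: F)
  then show ?thesis using g(1-5) by blast
qed

lemma higher_pderiv_order:
  fixes p :: "complex poly"
  assumes "p \<noteq> 0"
  shows "poly ((pderiv ^^ order t p) p) t \<noteq> 0" "\<And>j. j < order t p \<Longrightarrow> poly ((pderiv ^^ j) p) t = 0"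
proof -
  have "m = order t p \<Longrightarrow> p \<noteq> 0 \<Longrightarrow> poly ((pderiv ^^ m) p) t \<noteq> 0 \<and> (\<forall>j<m. poly ((pderiv ^^ j) p) t = 0)"
    for m
  proof (induction m arbitrary: p)
    case 0
    then show ?case by (metis funpow_0 less_nat_zero_code order_root)
  next
    case (Suc m)
    then have root: "poly p t = 0" by (metis nat.distinct(1) order_root)
    then have ord: "m = order t (pderiv p)" using order_pderiv[OF Suc.prems(2)] Suc.prems(1) by simp
    have "pderiv p \<noteq> 0"
    proof
      assume "pderiv p = 0"
      then have "degree p = 0" by (simp add: pderiv_eq_0_iff)
      then show False using root Suc.prems(2) by (auto elim!: degree_eq_zeroE)
    qed
    note IH = Suc.IH[OF ord this]
    have "poly ((pderiv ^^ j) p) t = 0" if "j < Suc m" for j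
      using that root IH by (cases j) (auto simp: funpow_Suc_right simp del: funpow.simps)
    then show ?case using IH by (auto simp: funpow_Suc_right simp del: funpow.simps)
  qed
  then show "poly ((pderiv ^^ order t p) p) t \<noteq> 0" "\<And>j. j < order t p \<Longrightarrow> poly ((pderiv ^^ j) p) t = 0"
    using assms by blast+
qed

lemma is_poly_eval_family:
  assumes "poly_family S e K"
  shows "is_poly (insert i S) (\<lambda>z. poly (K z) (z $ i))"
proof -
  have "poly (K z) (z $ i) = (\<Sum>l\<le>e. coeff (K z) l * (z $ i) ^ l)" for z
  proof -
    have "degree (K z) \<le> e" using assms by (simp add: poly_family_def)
    then have "poly (K z) (z $ i) = poly (\<Sum>l\<le>e. monom (coeff (K z) l) l) (z $ i)"
      by (simp only: poly_as_sum_of_monoms')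
    then show ?thesis by (simp only: poly_sum poly_monom)
  qed
  moreover have "is_poly (insert i S) (\<lambda>z. \<Sum>l\<le>e. coeff (K z) l * (z $ i) ^ l)"
    using assms unfolding poly_family_def
    by (intro is_poly_sum is_poly_mult is_poly_power is_poly_coord)
      (auto intro: is_poly_mono_set)
  ultimately show ?thesis by simp
qed

lemma poly_family_higher_pderiv: "poly_family S e K \<Longrightarrow> poly_family S e (\<lambda>z. (pderiv ^^ m) (K z))"
  by (induction m) (auto intro: poly_family_pderiv)

text \<open>On the line through a point where one factor is nonzero and a point where the other is,
  both become nonzero univariate polynomials, and so does their product.\<close>

lemma is_poly_prod_nonzero:
  assumes "finite I" "\<And>i. i \<in> I \<Longrightarrow> is_poly S (f i) \<and> (\<exists>z. f i z \<noteq> 0)"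
  shows "\<exists>z. (\<Prod>i\<in>I. f i z) \<noteq> 0"
  using assms
proof (induction I rule: finite_induct)
  case (insert j I)
  then obtain z where z: "(\<Prod>i\<in>I. f i z) \<noteq> 0" by auto
  obtain y where y: "f j y \<noteq> 0" and fj: "is_poly S (f j)" using insert.prems[of j] by auto
  have "is_poly S (\<lambda>z. \<Prod>i\<in>I. f i z)" using insert.prems by (intro is_poly_prod) auto
  then obtain p where p: "\<And>s. (\<Prod>i\<in>I. f i (z + s *s (y - z))) = poly p s"
    using is_poly_line by blast
  obtain q where q: "\<And>s. f j (z + s *s (y - z)) = poly q s" using is_poly_line[OF fj] by blast
  have "poly p 0 \<noteq> 0" using z p[of 0] by simp
  moreover have "poly q 1 \<noteq> 0" using y q[of 1] by simp
  ultimately have "p * q \<noteq> 0" by auto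
  then have "\<exists>s. poly (p * q) s \<noteq> 0" using poly_all_0_iff_0 by blast
  then obtain s where "poly (p * q) s \<noteq> 0" by blast
  then have "(\<Prod>i\<in>insert j I. f i (z + s *s (y - z))) \<noteq> 0"
    using insert.hyps p q by simp
  then show ?case by blast
qed simp

lemma has_derivative_vec_lambda:
  fixes f :: "'a::euclidean_space \<Rightarrow> 'n::finite \<Rightarrow> complex"
  assumes "\<And>i. ((\<lambda>x. f x i) has_derivative (\<lambda>h. f' h i)) F"
    and "F = at a"
  shows "((\<lambda>x. \<chi> i. f x i) has_derivative (\<lambda>h. \<chi> i. f' h i)) F"
  unfolding assms(2)
proof (subst has_derivative_componentwise_within, rule ballI)
  fix b :: "complex ^ 'n" assume "b \<in> Basis"
  then obtain i u where b: "b = axis i u" by (auto simp: Basis_vec_def)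
  show "((\<lambda>x. inner (\<chi> i. f x i) b) has_derivative (\<lambda>x. inner (\<chi> i. f' x i) b)) (at a)"
    unfolding b inner_axis using assms(1)[of i] by (simp add: assms(2) has_derivative_inner_left)
qed

lemma has_derivative_line: "((\<lambda>c. b + c *s a) has_derivative (\<lambda>h. h *s a)) (at (c :: complex))"
  for a b :: "complex ^ 'n"
proof -
  have "((\<lambda>c. \<chi> i. b $ i + c * a $ i) has_derivative (\<lambda>h. \<chi> i. h * a $ i)) (at c)"
    by (rule has_derivative_vec_lambda[where a = c]) (auto intro!: derivative_eq_intros)
  moreover have "(\<lambda>c. \<chi> i. b $ i + c * a $ i) = (\<lambda>c. b + c *s a)" "(\<lambda>h. \<chi> i. h * a $ i) = (\<lambda>h. h *s a)"
    by (auto simp: vec_eq_iff)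
  ultimately show ?thesis by simp
qed

lemma holomorphic_on_disc_in_chart:
  fixes \<psi> :: "complex ^ 'n \<Rightarrow> complex ^ 'n"
  assumes f: "is_poly S f"
    and \<psi>: "\<And>y. y \<in> V \<Longrightarrow> \<exists>E. vec_linear E \<and> (\<psi> has_derivative E) (at y)"
    and T: "\<And>c. c \<in> T \<Longrightarrow> b + c *s a \<in> V"
  shows "(\<lambda>c. f (\<psi> (b + c *s a))) holomorphic_on T"
  unfolding holomorphic_on_def
proof
  fix c assume c: "c \<in> T"
  obtain E where E: "vec_linear E" "(\<psi> has_derivative E) (at (b + c *s a))"
    using \<psi>[OF T[OF c]] by blast
  obtain d where "deg_le S d f" using f by (auto simp: is_poly_def)
  then obtain g where g: "\<And>z. (f has_derivative (\<lambda>h. \<Sum>i\<in>UNIV. g i z * h $ i)) (at z)"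
    using deg_le_gradient by blast
  define w where "w = \<psi> (b + c *s a)"
  have "((\<lambda>c. f (\<psi> (b + c *s a))) has_derivative (\<lambda>h. \<Sum>i\<in>UNIV. g i w * E (h *s a) $ i)) (at c)"
    unfolding w_def using has_derivative_compose[OF has_derivative_compose[OF has_derivative_line E(2)] g] .
  moreover have "(\<lambda>h. \<Sum>i\<in>UNIV. g i w * E (h *s a) $ i) = (*) (\<Sum>i\<in>UNIV. g i w * E a $ i)"
    by (rule ext) (simp add: vec_linearD[OF E(1)] sum_distrib_left sum_distrib_right mult_ac)
  ultimately have "((\<lambda>c. f (\<psi> (b + c *s a))) has_field_derivative (\<Sum>i\<in>UNIV. g i w * E a $ i)) (at c)"
    by (simp add: has_field_derivative_def)
  then show "(\<lambda>c. f (\<psi> (b + c *s a))) field_differentiable at c within T"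
    using field_differentiable_at_within field_differentiable_def by blast
qed

lemma norm_vec_smult: "norm (c *s x) = norm c * norm (x :: complex ^ 'n)"
  by (simp add: norm_vec_def norm_mult L2_set_right_distrib)

lemma submanifold_chart_inverse:
  assumes "submanifold_chart X p U \<phi> L"
  shows "\<exists>\<psi>. open U \<and> p \<in> U \<and> open (\<phi> ` U) \<and> (\<forall>z\<in>U. \<psi> (\<phi> z) = z) \<and>
    continuous_on U \<phi> \<and> continuous_on (\<phi> ` U) \<psi> \<and>
    (\<forall>z\<in>U. \<exists>E. vec_linear E \<and> (\<phi> has_derivative E) (at z)) \<and>
    (\<forall>y\<in>\<phi> ` U. \<exists>E. vec_linear E \<and> (\<psi> has_derivative E) (at y))"
proof -
  obtain \<psi> where \<psi>: "holomorphic_map_on \<phi> U" "holomorphic_map_on \<psi> (\<phi> ` U)" "\<forall>z\<in>U. \<psi> (\<phi> z) = z"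
    "p \<in> U"
    using assms unfolding submanifold_chart_def biholomorphic_on_def by blast
  have "continuous_on A f" if "holomorphic_map_on f A" for f A
    using that unfolding holomorphic_map_on_def
    by (meson continuous_at_imp_continuous_on has_derivative_continuous)
  then show ?thesis using \<psi> unfolding holomorphic_map_on_def by blast
qed

lemma norm_add_sq: "(norm (a + b :: 'a :: real_inner))\<^sup>2 = (norm a)\<^sup>2 + 2 * inner a b + (norm b)\<^sup>2"
  by (simp add: power2_norm_eq_inner inner_add_left inner_add_right inner_commute)

lemma inner_complex_Re: "inner a b = Re (cnj a * b)"
  by (simp add: inner_complex_def)

text \<open>The exponent is, up to a pluriharmonic term, strictly subharmonic along \<open>g\<close>, because \<open>g\<close>
  is transversal to the line \<open>c *s v\<close>; so the weighted modulus of \<open>d\<close> has no local maximum.\<close>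

lemma no_weighted_local_max:
  fixes g :: "complex \<Rightarrow> complex ^ 'n"
  assumes r: "r > 0" and g: "\<And>i. (\<lambda>c. g c $ i) holomorphic_on ball 0 r"
    and d: "d holomorphic_on ball 0 r" "d 0 \<noteq> 0"
    and der: "(g has_derivative (\<lambda>c. c *s w)) (at 0)"
    and w: "norm (w - v) \<ge> \<epsilon>" "\<epsilon> > 0" and k: "\<kappa> > 0" and \<eta>: "8 * \<eta> = \<epsilon>\<^sup>2"
    and max: "\<And>c. c \<in> ball 0 r \<Longrightarrow>
      norm (d c) * exp (\<kappa> * ((norm (g c - (s + c) *s v))\<^sup>2 - \<eta> * (norm (s + c - x))\<^sup>2)) \<le>
      norm (d 0) * exp (\<kappa> * ((norm (g 0 - s *s v))\<^sup>2 - \<eta> * (norm (s - x))\<^sup>2))"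
  shows False
proof -
  define u where "u c = g c - (s + c) *s v" for c
  \<comment> \<open>\<open>Re (q c)\<close> is the part of the exponent that is linear in
    \<open>u c - u 0\<close> and in \<open>c\<close>. As \<open>q\<close> is holomorphic, this part
    is absorbed into \<open>h\<close>; only the squares collected in \<open>B\<close> and a constant
    remain.\<close>
  define q where "q c = 2 * (\<Sum>i\<in>UNIV. cnj (u 0 $ i) * (u c $ i - u 0 $ i)) - 2 * of_real \<eta> * cnj (s - x) * c" for c
  define h where "h c = d c * exp (of_real \<kappa> * q c)" for c
  have h_holo: "h holomorphic_on ball 0 r"
    unfolding h_def q_def u_def using g d(1) by (auto intro!: holomorphic_intros)
  have "(u has_derivative (\<lambda>c. c *s w - c *s v)) (at 0)"
    unfolding u_def
  proof (rule has_derivative_diff[OF der])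
    have "((\<lambda>c. s *s v + c *s v) has_derivative (\<lambda>c. c *s v)) (at 0)" by (rule has_derivative_line)
    then show "((\<lambda>c. (s + c) *s v) has_derivative (\<lambda>c. c *s v)) (at 0)"
      by (simp add: vector_sadd_rdistrib)
  qed
  then have "\<exists>e>0. \<forall>c. norm (c - 0) < e \<longrightarrow> norm (u c - u 0 - ((c - 0) *s w - (c - 0) *s v)) \<le> \<epsilon> / 2 * norm (c - 0)"
    unfolding has_derivative_at_alt using w(2) by (meson half_gt_zero)
  then obtain e where e: "e > 0" "\<And>c. norm c < e \<Longrightarrow> norm (u c - u 0 - (c *s w - c *s v)) \<le> \<epsilon> / 2 * norm c"
    by auto
  have lower: "\<epsilon> / 2 * norm c \<le> norm (u c - u 0)" if c: "norm c < e" for c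
  proof -
    have "c *s w - c *s v = c *s (w - v)" by (simp add: vec_eq_iff right_diff_distrib)
    then have "norm (c *s w - c *s v) = norm c * norm (w - v)" by (simp only: norm_vec_smult)
    then have "norm c * \<epsilon> \<le> norm (c *s w - c *s v)" using w(1) by (simp add: mult_left_mono)
    also have "\<dots> \<le> norm (u c - u 0) + norm (u c - u 0 - (c *s w - c *s v))"
      using norm_triangle_ineq4[of "u c - u 0" "u c - u 0 - (c *s w - c *s v)"] by simp
    finally show ?thesis using e(2)[OF c] by (simp add: mult.commute)
  qed
  have Req: "Re (q c) = 2 * inner (u 0) (u c - u 0) - \<eta> * (2 * inner (s - x) c)" for c
    by (simp add: q_def inner_vec_def inner_complex_Re algebra_simps)
  define \<rho> where "\<rho> = min e r"
  have \<rho>: "\<rho> > 0" "ball 0 \<rho> \<subseteq> ball (0::complex) r" using e(1) r by (auto simp: \<rho>_def)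
  have strict: "norm (h c) < norm (h 0)" if c: "c \<in> ball 0 \<rho>" "c \<noteq> 0" for c
  proof -
    define A where "A = (norm (u 0))\<^sup>2 - \<eta> * (norm (s - x))\<^sup>2"
    define B where "B = (norm (u c - u 0))\<^sup>2 - \<eta> * (norm c)\<^sup>2"
    have split: "(norm (g c - (s + c) *s v))\<^sup>2 - \<eta> * (norm (s + c - x))\<^sup>2 = Re (q c) + A + B"
    proof -
      have "(norm (u c))\<^sup>2 = (norm (u 0))\<^sup>2 + 2 * inner (u 0) (u c - u 0) + (norm (u c - u 0))\<^sup>2"
        using norm_add_sq[of "u 0" "u c - u 0"] by simp
      moreover have "(norm (s + c - x))\<^sup>2 = (norm (s - x))\<^sup>2 + 2 * inner (s - x) c + (norm c)\<^sup>2"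
        using norm_add_sq[of "s - x" c] by (simp add: algebra_simps)
      ultimately show ?thesis
        unfolding Req A_def B_def u_def[of c, symmetric] by (simp only: distrib_left)
    qed
    have nh: "norm (h y) = norm (d y) * exp (\<kappa> * Re (q y))" for y
      by (simp add: h_def norm_mult)
    have "norm (h c) * (exp (\<kappa> * A) * exp (\<kappa> * B)) = norm (d c) * exp (\<kappa> * (Re (q c) + A + B))"
      unfolding nh by (simp add: exp_add[symmetric] distrib_left mult.assoc)
    also have "\<dots> \<le> norm (d 0) * exp (\<kappa> * A)"
      using max[of c] c \<rho>(2) unfolding split A_def u_def by auto
    also have "\<dots> = norm (h 0) * exp (\<kappa> * A)" unfolding nh by (simp add: q_def)
    finally have "exp (\<kappa> * A) * (norm (h c) * exp (\<kappa> * B)) \<le> exp (\<kappa> * A) * norm (h 0)"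
      by (simp add: mult_ac)
    then have le: "norm (h c) * exp (\<kappa> * B) \<le> norm (h 0)"
      by (rule mult_left_le_imp_le) (rule exp_gt_zero)
    have "(\<epsilon> / 2 * norm c)\<^sup>2 \<le> (norm (u c - u 0))\<^sup>2"
      using lower[of c] c w(2) by (intro power_mono) (auto simp: \<rho>_def)
    then have "\<epsilon>\<^sup>2 / 4 * (norm c)\<^sup>2 \<le> (norm (u c - u 0))\<^sup>2" by (simp add: power_mult_distrib power_divide)
    \<comment> \<open>The derivative estimate has cost half of \<open>\<epsilon>\<close>. What is
      left is \<open>\<epsilon>\<^sup>2 / 4 = 2 * \<eta>\<close>: one \<open>\<eta>\<close> pays for
      the penalty and the other one remains.\<close>
    then have "\<eta> * (norm c)\<^sup>2 \<le> B" unfolding \<eta>[symmetric] B_def by simp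
    moreover have "8 * \<eta> > 0" unfolding \<eta> using w(2) by simp
    then have "\<eta> * (norm c)\<^sup>2 > 0" using c(2) by simp
    ultimately have expB: "exp (\<kappa> * B) > 1" using k by simp
    have "norm (h 0) > 0" using d(2) by (simp add: h_def)
    then show ?thesis
    proof (cases "h c = 0")
      case False
      then have "norm (h c) * 1 < norm (h c) * exp (\<kappa> * B)"
        using expB by (intro mult_strict_left_mono) auto
      then show ?thesis using le by simp
    qed simp
  qed
  have "h constant_on ball 0 \<rho>"
  proof (rule maximum_modulus_principle[of h "ball 0 \<rho>" "ball 0 \<rho>" 0])
    show "h holomorphic_on ball 0 \<rho>" using h_holo \<rho>(2) by (rule holomorphic_on_subset)
    show "cmod (h c) \<le> cmod (h 0)" if "c \<in> ball 0 \<rho>" for c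
      using strict[OF that] by (cases "c = 0") auto
  qed (use \<rho> in auto)
  then obtain b where b: "\<And>c. c \<in> ball 0 \<rho> \<Longrightarrow> h c = b" unfolding constant_on_def by blast
  have "complex_of_real (\<rho> / 2) \<in> ball 0 \<rho>" "complex_of_real (\<rho> / 2) \<noteq> 0" "0 \<in> ball (0::complex) \<rho>"
    using \<rho>(1) by auto
  then show False using strict[of "complex_of_real (\<rho> / 2)"] b by fastforce
qed

text \<open>\<open>h\<close> is the homogeneous part of degree \<open>d\<close>, which is zero if
  the actual degree is smaller; division by \<open>x j ^ d\<close> sends all other parts to
  \<open>0\<close>.\<close>

lemma deg_le_asymptotic:
  assumes f: "deg_le S d f"
  shows "\<exists>h. deg_le S d h \<and> (\<forall>c z. h (c *s z) = c ^ d * h z) \<and>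
    (\<forall>(x :: nat \<Rightarrow> complex) y y0. filterlim (\<lambda>j. norm (x j)) at_top sequentially \<longrightarrow> y \<longlonglongrightarrow> y0 \<longrightarrow>
      (\<lambda>j. f (x j *s y j) / x j ^ d) \<longlonglongrightarrow> h y0)"
proof -
  obtain P where P: "\<And>z c. f (c *s z) = poly (P z) c" "\<And>z. degree (P z) \<le> d"
    "\<And>e. deg_le S e (\<lambda>z. coeff (P z) e)"
    using deg_le_homogeneous_parts[OF f] by blast
  have "(\<lambda>j. f (x j *s y j) / x j ^ d) \<longlonglongrightarrow> coeff (P y0) d"
    if x: "filterlim (\<lambda>j. norm (x j)) at_top sequentially" and y: "y \<longlonglongrightarrow> y0" for x :: "nat \<Rightarrow> complex" and y y0
  proof -
    have inv: "(\<lambda>j. inverse (x j)) \<longlonglongrightarrow> 0"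
    proof (rule tendsto_norm_zero_cancel)
      show "(\<lambda>j. norm (inverse (x j))) \<longlonglongrightarrow> 0"
        using tendsto_inverse_0_at_top[OF x] by (simp add: norm_inverse)
    qed
    have co: "(\<lambda>j. coeff (P (y j)) e) \<longlonglongrightarrow> coeff (P y0) e" for e
    proof -
      have "isCont (\<lambda>z. coeff (P z) e) y0"
        using is_poly_continuous[OF is_polyI[OF P(3)], of UNIV] by (simp add: continuous_on_eq_continuous_at)
      then show ?thesis using y by (rule isCont_tendsto_compose)
    qed
    have "(\<lambda>j. \<Sum>e\<le>d. coeff (P (y j)) e * inverse (x j) ^ (d - e)) \<longlonglongrightarrow>
        (\<Sum>e\<le>d. coeff (P y0) e * 0 ^ (d - e))"
      by (intro tendsto_sum tendsto_mult co tendsto_power inv)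
    moreover have "(\<Sum>e\<le>d. coeff (P y0) e * 0 ^ (d - e)) = coeff (P y0) d"
    proof -
      have "(\<Sum>e\<le>d. coeff (P y0) e * 0 ^ (d - e)) = (\<Sum>e\<in>{d}. coeff (P y0) e * 0 ^ (d - e))"
        by (rule sum.mono_neutral_right) auto
      then show ?thesis by simp
    qed
    moreover have "\<forall>\<^sub>F j in sequentially. (\<Sum>e\<le>d. coeff (P (y j)) e * inverse (x j) ^ (d - e)) =
        f (x j *s y j) / x j ^ d"
      using filterlim_at_top_dense[THEN iffD1, OF x, rule_format, of 0]
    proof eventually_elim
      case (elim j)
      then have xj: "x j \<noteq> 0" by auto
      have "f (x j *s y j) = poly (\<Sum>e\<le>d. monom (coeff (P (y j)) e) e) (x j)"
        using P(1,2) by (simp only: poly_as_sum_of_monoms')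
      also have "\<dots> = (\<Sum>e\<le>d. coeff (P (y j)) e * x j ^ e)" by (simp only: poly_sum poly_monom)
      finally show ?case
        using xj by (auto simp: sum_divide_distrib power_diff divide_simps intro!: sum.cong)
    qed
    ultimately show ?thesis using Lim_transform_eventually[of _ "coeff (P y0) d"] by simp
  qed
  moreover have "coeff (P (c *s z)) d = c ^ d * coeff (P z) d" for c z
    by (rule homogeneous_coeff[of f P]) (rule P(1))
  ultimately show ?thesis using P(3)[of d] by (intro exI[of _ "\<lambda>z. coeff (P z) d"]) blast
qed

text \<open>The leading forms of the monic equation of \<open>z $ i\<close> over \<open>S\<close> give the monic equation for the
  asymptotic directions of \<open>X\<close>.\<close>

lemma asymptotic_equation:
  assumes "integral_over X S i"
  shows "\<exists>q. (\<forall>z. q z \<noteq> 0) \<and> (\<forall>z z'. (\<forall>i\<in>S. z $ i = z' $ i) \<longrightarrow> q z = q z') \<and>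
    (\<forall>z c t. c \<noteq> 0 \<longrightarrow> poly (q (c *s z)) (c * t) = 0 \<longrightarrow> poly (q z) t = 0) \<and>
    (\<forall>(x :: nat \<Rightarrow> complex) y y0. filterlim (\<lambda>j. norm (x j)) at_top sequentially \<longrightarrow> y \<longlonglongrightarrow> y0 \<longrightarrow>
      (\<forall>j. x j *s y j \<in> X) \<longrightarrow> poly (q y0) (y0 $ i) = 0)"
proof -
  obtain d H where H: "monic_family S d H" "\<And>z. z \<in> X \<Longrightarrow> poly (H z) (z $ i) = 0"
    using assms by (auto simp: integral_over_def)
  have "\<forall>l\<in>{..d}. \<exists>h. deg_le S (d - l) h \<and> (\<forall>c z. h (c *s z) = c ^ (d - l) * h z) \<and>
    (\<forall>(x :: nat \<Rightarrow> complex) y y0. filterlim (\<lambda>j. norm (x j)) at_top sequentially \<longrightarrow> y \<longlonglongrightarrow> y0 \<longrightarrow>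
      (\<lambda>j. coeff (H (x j *s y j)) l / x j ^ (d - l)) \<longlonglongrightarrow> h y0)"
    by (intro ballI deg_le_asymptotic[OF wdeg_le_imp_deg_le[OF monic_familyD(4)[OF H(1)]]])
  from bchoice[OF this] obtain h where
    "\<forall>l\<in>{..d}. deg_le S (d - l) (h l) \<and> (\<forall>c z. h l (c *s z) = c ^ (d - l) * h l z) \<and>
    (\<forall>(x :: nat \<Rightarrow> complex) y y0. filterlim (\<lambda>j. norm (x j)) at_top sequentially \<longrightarrow> y \<longlonglongrightarrow> y0 \<longrightarrow>
      (\<lambda>j. coeff (H (x j *s y j)) l / x j ^ (d - l)) \<longlonglongrightarrow> h l y0)" by blast
  then have h: "\<And>l. l \<le> d \<Longrightarrow> deg_le S (d - l) (h l)"
    "\<And>l c z. l \<le> d \<Longrightarrow> h l (c *s z) = c ^ (d - l) * h l z"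
    "\<And>l (x :: nat \<Rightarrow> complex) y y0. l \<le> d \<Longrightarrow> filterlim (\<lambda>j. norm (x j)) at_top sequentially \<Longrightarrow> y \<longlonglongrightarrow> y0 \<Longrightarrow>
      (\<lambda>j. coeff (H (x j *s y j)) l / x j ^ (d - l)) \<longlonglongrightarrow> h l y0"
    by simp_all
  \<comment> \<open>The top coefficient is constantly \<open>1\<close>, and so is its limit, here
    taken along \<open>x j = of_nat j\<close>. Therefore the asymptotic polynomial
    \<open>q z\<close> is nonzero for all \<open>z\<close>.\<close>
  have hd: "h d z = 1" for z
  proof -
    have "filterlim (\<lambda>j. norm (of_nat j :: complex)) at_top sequentially"
      by (simp add: filterlim_real_sequentially)
    then have "(\<lambda>j. coeff (H (of_nat j *s z)) d / of_nat j ^ (d - d)) \<longlonglongrightarrow> h d z"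
      by (intro h(3)) auto
    then have "(\<lambda>j::nat. 1 :: complex) \<longlonglongrightarrow> h d z" using monic_familyD(2)[OF H(1)] by simp
    from LIMSEQ_unique[OF this tendsto_const] show ?thesis by simp
  qed
  define q where "q z = (\<Sum>l\<le>d. monom (h l z) l)" for z
  have pq: "poly (q z) t = (\<Sum>l\<le>d. h l z * t ^ l)" for z t
    by (simp add: q_def poly_sum poly_monom)
  have "coeff (q z) d = h d z" for z by (simp add: q_def coeff_sum)
  then have "coeff (q z) d \<noteq> 0" for z using hd[of z] by simp
  then have q1: "q z \<noteq> 0" for z by (metis coeff_0)
  have q2: "q z = q z'" if "\<forall>i\<in>S. z $ i = z' $ i" for z z'
  proof -
    have "h l z = h l z'" if "l \<le> d" for l
      using deg_le_cong_coord[OF h(1)[OF that], of z z'] \<open>\<forall>i\<in>S. z $ i = z' $ i\<close> by blast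
    then show ?thesis unfolding q_def by (intro sum.cong) auto
  qed
  have q3: "poly (q z) t = 0" if c: "c \<noteq> 0" and 0: "poly (q (c *s z)) (c * t) = 0" for z c t
  proof -
    have "poly (q (c *s z)) (c * t) = (\<Sum>l\<le>d. c ^ d * (h l z * t ^ l))"
      unfolding pq
    proof (rule sum.cong)
      fix l assume "l \<in> {..d}"
      then have "c ^ d = c ^ (d - l) * c ^ l" by (simp flip: power_add)
      then show "h l (c *s z) * (c * t) ^ l = c ^ d * (h l z * t ^ l)"
        using h(2)[of l c z] \<open>l \<in> {..d}\<close> by (simp add: power_mult_distrib mult_ac)
    qed simp
    also have "\<dots> = c ^ d * poly (q z) t" unfolding pq by (simp add: sum_distrib_left)
    finally show ?thesis using c 0 by simp
  qed
  have q4: "poly (q y0) (y0 $ i) = 0"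
    if x: "filterlim (\<lambda>j. norm (x j)) at_top sequentially" and y: "y \<longlonglongrightarrow> y0" and X: "\<forall>j. x j *s y j \<in> X"
    for x :: "nat \<Rightarrow> complex" and y y0
  proof -
    have "(\<lambda>j. \<Sum>l\<le>d. coeff (H (x j *s y j)) l / x j ^ (d - l) * (y j $ i) ^ l) \<longlonglongrightarrow>
        (\<Sum>l\<le>d. h l y0 * (y0 $ i) ^ l)"
      using h(3)[OF _ x y] y by (intro tendsto_sum tendsto_mult tendsto_power tendsto_vec_nth) auto
    moreover have "\<forall>\<^sub>F j in sequentially.
        (\<Sum>l\<le>d. coeff (H (x j *s y j)) l / x j ^ (d - l) * (y j $ i) ^ l) = 0"
      using filterlim_at_top_dense[THEN iffD1, OF x, rule_format, of 0]
    proof eventually_elim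
      case (elim j)
      then have xj: "x j \<noteq> 0" by auto
      have H_eq: "(\<Sum>l\<le>d. monom (coeff (H (x j *s y j)) l) l) = H (x j *s y j)"
        using monic_familyD(1)[OF H(1)] by (intro poly_as_sum_of_monoms') simp
      have "0 = poly (\<Sum>l\<le>d. monom (coeff (H (x j *s y j)) l) l) ((x j *s y j) $ i)"
        unfolding H_eq using H(2)[of "x j *s y j"] X by metis
      also have "\<dots> = (\<Sum>l\<le>d. coeff (H (x j *s y j)) l * (x j * y j $ i) ^ l)"
        by (simp add: poly_sum poly_monom)
      also have "\<dots> = (\<Sum>l\<le>d. x j ^ d * (coeff (H (x j *s y j)) l / x j ^ (d - l) * (y j $ i) ^ l))"
      proof (rule sum.cong)
        fix l assume "l \<in> {..d}"
        then have "x j ^ d = x j ^ (d - l) * x j ^ l" by (simp flip: power_add)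
        then show "coeff (H (x j *s y j)) l * (x j * y j $ i) ^ l =
            x j ^ d * (coeff (H (x j *s y j)) l / x j ^ (d - l) * (y j $ i) ^ l)"
          using xj by (simp add: power_mult_distrib)
      qed simp
      finally have "x j ^ d * (\<Sum>l\<le>d. coeff (H (x j *s y j)) l / x j ^ (d - l) * (y j $ i) ^ l) = 0"
        by (simp add: sum_distrib_left)
      then show ?case using xj by simp
    qed
    ultimately have "(\<lambda>j. 0) \<longlonglongrightarrow> (\<Sum>l\<le>d. h l y0 * (y0 $ i) ^ l)"
      by (rule Lim_transform_eventually)
    from LIMSEQ_unique[OF this tendsto_const] show ?thesis unfolding pq .
  qed
  show ?thesis
  proof (intro exI[of _ q] conjI allI impI)
    show "q z = q z'" if "\<forall>i\<in>S. z $ i = z' $ i" for z z' using that by (rule q2)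
    show "poly (q z) t = 0" if "c \<noteq> 0" "poly (q (c *s z)) (c * t) = 0" for z c t
      using that by (rule q3)
    show "poly (q y0) (y0 $ i) = 0"
      if "filterlim (\<lambda>j. norm (x j)) at_top sequentially" "y \<longlonglongrightarrow> y0" "\<forall>j. x j *s y j \<in> X"
      for x :: "nat \<Rightarrow> complex" and y y0
      using that by (rule q4)
  qed (rule q1)
qed

lemma zero_in_tangent_space:
  assumes "submanifold_chart X p U \<phi> L" shows "0 \<in> tangent_space X p"
proof -
  have "frechet_derivative \<phi> (at p) 0 = 0"
    using submanifold_chart_derivative[OF assms] by (intro linear_0 has_derivative_linear)
  moreover have "0 \<in> L" using assms by (simp add: submanifold_chart_def vec.subspace_0)
  ultimately show ?thesis unfolding tangent_space_def using assms by force
qed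

lemma tendsto_vec_smult:
  fixes c :: "'a \<Rightarrow> complex" and y :: "'a \<Rightarrow> complex ^ 'n"
  assumes "(c \<longlongrightarrow> c0) F" "(y \<longlongrightarrow> y0) F" shows "((\<lambda>j. c j *s y j) \<longlongrightarrow> c0 *s y0) F"
  using assms by (intro vec_tendstoI) (auto intro!: tendsto_intros)

section \<open>Normalized varieties\<close>

text \<open>The situation after Noether normalization: \<open>X\<close> is finite over the coordinates in \<open>S\<close>, and off the
  zeros of the discriminant \<open>D\<close> the other coordinates are simple roots of polynomials over them.\<close>

locale normalized_variety =
  fixes X :: "(complex ^ 'n) set" and F :: "(complex ^ 'n \<Rightarrow> complex) set" and k :: nat
    and S :: "'n set" and D :: "complex ^ 'n \<Rightarrow> complex"
    and K :: "'n \<Rightarrow> complex ^ 'n \<Rightarrow> complex poly" and e :: "'n \<Rightarrow> nat"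
  assumes X_eq: "X = {z. \<forall>f\<in>F. f z = 0}" and F_poly: "\<And>f. f \<in> F \<Longrightarrow> is_poly UNIV f"
    and pure: "pure_dimensional k X"
    and onto: "\<And>y. \<exists>z\<in>X. \<forall>i\<in>S. z $ i = y $ i"
    and integral: "\<And>i. i \<notin> S \<Longrightarrow> integral_over X S i"
    and D_poly: "is_poly S D" and D_nonzero: "\<exists>y. D y \<noteq> 0"
    and K_family: "\<And>i. i \<notin> S \<Longrightarrow> poly_family S (e i) (K i)"
    and K_root: "\<And>i z. i \<notin> S \<Longrightarrow> z \<in> X \<Longrightarrow> D z \<noteq> 0 \<Longrightarrow> poly (K i z) (z $ i) = 0"
    and K_simple: "\<And>i z. i \<notin> S \<Longrightarrow> z \<in> X \<Longrightarrow> D z \<noteq> 0 \<Longrightarrow> poly (pderiv (K i z)) (z $ i) \<noteq> 0"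
begin

definition LS :: "(complex ^ 'n) set" where "LS = {z. \<forall>i. i \<notin> S \<longrightarrow> z $ i = 0}"

definition pr :: "complex ^ 'n \<Rightarrow> complex ^ 'n" where "pr z = (\<chi> i. if i \<in> S then z $ i else 0)"

text \<open>Where \<open>D\<close> is nonzero, \<open>X\<close> satisfies the equations
  \<open>K i\<close>, so \<open>Phi\<close> sends it into the slice \<open>LS\<close>. A component
  \<open>i\<close> depends only on the coordinates in \<open>insert i S\<close>: the Jacobian is
  triangular, with \<open>1\<close> and the values of \<open>pderiv (K i z)\<close> on the
  diagonal.\<close>

definition Phi :: "complex ^ 'n \<Rightarrow> complex ^ 'n" where
  "Phi z = (\<chi> i. if i \<in> S then z $ i else poly (K i z) (z $ i))"

section \<open>Straightening by the simple equations\<close>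

lemma X_closed: "closed X"
proof -
  have "closed {z. f z = 0}" if "f \<in> F" for f
    using is_poly_continuous[OF F_poly[OF that], of UNIV] by (intro closed_Collect_eq) auto
  then have "closed (\<Inter>f\<in>F. {z. f z = 0})" by blast
  moreover have "X = (\<Inter>f\<in>F. {z. f z = 0})" unfolding X_eq by auto
  ultimately show ?thesis by simp
qed

lemma pr_in_LS: "pr z \<in> LS" by (simp add: pr_def LS_def)

lemma pr_LS: "y \<in> LS \<Longrightarrow> pr y = y" by (auto simp: pr_def LS_def vec_eq_iff)

lemma pr_eq: "pr z = pr y \<longleftrightarrow> (\<forall>i\<in>S. z $ i = y $ i)" by (auto simp: pr_def vec_eq_iff)

lemma continuous_pr: "continuous_on A pr"
  unfolding pr_def
proof (rule continuous_on_vec_lambda)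
  show "continuous_on A (\<lambda>z. if i \<in> S then z $ i else 0)" for i
    by (cases "i \<in> S") (auto intro!: continuous_intros)
qed

lemma D_pr: "D (pr z) = D z"
  by (rule is_poly_cong_coord[OF D_poly]) (simp add: pr_def)

lemma LS_vec_subspace: "vec.subspace LS"
  by (auto simp: LS_def vec.subspace_def)

lemma LS_subspace: "subspace LS"
  by (auto simp: LS_def subspace_def)

lemma Phi_pr: "z \<in> X \<Longrightarrow> D z \<noteq> 0 \<Longrightarrow> Phi z = pr z"
  by (auto simp: Phi_def pr_def vec_eq_iff K_root)

lemma Phi_coord: "i \<in> S \<Longrightarrow> Phi z $ i = z $ i"
  by (simp add: Phi_def)

lemma D_open: "open {z. D z \<noteq> 0}"
  using is_poly_continuous[OF D_poly, of UNIV] by (intro open_Collect_neq) auto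

lemma Phi_component_poly: "is_poly (insert i S) (\<lambda>z. Phi z $ i)"
  using is_poly_eval_family[OF K_family] by (cases "i \<in> S") (auto simp: Phi_def intro: is_poly_coord)

lemma Phi_gradient:
  "\<exists>g. \<forall>i. (\<forall>j. is_poly (insert i S) (g i j)) \<and> (\<forall>j. j \<notin> insert i S \<longrightarrow> g i j = (\<lambda>_. 0)) \<and>
    (\<forall>z. ((\<lambda>z. Phi z $ i) has_derivative (\<lambda>h. \<Sum>j\<in>UNIV. g i j z * h $ j)) (at z))"
proof (rule choice, rule allI)
  fix i
  obtain d where "deg_le (insert i S) d (\<lambda>z. Phi z $ i)"
    using Phi_component_poly unfolding is_poly_def by blast
  then show "\<exists>g. (\<forall>j. is_poly (insert i S) (g j)) \<and> (\<forall>j. j \<notin> insert i S \<longrightarrow> g j = (\<lambda>_. 0)) \<and>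
    (\<forall>z. ((\<lambda>z. Phi z $ i) has_derivative (\<lambda>h. \<Sum>j\<in>UNIV. g j z * h $ j)) (at z))"
    by (rule deg_le_gradient)
qed

lemma Phi_holomorphic: "\<exists>E. vec_linear E \<and> (Phi has_derivative E) (at z)"
proof -
  obtain g where
    g: "\<And>i z. ((\<lambda>z. Phi z $ i) has_derivative (\<lambda>h. \<Sum>j\<in>UNIV. g i j z * h $ j)) (at z)"
    using Phi_gradient by blast
  have "((\<lambda>z. \<chi> i. Phi z $ i) has_derivative (\<lambda>h. \<chi> i. \<Sum>j\<in>UNIV. g i j z * h $ j)) (at z)"
    by (rule has_derivative_vec_lambda[OF g refl])
  then have "(Phi has_derivative (\<lambda>h. \<chi> i. \<Sum>j\<in>UNIV. g i j z * h $ j)) (at z)" by simp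
  moreover have "vec_linear (\<lambda>h. \<chi> i. \<Sum>j\<in>UNIV. g i j z * h $ j)"
    by (rule vec_linearI) (auto simp: vec_eq_iff sum_distrib_left distrib_left sum.distrib mult_ac)
  ultimately show ?thesis by blast
qed

text \<open>The triangular Jacobian is injective at \<open>q\<close> because the roots are simple.
  The image is cut down to a ball so that complex lines meet it in a convex, hence connected, set,
  as the identity theorem requires.\<close>

lemma Phi_local_inverse:
  assumes q: "q \<in> X" "D q \<noteq> 0"
  shows "\<exists>U \<rho> \<psi>. \<rho> > 0 \<and> open U \<and> q \<in> U \<and> homeomorphism U (ball (Phi q) \<rho>) Phi \<psi> \<and>
    (\<forall>y\<in>ball (Phi q) \<rho>. \<exists>E. vec_linear E \<and> (\<psi> has_derivative E) (at y)) \<and>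
    (\<forall>z\<in>U. D z \<noteq> 0)"
proof -
  obtain g where
    "\<forall>i. (\<forall>j. is_poly (insert i S) (g i j)) \<and> (\<forall>j. j \<notin> insert i S \<longrightarrow> g i j = (\<lambda>_. 0)) \<and>
      (\<forall>z. ((\<lambda>z. Phi z $ i) has_derivative (\<lambda>h. \<Sum>j\<in>UNIV. g i j z * h $ j)) (at z))"
    using Phi_gradient by blast
  then have g: "\<And>i j. is_poly (insert i S) (g i j)"
    "\<And>i j. j \<notin> insert i S \<Longrightarrow> g i j = (\<lambda>_. 0)"
    "\<And>i z. ((\<lambda>z. Phi z $ i) has_derivative (\<lambda>h. \<Sum>j\<in>UNIV. g i j z * h $ j)) (at z)"
    by blast+
  define P where "P z h = (\<chi> i. \<Sum>j\<in>UNIV. g i j z * h $ j)" for z h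
  have lin: "vec_linear (P z)" for z
    by (rule vec_linearI) (auto simp: P_def vec_eq_iff sum_distrib_left distrib_left sum.distrib mult_ac)
  have der: "(Phi has_derivative P z) (at z)" for z
  proof -
    have "((\<lambda>z. \<chi> i. Phi z $ i) has_derivative (\<lambda>h. \<chi> i. \<Sum>j\<in>UNIV. g i j z * h $ j)) (at z)"
      by (rule has_derivative_vec_lambda[OF g(3) refl])
    then show ?thesis by (simp add: P_def[abs_def])
  qed
  have cont: "continuous_on UNIV (\<lambda>z. P z h)" for h
    unfolding P_def
  proof (intro continuous_on_vec_lambda continuous_intros)
    show "continuous_on UNIV (g i j)" for i j by (rule is_poly_continuous[OF g(1)])
  qed
  have inj: "inj (P q)"
  proof (rule injI)
    fix x y assume "P q x = P q y"
    define h where "h = x - y"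
    have "P q (y + h) = P q y + P q h" by (rule vec_linearD(1)[OF lin])
    then have "P q h = 0" using \<open>P q x = P q y\<close> by (simp add: h_def)
    then have Ph: "(\<Sum>j\<in>UNIV. g i j q * h $ j) = 0" for i by (simp add: P_def vec_eq_iff)
    have hS: "h $ i = 0" if "i \<in> S" for i
    proof -
      have "((\<lambda>z. z $ i) has_derivative (\<lambda>h. \<Sum>j\<in>UNIV. g i j q * h $ j)) (at q)"
        using g(3)[of i q] that by (simp add: Phi_coord)
      moreover have "((\<lambda>z. z $ i) has_derivative (\<lambda>h. h $ i)) (at q)"
        by (intro bounded_linear_imp_has_derivative bounded_linear_vec_nth)
      ultimately have "(\<lambda>h. \<Sum>j\<in>UNIV. g i j q * h $ j) = (\<lambda>h. h $ i)" by (rule has_derivative_unique)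
      from fun_cong[OF this, of h] show ?thesis using Ph[of i] by simp
    qed
    have "h $ i = 0" if i: "i \<notin> S" for i
    proof -
      have "(\<Sum>j\<in>UNIV. g i j q * h $ j) = (\<Sum>j\<in>{i}. g i j q * h $ j)"
      proof (rule sum.mono_neutral_right)
        show "\<forall>j\<in>UNIV - {i}. g i j q * h $ j = 0"
        proof
          fix j assume "j \<in> UNIV - {i}"
          then show "g i j q * h $ j = 0" using g(2)[of j i] hS[of j] by (cases "j \<in> S") auto
        qed
      qed auto
      then have 0: "g i i q * h $ i = 0" using Ph[of i] by simp
      have gax: "(\<Sum>j\<in>UNIV. g i j q * (c *s axis i 1) $ j) = g i i q * c" for c
      proof -
        have "(\<Sum>j\<in>UNIV. g i j q * (c *s axis i 1) $ j) = (\<Sum>j\<in>{i}. g i j q * (c *s axis i 1) $ j)"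
          by (rule sum.mono_neutral_right) (auto simp: axis_def)
        then show ?thesis by (simp add: axis_def)
      qed
      have line: "((\<lambda>c. q + c *s axis i 1) has_derivative (\<lambda>c. c *s axis i 1)) (at 0)"
      proof -
        have "((\<lambda>c. \<chi> j. q $ j + c * axis i 1 $ j) has_derivative (\<lambda>h. \<chi> j. h * axis i 1 $ j)) (at (0::complex))"
          by (rule has_derivative_vec_lambda[where a = 0]) (auto intro!: derivative_eq_intros)
        moreover have "(\<lambda>c. \<chi> j. q $ j + c * axis i 1 $ j) = (\<lambda>c. q + c *s axis i 1)"
          "(\<lambda>h. \<chi> j. h * axis i 1 $ j) = (\<lambda>h. h *s axis i (1::complex))"
          by (auto simp: vec_eq_iff)
        ultimately show ?thesis by simp
      qed
      have Pax: "Phi (q + c *s axis i 1) $ i = poly (K i q) (q $ i + c)" for c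
      proof -
        have "K i (q + c *s axis i 1) = K i q"
          by (rule poly_family_cong[OF K_family[OF i]]) (use i in \<open>auto simp: axis_def\<close>)
        then show ?thesis using i by (simp add: Phi_def axis_def)
      qed
      have "((\<lambda>z. Phi z $ i) has_derivative (\<lambda>h. \<Sum>j\<in>UNIV. g i j q * h $ j)) (at (q + 0 *s axis i 1))"
        using g(3)[of i q] by simp
      from has_derivative_compose[OF line this]
      have "((\<lambda>c. poly (K i q) (q $ i + c)) has_derivative (\<lambda>c. g i i q * c)) (at 0)"
        by (simp only: Pax gax)
      moreover have "((\<lambda>c. poly (K i q) (q $ i + c)) has_derivative
          (\<lambda>c. poly (pderiv (K i q)) (q $ i) * c)) (at 0)"
      proof -
        have "((\<lambda>c. poly (K i q) (q $ i + c)) has_field_derivative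
            poly (pderiv (K i q)) (q $ i + 0) * 1) (at 0)"
          by (rule DERIV_chain2[OF poly_DERIV]) (auto intro!: derivative_eq_intros)
        then show ?thesis by (simp add: has_field_derivative_def)
      qed
      ultimately have "(\<lambda>c. g i i q * c) = (\<lambda>c. poly (pderiv (K i q)) (q $ i) * c)"
        by (rule has_derivative_unique)
      from fun_cong[OF this, of 1] have "g i i q = poly (pderiv (K i q)) (q $ i)" by simp
      then show ?thesis using 0 K_simple[OF i q] by simp
    qed
    then have "h = 0" using hS by (auto simp: vec_eq_iff)
    then show "x = y" by (simp add: h_def)
  qed
  obtain U V \<psi> where UV: "open U" "q \<in> U" "open V" "homeomorphism U V Phi \<psi>"
    "\<And>y. y \<in> V \<Longrightarrow> \<exists>E. vec_linear E \<and> (\<psi> has_derivative E) (at y)"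
    using holomorphic_inverse_function[OF lin der cont inj] by blast
  have contPhi: "continuous_on UNIV Phi"
    using der by (meson continuous_at_imp_continuous_on has_derivative_continuous)
  have cont\<psi>: "continuous_on V \<psi>" and \<psi>Phi: "\<And>z. z \<in> U \<Longrightarrow> \<psi> (Phi z) = z"
    and Phi\<psi>: "\<And>y. y \<in> V \<Longrightarrow> Phi (\<psi> y) = y" and PhiV: "Phi ` U = V" and \<psi>U: "\<psi> ` V = U"
    using UV(4) by (auto simp: homeomorphism_def)
  define V1 where "V1 = V \<inter> \<psi> -` {z. D z \<noteq> 0}"
  have "open V1" unfolding V1_def using cont\<psi> UV(3) D_open by (rule continuous_open_preimage)
  moreover have "Phi q \<in> V1" using UV(2) PhiV \<psi>Phi q(2) by (auto simp: V1_def)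
  ultimately obtain \<rho> where \<rho>: "\<rho> > 0" "ball (Phi q) \<rho> \<subseteq> V1" by (meson openE)
  define W where "W = ball (Phi q) \<rho>"
  define U1 where "U1 = U \<inter> Phi -` W"
  have WV: "W \<subseteq> V" "W \<subseteq> V1" using \<rho>(2) by (auto simp: W_def V1_def)
  have "open (Phi -` W)" using contPhi by (intro open_vimage) (auto simp: W_def)
  then have "open U1" unfolding U1_def using UV(1) by blast
  moreover have "q \<in> U1" using UV(2) \<rho>(1) by (simp add: U1_def W_def)
  moreover have "homeomorphism U1 W Phi \<psi>"
    unfolding homeomorphism_def
  proof (intro conjI ballI)
    show "continuous_on U1 Phi" using contPhi continuous_on_subset by blast
    show "continuous_on W \<psi>" using cont\<psi> WV(1) by (rule continuous_on_subset)
    show "\<psi> (Phi z) = z" if "z \<in> U1" for z using that \<psi>Phi by (simp add: U1_def)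
    show "Phi (\<psi> y) = y" if "y \<in> W" for y using that WV Phi\<psi> by blast
    have 1: "\<psi> y \<in> U1" if "y \<in> W" for y
    proof -
      have "y \<in> V" using that WV(1) by blast
      then show ?thesis using that Phi\<psi>[of y] \<psi>U by (auto simp: U1_def)
    qed
    have 2: "Phi z \<in> W" if "z \<in> U1" for z using that by (simp add: U1_def)
    have 3: "\<psi> (Phi z) = z" if "z \<in> U1" for z using that \<psi>Phi by (simp add: U1_def)
    have 4: "Phi (\<psi> y) = y" if "y \<in> W" for y using that WV(1) Phi\<psi> by blast
    show "\<psi> ` W = U1"
    proof
      show "U1 \<subseteq> \<psi> ` W" using 2 3 by (metis image_eqI subsetI)
    qed (use 1 in blast)
    show "Phi ` U1 = W"
    proof
      show "W \<subseteq> Phi ` U1" using 1 4 by (metis image_eqI subsetI)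
    qed (use 2 in blast)
  qed
  moreover have "D z \<noteq> 0" if "z \<in> U1" for z
  proof -
    have "z \<in> U" "Phi z \<in> W" using that by (auto simp: U1_def)
    then have "Phi z \<in> V1" using WV(2) by blast
    then show ?thesis using \<psi>Phi[OF \<open>z \<in> U\<close>] by (simp add: V1_def)
  qed
  moreover have "\<forall>y\<in>W. \<exists>E. vec_linear E \<and> (\<psi> has_derivative E) (at y)"
    using UV(5) WV(1) by blast
  ultimately show ?thesis using \<rho>(1) unfolding W_def
    by (intro exI[of _ U1] exI[of _ \<rho>] exI[of _ \<psi>]) blast
qed

text \<open>The equations of \<open>X\<close> hold on an open piece of the slice \<open>LS\<close>, hence, by the identity theorem
  along complex lines, on the whole slice.\<close>

lemma chart_of_open_piece:
  assumes q: "q \<in> X" and U: "open U" "q \<in> U" and hom: "homeomorphism U (ball c \<rho>) Phi \<psi>"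
    and der: "\<And>y. y \<in> ball c \<rho> \<Longrightarrow> \<exists>E. vec_linear E \<and> (\<psi> has_derivative E) (at y)"
    and DU: "\<And>z. z \<in> U \<Longrightarrow> D z \<noteq> 0"
    and b: "b \<in> LS" "\<epsilon> > 0" "\<And>l. l \<in> LS \<Longrightarrow> l \<in> ball b \<epsilon> \<Longrightarrow> l \<in> pr ` (X \<inter> U)"
  shows "submanifold_chart X q U Phi LS"
proof -
  define W where "W = ball c \<rho>"
  have \<psi>Phi: "\<And>z. z \<in> U \<Longrightarrow> \<psi> (Phi z) = z" and Phi\<psi>: "\<And>y. y \<in> W \<Longrightarrow> Phi (\<psi> y) = y"
    and PhiU: "Phi ` U = W" and \<psi>W: "\<psi> ` W = U"
    using hom by (auto simp: homeomorphism_def W_def)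
  have piece: "l \<in> W \<and> \<psi> l \<in> X" if l: "l \<in> LS" "l \<in> ball b \<epsilon>" for l
  proof -
    obtain z where z: "z \<in> X" "z \<in> U" "l = pr z" using b(3)[OF l] by blast
    have "Phi z = l" using Phi_pr[OF z(1) DU[OF z(2)]] z(3) by simp
    moreover have "Phi z \<in> W" using z(2) PhiU by blast
    ultimately show ?thesis using z(1) \<psi>Phi[OF z(2)] by simp
  qed
  have bW: "b \<in> W" using piece[OF b(1)] b(2) by simp
  have all: "\<psi> l \<in> X" if l: "l \<in> LS" "l \<in> W" for l
  proof -
    define a where "a = l - b"
    define T where "T = {t. b + t *s a \<in> W}"
    have conv: "convex T"
    proof (rule convexI)
      fix x y and u v :: real assume xy: "x \<in> T" "y \<in> T" "0 \<le> u" "0 \<le> v" "u + v = 1"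
      have "u *\<^sub>R (b + x *s a) + v *\<^sub>R (b + y *s a) \<in> W"
        using xy unfolding T_def W_def by (intro convexD[OF convex_ball]) auto
      moreover have "u *\<^sub>R (b + x *s a) + v *\<^sub>R (b + y *s a) = b + (u *\<^sub>R x + v *\<^sub>R y) *s a"
      proof -
        have "u *\<^sub>R b + v *\<^sub>R b = b" using xy(5) by (metis scaleR_left_distrib scaleR_one)
        moreover have "u *\<^sub>R (b + x *s a) + v *\<^sub>R (b + y *s a) =
            (u *\<^sub>R b + v *\<^sub>R b) + (u *\<^sub>R x + v *\<^sub>R y) *s a"
          unfolding vec_eq_iff by (simp add: scaleR_conv_of_real[where 'a=complex] algebra_simps)
        ultimately show ?thesis by simp
      qed
      ultimately show "u *\<^sub>R x + v *\<^sub>R y \<in> T" by (simp add: T_def)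
    qed
    have contline: "continuous_on UNIV (\<lambda>t. b + t *s a)"
    proof -
      have "b + t *s a = (\<chi> i. b $ i + t * a $ i)" for t by (simp add: vec_eq_iff)
      then show ?thesis
        by (simp only:) (intro continuous_on_vec_lambda continuous_intros)
    qed
    have openT: "open T"
      using open_vimage[OF _ contline, of W] by (simp add: T_def W_def vimage_def)
    define T0 where "T0 = {t. b + t *s a \<in> ball b \<epsilon>}"
    have openT0: "open T0" using open_vimage[OF _ contline, of "ball b \<epsilon>"] by (simp add: T0_def vimage_def)
    have onLS: "b + t *s a \<in> LS" for t
      using vec.subspace_add[OF LS_vec_subspace b(1) vec.subspace_scale[OF LS_vec_subspace
            vec.subspace_diff[OF LS_vec_subspace l(1) b(1)]]] by (simp add: a_def)
    have "f (\<psi> l) = 0" if f: "f \<in> F" for f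
    proof -
      \<comment> \<open>Along the line from \<open>b\<close> to \<open>l\<close> the equation is
        holomorphic on the convex set \<open>T\<close>. It holds on the nonempty open part
        \<open>T0\<close>, over which the slice is covered by \<open>X\<close>, hence also at
        parameter \<open>1\<close>, which is \<open>l\<close>.\<close>
      have "f (\<psi> (b + 1 *s a)) = 0"
      proof (rule analytic_continuation_open[of "T0" T "\<lambda>t. f (\<psi> (b + t *s a))" "\<lambda>_. 0"])
        show "open T0" "open T" by (fact openT0, fact openT)
        have "0 \<in> T0" using b(2) by (simp add: T0_def)
        then show "T0 \<noteq> {}" by blast
        show "connected T" using conv by (rule convex_connected)
        show "T0 \<subseteq> T" using piece onLS by (auto simp: T0_def T_def)
        show "(\<lambda>t. f (\<psi> (b + t *s a))) holomorphic_on T"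
          by (rule holomorphic_on_disc_in_chart[OF F_poly[OF f], of W])
            (use der in \<open>auto simp: W_def T_def\<close>)
        show "f (\<psi> (b + t *s a)) = 0" if "t \<in> T0" for t
        proof -
          have "\<psi> (b + t *s a) \<in> X" using piece[OF onLS] that by (simp add: T0_def)
          then show ?thesis using f by (simp add: X_eq)
        qed
        show "1 \<in> T" using l(2) by (simp add: T_def a_def)
      qed auto
      then show ?thesis by (simp add: a_def)
    qed
    then show ?thesis by (simp add: X_eq)
  qed
  have "Phi ` (X \<inter> U) = Phi ` U \<inter> LS"
  proof
    have "Phi z \<in> LS" if "z \<in> X" "z \<in> U" for z using Phi_pr[OF that(1) DU[OF that(2)]] pr_in_LS by simp
    then show "Phi ` (X \<inter> U) \<subseteq> Phi ` U \<inter> LS" by auto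
    show "Phi ` U \<inter> LS \<subseteq> Phi ` (X \<inter> U)"
    proof
      fix l assume "l \<in> Phi ` U \<inter> LS"
      then have l: "l \<in> W" "l \<in> LS" using PhiU by auto
      then have "\<psi> l \<in> X \<inter> U" using all \<psi>W by auto
      then show "l \<in> Phi ` (X \<inter> U)" using Phi\<psi>[OF l(1)] by (intro image_eqI[of l Phi "\<psi> l"]) auto
    qed
  qed
  moreover have "holomorphic_map_on Phi U"
    unfolding holomorphic_map_on_def using U(1) Phi_holomorphic by blast
  moreover have "holomorphic_map_on \<psi> (Phi ` U)"
    unfolding holomorphic_map_on_def PhiU using der by (simp add: W_def)
  ultimately show ?thesis
    unfolding submanifold_chart_def biholomorphic_on_def using U(2) \<psi>Phi LS_vec_subspace by blast
qed

text \<open>Pure dimension provides a point of \<open>X\<close> in \<open>N\<close> with a chart of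
  dimension \<open>k\<close>. In this chart \<open>pr\<close> is a continuous injection of an open
  part of \<open>L\<close> into \<open>LS\<close>, whose dimension is not larger, so invariance of
  domain makes the image open.\<close>

lemma open_piece:
  assumes dim: "vec.dim LS \<le> k" and q: "q \<in> X" "q \<in> N" and N: "open N" and inj: "inj_on pr (X \<inter> N)"
  shows "\<exists>b \<epsilon>. b \<in> LS \<and> \<epsilon> > 0 \<and> (\<forall>l. l \<in> LS \<longrightarrow> l \<in> ball b \<epsilon> \<longrightarrow> l \<in> pr ` (X \<inter> N))"
proof -
  obtain r where r: "r > 0" "ball q r \<subseteq> N" using N q(2) by (meson openE)
  have "has_local_dim X q k" using pure q(1) by (simp add: pure_dimensional_def)
  then obtain z where z: "z \<in> ball q r" "regular_point_of_dim X k z"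
    unfolding has_local_dim_def using r(1) by blast
  obtain U \<phi> L where c: "submanifold_chart X z U \<phi> L" "vec.dim L = k" and zX: "z \<in> X"
    using z(2) unfolding regular_point_of_dim_def by blast
  obtain \<psi> where U: "open U" "z \<in> U" "open (\<phi> ` U)" "\<forall>z\<in>U. \<psi> (\<phi> z) = z" "continuous_on (\<phi> ` U) \<psi>"
    using submanifold_chart_inverse[OF c(1)] by blast
  have L: "vec.subspace L" "\<phi> ` (X \<inter> U) = \<phi> ` U \<inter> L" using c(1) by (auto simp: submanifold_chart_def)
  define T where "T = L \<inter> (\<phi> ` U \<inter> \<psi> -` N)"
  have "open (\<phi> ` U \<inter> \<psi> -` N)" using U(5,3) N by (rule continuous_open_preimage)
  then have opT: "openin (top_of_set L) T" unfolding T_def by blast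
  have TX: "\<exists>x\<in>X \<inter> U \<inter> N. y = \<phi> x \<and> \<psi> y = x" if y: "y \<in> T" for y
  proof -
    have "y \<in> \<phi> ` (X \<inter> U)" using y L(2) by (auto simp: T_def)
    then obtain x where "x \<in> X" "x \<in> U" "y = \<phi> x" by blast
    then show ?thesis using y U(4) by (auto simp: T_def)
  qed
  have inj': "inj_on (\<lambda>y. pr (\<psi> y)) T"
  proof (rule inj_onI)
    fix y y' assume y: "y \<in> T" "y' \<in> T" and eq: "pr (\<psi> y) = pr (\<psi> y')"
    obtain x where x: "x \<in> X \<inter> U \<inter> N" "y = \<phi> x" "\<psi> y = x" using TX[OF y(1)] by blast
    obtain x' where x': "x' \<in> X \<inter> U \<inter> N" "y' = \<phi> x'" "\<psi> y' = x'" using TX[OF y(2)] by blast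
    have "x = x'" using inj_onD[OF inj, of x x'] eq x x' by auto
    then show "y = y'" using x x' by simp
  qed
  have "openin (top_of_set LS) ((\<lambda>y. pr (\<psi> y)) ` T)"
  proof (rule invariance_of_domain_subspaces[OF opT])
    show "subspace L" using c(1) by (rule submanifold_chart_real_subspace)
    show "dim LS \<le> dim L"
      using L(1) LS_vec_subspace dim c(2) by (intro dim_mono_vec_dim) auto
    have "continuous_on T \<psi>" by (rule continuous_on_subset[OF U(5)]) (auto simp: T_def)
    then show "continuous_on T (\<lambda>y. pr (\<psi> y))"
      by (rule continuous_on_compose2[OF continuous_pr[of UNIV]]) auto
    show "(\<lambda>y. pr (\<psi> y)) \<in> T \<rightarrow> LS" using pr_in_LS by auto
  qed (use inj' LS_subspace in auto)
  then have ball: "\<forall>x\<in>(\<lambda>y. pr (\<psi> y)) ` T. \<exists>\<epsilon>>0. ball x \<epsilon> \<inter> LS \<subseteq> (\<lambda>y. pr (\<psi> y)) ` T"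
    unfolding openin_contains_ball by (rule conjunct2)
  have "pr z \<in> (\<lambda>y. pr (\<psi> y)) ` T"
  proof (rule image_eqI)
    have "\<phi> z \<in> \<phi> ` (X \<inter> U)" using zX U(2) by blast
    then have "\<phi> z \<in> \<phi> ` U" "\<phi> z \<in> L" unfolding L(2) by blast+
    moreover have "z \<in> N" using z(1) r(2) by blast
    ultimately show "\<phi> z \<in> T" using U(2,4) unfolding T_def by simp
    show "pr z = pr (\<psi> (\<phi> z))" using U(2,4) by simp
  qed
  from bspec[OF ball this] obtain \<epsilon> where \<epsilon>: "\<epsilon> > 0" "ball (pr z) \<epsilon> \<inter> LS \<subseteq> (\<lambda>y. pr (\<psi> y)) ` T"
    by (elim exE conjE)
  have sub: "(\<lambda>y. pr (\<psi> y)) ` T \<subseteq> pr ` (X \<inter> N)"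
  proof
    fix l assume "l \<in> (\<lambda>y. pr (\<psi> y)) ` T"
    then obtain y where y: "y \<in> T" "l = pr (\<psi> y)" by (elim imageE) auto
    obtain x where "x \<in> X \<inter> U \<inter> N" "\<psi> y = x" using TX[OF y(1)] by blast
    then show "l \<in> pr ` (X \<inter> N)" using y(2) by (intro image_eqI[of _ _ x]) auto
  qed
  show ?thesis
  proof (intro exI conjI allI impI)
    show "pr z \<in> LS" by (rule pr_in_LS)
    show "\<epsilon> > 0" by (rule \<epsilon>(1))
    fix l assume "l \<in> LS" "l \<in> ball (pr z) \<epsilon>"
    then have "l \<in> ball (pr z) \<epsilon> \<inter> LS" by simp
    from subsetD[OF sub subsetD[OF \<epsilon>(2) this]] show "l \<in> pr ` (X \<inter> N)" .
  qed
qed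

section \<open>Dimension of the slice, regularity and density off the discriminant\<close>

lemma D_dense_LS:
  assumes w: "w \<in> LS" and \<epsilon>: "\<epsilon> > 0" shows "\<exists>y\<in>LS. dist y w < \<epsilon> \<and> D y \<noteq> 0"
proof -
  obtain y where y: "D y \<noteq> 0" using D_nonzero by blast
  define a where "a = pr y - w"
  have "D (pr y) \<noteq> 0" using y D_pr by simp
  then obtain s where s: "norm s < \<epsilon> / (norm a + 1)" "D (w + s *s a) \<noteq> 0"
    using is_poly_nonzero_near[OF D_poly, of "pr y" "\<epsilon> / (norm a + 1)" w] \<epsilon>
    unfolding a_def by (auto simp: add_nonneg_pos)
  have "w + s *s a \<in> LS"
    unfolding a_def using w pr_in_LS LS_vec_subspace
    by (intro vec.subspace_add vec.subspace_scale vec.subspace_diff) auto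
  moreover have "dist (w + s *s a) w < \<epsilon>"
  proof -
    have "dist (w + s *s a) w = norm s * norm a"
      by (simp add: dist_norm norm_vec_smult)
    also have "\<dots> \<le> norm s * (norm a + 1)" by (simp add: mult_left_mono)
    also have "\<dots> < \<epsilon>" using s(1) by (simp add: pos_less_divide_eq add_nonneg_pos)
    finally show ?thesis .
  qed
  ultimately show ?thesis using s(2) by blast
qed

text \<open>The fibres of \<open>pr\<close> over \<open>LS\<close> are nonempty, so by Baire's theorem one of countably many sheets
  contains an open piece of \<open>LS\<close>.\<close>

lemma dim_LS_le: "vec.dim LS \<le> k"
proof -
  define A where "A = {q \<in> X. D q \<noteq> 0}"
  have "\<forall>q\<in>A. \<exists>U \<rho> \<psi>. \<rho> > 0 \<and> open U \<and> q \<in> U \<and> homeomorphism U (ball (Phi q) \<rho>) Phi \<psi> \<and>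
    (\<forall>y\<in>ball (Phi q) \<rho>. \<exists>E. vec_linear E \<and> (\<psi> has_derivative E) (at y)) \<and>
    (\<forall>z\<in>U. D z \<noteq> 0)"
    using Phi_local_inverse by (simp add: A_def)
  from bchoice[OF this] obtain U where
    U: "\<forall>q\<in>A. \<exists>\<rho> \<psi>. \<rho> > 0 \<and> open (U q) \<and> q \<in> U q \<and> homeomorphism (U q) (ball (Phi q) \<rho>) Phi \<psi> \<and>
    (\<forall>y\<in>ball (Phi q) \<rho>. \<exists>E. vec_linear E \<and> (\<psi> has_derivative E) (at y)) \<and>
    (\<forall>z\<in>U q. D z \<noteq> 0)" by blast
  have "\<forall>q\<in>A. \<exists>r>0. cball q r \<subseteq> U q" using U by (meson open_contains_cball)
  from bchoice[OF this] obtain r where r: "\<forall>q\<in>A. r q > 0 \<and> cball q (r q) \<subseteq> U q" by blast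
  obtain \<F> where \<F>: "\<F> \<subseteq> (\<lambda>q. ball q (r q)) ` A" "countable \<F>" "\<Union>\<F> = (\<Union>q\<in>A. ball q (r q))"
    by (rule Lindelof[of "(\<lambda>q. ball q (r q)) ` A"]) auto
  obtain Q where Q: "Q \<subseteq> A" "countable Q" "\<F> = (\<lambda>q. ball q (r q)) ` Q"
    using countable_subset_image[of \<F> "\<lambda>q. ball q (r q)" A] \<F>(1,2) by blast
  define B where "B q = pr ` (X \<inter> cball q (r q))" for q
  have clB: "closed (B q)" for q
  proof -
    have "compact (X \<inter> cball q (r q))" using X_closed by (intro closed_Int_compact) auto
    then show ?thesis unfolding B_def
      by (intro compact_imp_closed compact_continuous_image continuous_pr)
  qed
  \<comment> \<open>If no sheet \<open>B q\<close> contained an open piece of \<open>LS\<close>,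
    these relatively open sets would all be dense, while their intersection is empty because
    \<open>X\<close> projects onto the slice.\<close>
  define \<G> where "\<G> = insert {y \<in> LS. D y \<noteq> 0} ((\<lambda>q. LS - B q) ` Q)"
  have empty: "\<Inter>\<G> = {}"
  proof (rule ccontr)
    assume "\<Inter>\<G> \<noteq> {}"
    then obtain y where y: "y \<in> LS" "D y \<noteq> 0" "\<And>q. q \<in> Q \<Longrightarrow> y \<notin> B q" unfolding \<G>_def by blast
    obtain z where z: "z \<in> X" "\<forall>i\<in>S. z $ i = y $ i" using onto by blast
    have pz: "pr z = y" using z(2) pr_eq pr_LS[OF y(1)] by metis
    then have "D z \<noteq> 0" using D_pr[of z] y(2) by simp
    then have "z \<in> A" using z(1) by (simp add: A_def)
    then have "z \<in> (\<Union>q\<in>A. ball q (r q))" using r by force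
    then have "z \<in> \<Union>\<F>" using \<F>(3) by simp
    then obtain q where q: "q \<in> Q" "z \<in> ball q (r q)" using Q(3) by blast
    then have "z \<in> cball q (r q)" by auto
    then have "y \<in> B q" using z(1) pz unfolding B_def by blast
    then show False using y(3) q(1) by blast
  qed
  have "\<exists>q\<in>Q. \<not> LS \<subseteq> closure (LS - B q)"
  proof (rule ccontr)
    assume no: "\<not> ?thesis"
    have "LS \<subseteq> closure (\<Inter>\<G>)"
    proof (rule Baire)
      show "closed LS" using LS_subspace by (rule closed_subspace)
      show "countable \<G>" using Q(2) by (simp add: \<G>_def)
      fix T assume "T \<in> \<G>"
      then consider "T = {y \<in> LS. D y \<noteq> 0}" | q where "q \<in> Q" "T = LS - B q" unfolding \<G>_def by blast
      then show "openin (top_of_set LS) T \<and> LS \<subseteq> closure T"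
      proof cases
        case 1
        have "T = LS \<inter> {y. D y \<noteq> 0}" using 1 by blast
        then have "openin (top_of_set LS) T" using D_open by blast
        moreover have "LS \<subseteq> closure T"
          unfolding 1 closure_approachable subset_iff using D_dense_LS by blast
        ultimately show ?thesis ..
      next
        case 2
        have "openin (top_of_set LS) (LS - B q)"
          unfolding Diff_eq using clB[of q] by (intro openin_open_Int open_Compl)
        then show ?thesis using 2 no by blast
      qed
    qed
    then have "LS = {}" unfolding empty by simp
    then show False using pr_in_LS by blast
  qed
  then obtain q b where q: "q \<in> Q" and b: "b \<in> LS" "b \<notin> closure (LS - B q)" by blast
  then obtain \<epsilon> where \<epsilon>: "\<epsilon> > 0" "\<And>l. l \<in> LS - B q \<Longrightarrow> \<not> dist l b < \<epsilon>"
    unfolding closure_approachable by blast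
  have qA: "q \<in> A" using q Q(1) by blast
  obtain \<rho> \<psi> where Uq: "open (U q)" "q \<in> U q" "homeomorphism (U q) (ball (Phi q) \<rho>) Phi \<psi>"
    "\<forall>y\<in>ball (Phi q) \<rho>. \<exists>E. vec_linear E \<and> (\<psi> has_derivative E) (at y)"
    "\<forall>z\<in>U q. D z \<noteq> 0" using U qA by blast
  have "submanifold_chart X q (U q) Phi LS"
  proof (rule chart_of_open_piece[OF _ Uq(1-3) _ _ b(1) \<epsilon>(1)])
    show "q \<in> X" using qA by (simp add: A_def)
    show "l \<in> pr ` (X \<inter> U q)" if "l \<in> LS" "l \<in> ball b \<epsilon>" for l
    proof -
      have "l \<in> B q" using \<epsilon>(2)[of l] that by (auto simp: dist_commute)
      then show ?thesis using r qA unfolding B_def by blast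
    qed
  qed (use Uq(4,5) in blast)+
  \<comment> \<open>\<open>LS\<close> is now the model space of a chart at \<open>q\<close>, so its
    dimension occurs at a regular point and is bounded by the local dimension
    \<open>k\<close>.\<close>
  then have "regular_point_of_dim X (vec.dim LS) q"
    unfolding regular_point_of_dim_def using qA A_def by blast
  moreover have "has_local_dim X q k" using pure qA by (simp add: pure_dimensional_def A_def)
  ultimately show ?thesis unfolding has_local_dim_def by (meson centre_in_ball)
qed

text \<open>On \<open>X \<inter> U\<close> the map \<open>Phi\<close> agrees with \<open>pr\<close>,
  which is therefore injective there. As \<open>vec.dim LS \<le> k\<close> is now known, invariance
  of domain finds an open piece near each such point, where Baire's theorem found it only near
  some.\<close>

lemma regular_chart:
  assumes q: "q \<in> X" "D q \<noteq> 0" shows "\<exists>U. submanifold_chart X q U Phi LS"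
proof -
  obtain U \<rho> \<psi> where U: "open U" "q \<in> U" "homeomorphism U (ball (Phi q) \<rho>) Phi \<psi>"
    "\<forall>y\<in>ball (Phi q) \<rho>. \<exists>E. vec_linear E \<and> (\<psi> has_derivative E) (at y)"
    "\<forall>z\<in>U. D z \<noteq> 0"
    using Phi_local_inverse[OF q] by blast
  have "inj_on pr (X \<inter> U)"
  proof (rule inj_onI)
    fix x y
    assume xy: "x \<in> X \<inter> U" "y \<in> X \<inter> U" "pr x = pr y"
    then have "D x \<noteq> 0" "D y \<noteq> 0" using U(5) by auto
    then have *: "Phi x = Phi y" using Phi_pr[of x] Phi_pr[of y] xy by simp
    have "x = \<psi> (Phi x)" using homeomorphism_apply1[OF U(3)] xy(1) by auto
    also have "\<dots> = y" unfolding * using homeomorphism_apply1[OF U(3)] xy(2) by auto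
    finally show "x = y" .
  qed
  from open_piece[OF dim_LS_le q(1) U(2,1) this] obtain b \<epsilon> where
    b: "b \<in> LS" "\<epsilon> > 0" "\<forall>l. l \<in> LS \<longrightarrow> l \<in> ball b \<epsilon> \<longrightarrow> l \<in> pr ` (X \<inter> U)"
    by (elim exE conjE)
  have "submanifold_chart X q U Phi LS"
    by (rule chart_of_open_piece[OF q(1) U(1-3) _ _ b(1,2)]) (use U(4,5) b(3) in blast)+
  then show ?thesis by blast
qed

text \<open>At a point of \<open>X\<close> where the multiplicities of the coordinates as roots of their monic
  equations are minimal, the multiplicities are locally constant, and then \<open>pr\<close> is injective.\<close>

lemma dense_D:
  assumes p: "p \<in> X" and \<epsilon>: "\<epsilon> > 0"
  shows "\<exists>q\<in>X. dist q p < \<epsilon> \<and> D q \<noteq> 0"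
proof -
  have "\<forall>i\<in>-S. \<exists>H. (\<exists>d. monic_family S d H) \<and> (\<forall>z\<in>X. poly (H z) (z $ i) = 0)"
    using integral unfolding integral_over_def by blast
  from bchoice[OF this] obtain H where
    H: "\<forall>i\<in>-S. (\<exists>d. monic_family S d (H i)) \<and> (\<forall>z\<in>X. poly (H i z) (z $ i) = 0)" by blast
  have H0: "H i z \<noteq> 0" if "i \<notin> S" for i z using H that monic_familyD(3) by blast
  have Hcong: "H i z = H i z'" if "i \<notin> S" "pr z = pr z'" for i z z'
    using H that monic_family_cong[of S _ "H i" z z'] unfolding pr_eq by blast
  define m where "m i z = order (z $ i) (H i z)" for i z
  define M where "M z = (\<Sum>i\<in>-S. m i z)" for z
  have "\<exists>z. z \<in> X \<inter> ball p \<epsilon> \<and> (\<forall>y. y \<in> X \<inter> ball p \<epsilon> \<longrightarrow> M z \<le> M y)"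
    by (rule ex_has_least_nat[of _ p]) (use p \<epsilon> in simp)
  then obtain z1 where z1: "z1 \<in> X" "z1 \<in> ball p \<epsilon>" "\<And>y. y \<in> X \<Longrightarrow> y \<in> ball p \<epsilon> \<Longrightarrow> M z1 \<le> M y"
    by blast
  \<comment> \<open>At \<open>z1\<close> this is the first derivative that does not vanish. By
    continuity the multiplicities near \<open>z1\<close> cannot exceed those at \<open>z1\<close>,
    and the minimality of their sum \<open>M z1\<close> prevents them from dropping.\<close>
  define f where "f i z = poly ((pderiv ^^ m i z1) (H i z)) (z $ i)" for i z
  have f_poly: "is_poly (insert i S) (f i)" if i: "i \<notin> S" for i
  proof -
    obtain d where "monic_family S d (H i)" using H i by blast
    then have "poly_family S d (\<lambda>z. (pderiv ^^ m i z1) (H i z))"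
      by (intro poly_family_higher_pderiv monic_family_imp_poly_family)
    then show ?thesis unfolding f_def by (rule is_poly_eval_family)
  qed
  have fz1: "f i z1 \<noteq> 0" if "i \<notin> S" for i
    unfolding f_def m_def using higher_pderiv_order(1)[OF H0[OF that]] by simp
  have "\<forall>\<^sub>F z in nhds z1. \<forall>i\<in>-S. dist (f i z) (f i z1) < norm (f i z1) / 2"
  proof (rule eventually_ball_finite, simp, intro ballI)
    fix i assume "i \<in> -S"
    then have i: "i \<notin> S" by simp
    have "(f i \<longlongrightarrow> f i z1) (at z1)"
      using is_poly_continuous[OF f_poly[OF i], of UNIV] by (simp add: continuous_on_def)
    then have "(f i \<longlongrightarrow> f i z1) (nhds z1)" by (simp add: tendsto_at_iff_tendsto_nhds)
    then show "\<forall>\<^sub>F z in nhds z1. dist (f i z) (f i z1) < norm (f i z1) / 2"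
      using fz1[OF i] by (intro tendstoD) auto
  qed
  then obtain \<delta>1 where \<delta>1: "\<delta>1 > 0"
    "\<And>z. dist z z1 < \<delta>1 \<Longrightarrow> \<forall>i\<in>-S. dist (f i z) (f i z1) < norm (f i z1) / 2"
    unfolding eventually_nhds_metric by blast
  obtain \<delta>2 where \<delta>2: "\<delta>2 > 0" "ball z1 \<delta>2 \<subseteq> ball p \<epsilon>" using z1(2) by (meson open_ball openE)
  define \<delta> where "\<delta> = min \<delta>1 \<delta>2"
  have \<delta>: "\<delta> > 0" using \<delta>1 \<delta>2 by (simp add: \<delta>_def)
  have near: "norm (f i z - f i z1) \<le> norm (f i z1) / 2" if "norm (z - z1) < \<delta>" "i \<notin> S" for i z
    using \<delta>1(2)[of z] that by (force simp: \<delta>_def dist_norm)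
  define N where "N = ball z1 (\<delta> / 4)"
  have N: "norm (z - z1) < \<delta> / 4" if "z \<in> N" for z
    using that by (simp add: N_def dist_norm norm_minus_commute)
  have ballp: "z \<in> ball p \<epsilon>" if "z \<in> N" for z
  proof -
    have "z \<in> ball z1 \<delta>2" using N[OF that] \<delta> by (simp add: \<delta>_def dist_norm norm_minus_commute)
    then show ?thesis using \<delta>2(2) by blast
  qed
  have const: "m i z = m i z1" if z: "z \<in> X" "z \<in> N" and i: "i \<notin> S" for i z
  proof -
    have le: "m j z \<le> m j z1" if j: "j \<in> -S" for j
    proof (rule ccontr)
      assume "\<not> m j z \<le> m j z1"
      then have "m j z1 < order (z $ j) (H j z)" by (simp add: m_def)
      then have "f j z = 0" unfolding f_def using higher_pderiv_order(2)[OF H0] j by simp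
      then show False using near[of z j] N[OF z(2)] \<delta> fz1[of j] j by auto
    qed
    show ?thesis
    proof (rule ccontr)
      assume "m i z \<noteq> m i z1"
      then have "m i z < m i z1" using le[of i] i by simp
      then have "M z < M z1" unfolding M_def using le i by (intro sum_strict_mono_ex1) auto
      then show False using z1(3)[OF z(1) ballp[OF z(2)]] by simp
    qed
  qed
  have inj: "inj_on pr (X \<inter> N)"
  proof (rule inj_onI)
    fix z z' assume z: "z \<in> X \<inter> N" and z': "z' \<in> X \<inter> N" and eq: "pr z = pr z'"
    have "z $ i = z' $ i" for i
    proof (cases "i \<in> S")
      case True
      then show ?thesis using eq by (simp add: pr_eq)
    next
      case i: False
      \<comment> \<open>One derivative fewer: the coordinates of both points are roots of
        \<open>P\<close>, because they have the full multiplicity \<open>Suc n\<close>, while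
        \<open>pderiv P\<close> stays so close to the nonzero constant \<open>c\<close> that
        \<open>P\<close> is injective on \<open>T\<close>.\<close>
      define n where "n = m i z1 - 1"
      have "poly (H i z1) (z1 $ i) = 0" using H i z1(1) by blast
      then have n: "m i z1 = Suc n" unfolding n_def m_def using H0[OF i, of z1] by (simp add: order_root)
      define P where "P = (pderiv ^^ n) (H i z)"
      have roots: "poly P (z $ i) = 0" "poly P (z' $ i) = 0"
        using higher_pderiv_order(2)[OF H0[OF i], of n "z $ i" z] const[of z i]
          higher_pderiv_order(2)[OF H0[OF i], of n "z' $ i" z'] const[of z' i] z z' i n
        unfolding P_def m_def Hcong[OF i eq] by auto
      define c where "c = f i z1"
      define T where "T = {t. upd z i t \<in> ball z1 \<delta>}"
      have der: "norm (poly (pderiv P) t - c) \<le> norm c / 2" if t: "t \<in> T" for t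
      proof -
        have "H i (upd z i t) = H i z" using i by (intro Hcong) (auto simp: pr_eq)
        then have "f i (upd z i t) = poly (pderiv P) t" by (simp add: f_def P_def n)
        moreover have "norm (upd z i t - z1) < \<delta>"
          using t by (simp add: T_def dist_norm norm_minus_commute)
        ultimately show ?thesis using near[of "upd z i t" i] i by (simp add: c_def)
      qed
      have conv: "convex T"
      proof (rule convexI)
        fix x y and u v :: real assume xy: "x \<in> T" "y \<in> T" "0 \<le> u" "0 \<le> v" "u + v = 1"
        have "u *\<^sub>R a + v *\<^sub>R a = a" for a :: complex
          using xy(5) by (simp flip: scaleR_add_left)
        have "u *\<^sub>R upd z i x + v *\<^sub>R upd z i y \<in> ball z1 \<delta>"
          using xy unfolding T_def by (intro convexD[OF convex_ball]) auto
        moreover have "u *\<^sub>R upd z i x + v *\<^sub>R upd z i y = upd z i (u *\<^sub>R x + v *\<^sub>R y)"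
          by (simp add: vec_eq_iff \<open>\<And>a. u *\<^sub>R a + v *\<^sub>R a = a\<close>)
        ultimately show "u *\<^sub>R x + v *\<^sub>R y \<in> T" by (simp add: T_def)
      qed
      have "upd z i (z $ i) = z" by (simp add: vec_eq_iff)
      then have zT: "z $ i \<in> T" using N[of z] z \<delta> by (simp add: T_def dist_norm norm_minus_commute)
      have zT': "z' $ i \<in> T"
      proof -
        have "norm (z' $ i - z $ i) \<le> norm (z' - z)" using Finite_Cartesian_Product.norm_nth_le[of "z' - z" i] by simp
        also have "\<dots> \<le> norm (z' - z1) + norm (z - z1)"
          using norm_triangle_ineq4[of "z' - z1" "z - z1"] by simp
        finally have "norm (upd z i (z' $ i) - z) < \<delta> / 2" using N[of z] N[of z'] z z' norm_upd[of z i "z' $ i"] by simp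
        moreover have "norm (upd z i (z' $ i) - z1) \<le> norm (upd z i (z' $ i) - z) + norm (z - z1)"
          using norm_triangle_ineq[of "upd z i (z' $ i) - z" "z - z1"] by simp
        ultimately have "norm (upd z i (z' $ i) - z1) < \<delta>" using N[of z] z \<delta> by auto
        then show ?thesis by (simp add: T_def dist_norm norm_minus_commute)
      qed
      have "norm ((poly P (z $ i) - c * z $ i) - (poly P (z' $ i) - c * z' $ i)) \<le> norm c / 2 * norm (z $ i - z' $ i)"
        by (rule field_differentiable_bound[OF conv _ der zT zT'])
          (auto intro!: derivative_eq_intros poly_DERIV)
      then have "norm (c * (z' $ i - z $ i)) \<le> norm c / 2 * norm (z $ i - z' $ i)"
        using roots by (simp add: right_diff_distrib)
      then have "norm c * norm (z $ i - z' $ i) \<le> norm c * (norm (z $ i - z' $ i) / 2)"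
        by (simp add: norm_mult norm_minus_commute)
      moreover have "norm c > 0" using fz1[OF i] by (simp add: c_def)
      ultimately have "norm (z $ i - z' $ i) \<le> norm (z $ i - z' $ i) / 2"
        by (rule mult_left_le_imp_le)
      then show ?thesis by simp
    qed
    then show "z = z'" by (simp add: vec_eq_iff)
  qed
  have "z1 \<in> N" "open N" using \<delta> by (auto simp: N_def)
  from open_piece[OF dim_LS_le z1(1) this inj] obtain b \<epsilon>' where
    b: "b \<in> LS" "\<epsilon>' > 0" "\<forall>l. l \<in> LS \<longrightarrow> l \<in> ball b \<epsilon>' \<longrightarrow> l \<in> pr ` (X \<inter> N)"
    by (elim exE conjE)
  obtain y where y: "y \<in> LS" "dist y b < \<epsilon>'" "D y \<noteq> 0" using D_dense_LS[OF b(1,2)] by blast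
  then have "y \<in> pr ` (X \<inter> N)" using b(3) by (simp add: dist_commute)
  then obtain q where q: "q \<in> X" "q \<in> N" "y = pr q" by blast
  then have "D q \<noteq> 0" using y(3) D_pr by simp
  moreover have "q \<in> ball p \<epsilon>" using q(2) by (rule ballp)
  ultimately show ?thesis using q(1) by (auto simp: dist_commute)
qed

section \<open>Tangent discs, asymptotic directions and the weighted maximum\<close>

lemma not_Sing: "q \<in> X \<Longrightarrow> D q \<noteq> 0 \<Longrightarrow> q \<notin> Sing X"
  using regular_chart unfolding Sing_def regular_point_of_dim_def by blast

text \<open>The disc is the image of a complex line in the slice under the inverse chart, hence it
  moves over the direction \<open>pr v\<close>. Its velocity \<open>w\<close> at \<open>0\<close> is
  tangent to \<open>X\<close> and can differ from \<open>v\<close> only in coordinates outside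
  \<open>S\<close>.\<close>

lemma tangent_disc:
  assumes q: "q \<in> X" "D q \<noteq> 0"
  shows "\<exists>r>0. \<exists>g w. g 0 = q \<and> (\<forall>c\<in>ball 0 r. g c \<in> X \<and> pr (g c) = pr q + c *s pr v) \<and>
    (\<forall>f. is_poly UNIV f \<longrightarrow> (\<lambda>c. f (g c)) holomorphic_on ball 0 r) \<and>
    w \<in> tangent_space X q \<and> pr w = pr v \<and> (g has_derivative (\<lambda>c. c *s w)) (at 0)"
proof -
  obtain U where c: "submanifold_chart X q U Phi LS" using regular_chart[OF q] by blast
  obtain \<psi> where U: "open U" "q \<in> U" "open (Phi ` U)" "\<forall>z\<in>U. \<psi> (Phi z) = z"
    "\<forall>y\<in>Phi ` U. \<exists>E. vec_linear E \<and> (\<psi> has_derivative E) (at y)"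
    using submanifold_chart_inverse[OF c] by blast
  have im: "Phi ` (X \<inter> U) = Phi ` U \<inter> LS" using c by (simp add: submanifold_chart_def)
  define g where "g c = \<psi> (Phi q + c *s pr v)" for c
  have "open ((\<lambda>c. Phi q + c *s pr v) -` (Phi ` U))"
    using has_derivative_continuous[OF has_derivative_line]
    by (intro open_vimage U(3) continuous_at_imp_continuous_on ballI)
  moreover have "0 \<in> (\<lambda>c. Phi q + c *s pr v) -` (Phi ` U)" using U(2) by simp
  ultimately obtain r where r: "r > 0" "ball 0 r \<subseteq> (\<lambda>c. Phi q + c *s pr v) -` (Phi ` U)"
    by (meson openE)
  have inV: "Phi q + c *s pr v \<in> Phi ` U" if "c \<in> ball 0 r" for c using r(2) that by blast
  have "Phi q \<in> LS" using Phi_pr[OF q] pr_in_LS by simp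
  then have onLS: "Phi q + c *s pr v \<in> LS" for c
    using pr_in_LS LS_vec_subspace by (intro vec.subspace_add vec.subspace_scale) auto
  have gX: "g c \<in> X \<and> pr (g c) = pr q + c *s pr v" if c: "c \<in> ball 0 r" for c
  proof -
    have "Phi q + c *s pr v \<in> Phi ` (X \<inter> U)" unfolding im using inV[OF c] onLS by blast
    then obtain x where x: "x \<in> X" "x \<in> U" "Phi q + c *s pr v = Phi x" by blast
    then have gx: "g c = x" using U(4) by (simp add: g_def)
    have "x $ i = q $ i + c * pr v $ i" if "i \<in> S" for i
      using arg_cong[OF x(3), of "\<lambda>z. z $ i"] Phi_coord[OF that] by simp
    then have "pr x = pr q + c *s pr v" by (simp add: pr_def vec_eq_iff)
    then show ?thesis using gx x(1) by simp
  qed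
  obtain E where E: "vec_linear E" "(\<psi> has_derivative E) (at (Phi q))"
    using U(5,2) by blast
  define w where "w = E (pr v)"
  have g0: "g 0 = q" using U(2,4) by (simp add: g_def)
  have "(\<psi> has_derivative E) (at (Phi q + 0 *s pr v))" using E(2) by simp
  from has_derivative_compose[OF has_derivative_line this]
  have derg: "(g has_derivative (\<lambda>c. c *s w)) (at 0)"
    using vec_linearD(2)[OF E(1)] by (simp add: g_def[abs_def] w_def)
  have "w \<in> tangent_space X q"
  proof -
    have "(Phi has_derivative frechet_derivative Phi (at q)) (at (\<psi> (Phi q)))"
      using submanifold_chart_derivative[OF c] U(2,4) by simp
    from has_derivative_compose[OF E(2) this]
    have "((\<lambda>y. Phi (\<psi> y)) has_derivative (\<lambda>h. frechet_derivative Phi (at q) (E h))) (at (Phi q))" .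
    then have "((\<lambda>y. y) has_derivative (\<lambda>h. frechet_derivative Phi (at q) (E h))) (at (Phi q))"
      by (rule has_derivative_transform_within_open[OF _ U(3)]) (use U(2,4) in auto)
    then have "(\<lambda>h. frechet_derivative Phi (at q) (E h)) = (\<lambda>h. h)"
      using has_derivative_unique has_derivative_ident by blast
    from fun_cong[OF this, of "pr v"] have "frechet_derivative Phi (at q) w \<in> LS"
      using pr_in_LS by (simp add: w_def)
    then show ?thesis unfolding tangent_space_def using c by blast
  qed
  moreover have "pr w = pr v"
  proof -
    have "w $ i = v $ i" if i: "i \<in> S" for i
    proof -
      have "((\<lambda>c. g c $ i) has_derivative (\<lambda>c. (c *s w) $ i)) (at 0)"
        using has_derivative_compose[OF derg bounded_linear_imp_has_derivative[OF bounded_linear_vec_nth]] .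
      moreover have "((\<lambda>c. g c $ i) has_derivative (\<lambda>c. c * v $ i)) (at 0)"
      proof (rule has_derivative_transform_within_open[of "\<lambda>c. q $ i + c * v $ i" _ _ _ "ball 0 r"])
        show "((\<lambda>c. q $ i + c * v $ i) has_derivative (\<lambda>c. c * v $ i)) (at 0)"
          by (auto intro!: derivative_eq_intros)
        show "q $ i + c * v $ i = g c $ i" if "c \<in> ball 0 r" for c
          using gX[OF that] i by (simp add: pr_def vec_eq_iff) metis
      qed (use r in auto)
      ultimately have "(\<lambda>c. (c *s w) $ i) = (\<lambda>c. c * v $ i)" by (rule has_derivative_unique)
      from fun_cong[OF this, of 1] show ?thesis by simp
    qed
    then show ?thesis by (simp add: pr_eq)
  qed
  moreover have "(\<lambda>c. f (g c)) holomorphic_on ball 0 r" if "is_poly UNIV f" for f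
    unfolding g_def by (rule holomorphic_on_disc_in_chart[OF that, of "Phi ` U"]) (use U(5) inV in blast)+
  ultimately show ?thesis using r(1) g0 gX derg by blast
qed

text \<open>By the asymptotic equations, \<open>v\<close> is an isolated direction at infinity of the part of \<open>X\<close>
  lying over lines parallel to \<open>pr v\<close>.\<close>

lemma isolated_direction:
  fixes x :: "nat \<Rightarrow> complex"
  assumes p: "\<And>j. p j \<in> X" and x0: "\<And>j. x j \<noteq> 0"
    and x: "filterlim (\<lambda>j. norm (x j)) at_top sequentially"
    and lim: "(\<lambda>j. inverse (x j) *s p j) \<longlonglongrightarrow> v"
  shows "\<exists>\<delta>>0. \<forall>\<delta>'>0. \<forall>\<^sub>F j in sequentially. \<forall>s z. z \<in> X \<longrightarrow>
    (\<forall>i\<in>S. z $ i = (p j - x j *s v) $ i + s * v $ i) \<longrightarrow> norm (s - x j) \<le> norm (x j) / 2 \<longrightarrow>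
    norm (z - s *s v) \<le> \<delta> * norm (x j) \<longrightarrow> norm (z - s *s v) \<le> \<delta>' * norm (x j)"
proof -
  have "\<forall>i\<in>-S. \<exists>q. (\<forall>z. q z \<noteq> 0) \<and> (\<forall>z z'. (\<forall>i\<in>S. z $ i = z' $ i) \<longrightarrow> q z = q z') \<and>
    (\<forall>z c t. c \<noteq> 0 \<longrightarrow> poly (q (c *s z)) (c * t) = 0 \<longrightarrow> poly (q z) t = 0) \<and>
    (\<forall>(x :: nat \<Rightarrow> complex) y y0. filterlim (\<lambda>j. norm (x j)) at_top sequentially \<longrightarrow> y \<longlonglongrightarrow> y0 \<longrightarrow>
      (\<forall>j. x j *s y j \<in> X) \<longrightarrow> poly (q y0) (y0 $ i) = 0)"
    using asymptotic_equation[OF integral] by simp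
  from bchoice[OF this] obtain q where
    q: "\<forall>i\<in>-S. (\<forall>z. q i z \<noteq> 0) \<and> (\<forall>z z'. (\<forall>i\<in>S. z $ i = z' $ i) \<longrightarrow> q i z = q i z') \<and>
    (\<forall>z c t. c \<noteq> 0 \<longrightarrow> poly (q i (c *s z)) (c * t) = 0 \<longrightarrow> poly (q i z) t = 0) \<and>
    (\<forall>(x :: nat \<Rightarrow> complex) y y0. filterlim (\<lambda>j. norm (x j)) at_top sequentially \<longrightarrow> y \<longlonglongrightarrow> y0 \<longrightarrow>
      (\<forall>j. x j *s y j \<in> X) \<longrightarrow> poly (q i y0) (y0 $ i) = 0)" by blast
  have q_nz: "q i z \<noteq> 0" if "i \<in> -S" for i z
    by (rule bspec[OF q that, THEN conjunct1, THEN spec])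
  have q_cong: "q i z = q i z'" if "i \<in> -S" "\<forall>k\<in>S. z $ k = z' $ k" for i z z'
    by (rule bspec[OF q that(1), THEN conjunct2, THEN conjunct1, THEN spec, THEN spec, THEN mp, OF that(2)])
  have q_hom: "poly (q i z) t = 0" if "i \<in> -S" "c \<noteq> 0" "poly (q i (c *s z)) (c * t) = 0" for i c z t
    by (rule bspec[OF q that(1), THEN conjunct2, THEN conjunct2, THEN conjunct1, THEN spec, THEN spec,
          THEN spec, THEN mp, THEN mp, OF that(2,3)])
  have q_lim: "poly (q i y0) (y0 $ i) = 0"
    if "i \<in> -S" "filterlim (\<lambda>j. norm (x j)) at_top sequentially" "y \<longlonglongrightarrow> y0" "\<forall>j. x j *s y j \<in> X"
    for i and x :: "nat \<Rightarrow> complex" and y y0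
    by (rule bspec[OF q that(1), THEN conjunct2, THEN conjunct2, THEN conjunct2, THEN spec, THEN spec,
          THEN spec, THEN mp, THEN mp, THEN mp, OF that(2-4)])
  have "\<forall>i\<in>-S. \<exists>\<gamma>>0. \<forall>t\<in>{t. poly (q i v) t = 0}. t \<noteq> v $ i \<longrightarrow> \<gamma> \<le> dist (v $ i) t"
    by (intro ballI finite_set_avoid poly_roots_finite q_nz)
  from bchoice[OF this] obtain \<gamma> where
    \<gamma>: "\<forall>i\<in>-S. \<gamma> i > 0 \<and> (\<forall>t\<in>{t. poly (q i v) t = 0}. t \<noteq> v $ i \<longrightarrow> \<gamma> i \<le> dist (v $ i) t)" by blast
  \<comment> \<open>\<open>\<gamma> i\<close> separates \<open>v $ i\<close> from the other roots of
    its asymptotic equation. The limit parameter \<open>\<sigma>0\<close> below has norm at least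
    \<open>1 / 2\<close>, so dividing by it at most doubles an error; the factor \<open>4\<close>
    leaves room for \<open>2 * \<delta> < \<gamma> i\<close>. The \<open>1\<close> covers the case
    that no coordinate lies outside \<open>S\<close>.\<close>
  define \<delta> where "\<delta> = Min (insert 1 (\<gamma> ` (-S))) / 4"
  have \<delta>: "\<delta> > 0" using \<gamma> by (simp add: \<delta>_def)
  have gap: "2 * \<delta> < \<gamma> i" if "i \<notin> S" for i
  proof -
    have "Min (insert 1 (\<gamma> ` (-S))) \<le> \<gamma> i" using that by (intro Min_le) auto
    moreover have "\<gamma> i > 0" using \<gamma> that by simp
    ultimately show ?thesis unfolding \<delta>_def by linarith
  qed
  have inv_lim: "(\<lambda>j. inverse (x j) *s (p j - x j *s v)) \<longlonglongrightarrow> 0"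
  proof -
    have "(\<lambda>j. inverse (x j) *s p j - v) \<longlonglongrightarrow> v - v" by (intro tendsto_intros lim)
    moreover have "inverse (x j) *s p j - v = inverse (x j) *s (p j - x j *s v)" for j
      using x0[of j] by (simp add: vector_ssub_ldistrib vector_smult_assoc)
    ultimately show ?thesis by simp
  qed
  define Q where "Q \<delta>' j \<longleftrightarrow> (\<forall>s z. z \<in> X \<longrightarrow>
    (\<forall>i\<in>S. z $ i = (p j - x j *s v) $ i + s * v $ i) \<longrightarrow> norm (s - x j) \<le> norm (x j) / 2 \<longrightarrow>
    norm (z - s *s v) \<le> \<delta> * norm (x j) \<longrightarrow> norm (z - s *s v) \<le> \<delta>' * norm (x j))" for \<delta>' j
  have main: "eventually (Q \<delta>') sequentially" if \<delta>': "\<delta>' > 0" for \<delta>'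
  proof (rule ccontr)
    assume "\<not> eventually (Q \<delta>') sequentially"
    from not_eventually_sequentiallyD[OF this]
    obtain r :: "nat \<Rightarrow> nat" where r0: "strict_mono r \<and> (\<forall>n. \<not> Q \<delta>' (r n))" by (rule exE)
    then have r: "strict_mono r" "\<And>n. \<not> Q \<delta>' (r n)" by simp_all
    have "\<forall>n. \<exists>sz. snd sz \<in> X \<and> (\<forall>i\<in>S. snd sz $ i = (p (r n) - x (r n) *s v) $ i + fst sz * v $ i) \<and>
      norm (fst sz - x (r n)) \<le> norm (x (r n)) / 2 \<and> norm (snd sz - fst sz *s v) \<le> \<delta> * norm (x (r n)) \<and>
      \<not> norm (snd sz - fst sz *s v) \<le> \<delta>' * norm (x (r n))"
    proof
      fix n
      from r(2)[of n] obtain s z where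
        "z \<in> X" "\<forall>i\<in>S. z $ i = (p (r n) - x (r n) *s v) $ i + s * v $ i"
        "norm (s - x (r n)) \<le> norm (x (r n)) / 2" "norm (z - s *s v) \<le> \<delta> * norm (x (r n))"
        "\<not> norm (z - s *s v) \<le> \<delta>' * norm (x (r n))" unfolding Q_def by blast
      then show "\<exists>sz. snd sz \<in> X \<and> (\<forall>i\<in>S. snd sz $ i = (p (r n) - x (r n) *s v) $ i + fst sz * v $ i) \<and>
        norm (fst sz - x (r n)) \<le> norm (x (r n)) / 2 \<and> norm (snd sz - fst sz *s v) \<le> \<delta> * norm (x (r n)) \<and>
        \<not> norm (snd sz - fst sz *s v) \<le> \<delta>' * norm (x (r n))"
        by (intro exI[of _ "(s, z)"]) (simp only: fst_conv snd_conv; blast)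
    qed
    from choice[OF this] obtain sz where
      sz: "\<And>n. snd (sz n) \<in> X" "\<And>n i. i \<in> S \<Longrightarrow> snd (sz n) $ i = (p (r n) - x (r n) *s v) $ i + fst (sz n) * v $ i"
      "\<And>n. norm (fst (sz n) - x (r n)) \<le> norm (x (r n)) / 2"
      "\<And>n. norm (snd (sz n) - fst (sz n) *s v) \<le> \<delta> * norm (x (r n))"
      "\<And>n. \<not> norm (snd (sz n) - fst (sz n) *s v) \<le> \<delta>' * norm (x (r n))"
      by blast
    \<comment> \<open>The counterexamples are rescaled by \<open>x (r n)\<close> to stay bounded. A
      subsequence converges, and the limit satisfies the asymptotic equations over
      \<open>\<sigma>0 *s v\<close> in the coordinates outside \<open>S\<close>.\<close>
    define \<sigma> where "\<sigma> n = inverse (x (r n)) * fst (sz n)" for n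
    define \<zeta> where "\<zeta> n = inverse (x (r n)) *s snd (sz n)" for n
    have scale: "norm (\<zeta> n - \<sigma> n *s v) = norm (snd (sz n) - fst (sz n) *s v) / norm (x (r n))" for n
    proof -
      have "\<zeta> n - \<sigma> n *s v = inverse (x (r n)) *s (snd (sz n) - fst (sz n) *s v)"
        by (simp add: \<zeta>_def \<sigma>_def vec_eq_iff right_diff_distrib)
      then have "norm (\<zeta> n - \<sigma> n *s v) = norm (inverse (x (r n)) *s (snd (sz n) - fst (sz n) *s v))" by (rule arg_cong)
      also have "\<dots> = norm (snd (sz n) - fst (sz n) *s v) / norm (x (r n))"
        unfolding norm_vec_smult norm_inverse by (simp add: divide_inverse)
      finally show ?thesis .
    qed
    have nx: "norm (x (r n)) > 0" for n using x0 by simp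
    have \<zeta>1: "norm (\<zeta> n - \<sigma> n *s v) \<le> \<delta>" "\<delta>' \<le> norm (\<zeta> n - \<sigma> n *s v)" for n
      using sz(4,5)[of n] nx[of n] unfolding scale by (simp_all add: pos_divide_le_eq pos_le_divide_eq)
    have \<sigma>1: "norm (\<sigma> n - 1) \<le> 1 / 2" for n
    proof -
      have "\<sigma> n - 1 = inverse (x (r n)) * (fst (sz n) - x (r n))"
        using x0[of "r n"] by (simp add: \<sigma>_def right_diff_distrib)
      then have "norm (\<sigma> n - 1) = norm (fst (sz n) - x (r n)) / norm (x (r n))"
        by (simp add: norm_mult norm_inverse divide_inverse)
      then show ?thesis using sz(3)[of n] nx[of n] by (simp add: pos_divide_le_eq)
    qed
    have \<sigma>_bound: "norm (\<sigma> n) \<le> 3 / 2" for n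
      using norm_triangle_ineq[of "\<sigma> n - 1" 1] \<sigma>1[of n] by simp
    have \<zeta>_bound: "norm (\<zeta> n) \<le> \<delta> + 3 / 2 * norm v" for n
    proof -
      have "norm (\<zeta> n) \<le> norm (\<zeta> n - \<sigma> n *s v) + norm (\<sigma> n *s v)"
        using norm_triangle_ineq[of "\<zeta> n - \<sigma> n *s v" "\<sigma> n *s v"] by simp
      also have "norm (\<sigma> n *s v) \<le> 3 / 2 * norm v"
        unfolding norm_vec_smult using \<sigma>_bound by (intro mult_right_mono) auto
      finally show ?thesis using \<zeta>1(1)[of n] by simp
    qed
    have "compact (cball (0::complex) (3 / 2) \<times> cball (0 :: complex ^ 'n) (\<delta> + 3 / 2 * norm v))"
      by (intro compact_Times compact_cball)
    then have "seq_compact (cball (0::complex) (3 / 2) \<times> cball (0 :: complex ^ 'n) (\<delta> + 3 / 2 * norm v))"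
      by (rule compact_imp_seq_compact)
    moreover have "\<forall>n. (\<sigma> n, \<zeta> n) \<in> cball 0 (3 / 2) \<times> cball 0 (\<delta> + 3 / 2 * norm v)"
      using \<sigma>_bound \<zeta>_bound by simp
    ultimately obtain l r' where l: "strict_mono r'" "((\<lambda>n. (\<sigma> n, \<zeta> n)) \<circ> r') \<longlonglongrightarrow> l"
      by (rule seq_compactE)
    define \<sigma>0 \<zeta>0 where "\<sigma>0 = fst l" and "\<zeta>0 = snd l"
    have l\<sigma>: "(\<lambda>n. \<sigma> (r' n)) \<longlonglongrightarrow> \<sigma>0" using tendsto_fst[OF l(2)] by (simp add: \<sigma>0_def comp_def)
    have l\<zeta>: "(\<lambda>n. \<zeta> (r' n)) \<longlonglongrightarrow> \<zeta>0" using tendsto_snd[OF l(2)] by (simp add: \<zeta>0_def comp_def)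
    have "(\<lambda>n. norm (\<sigma> (r' n) - 1)) \<longlonglongrightarrow> norm (\<sigma>0 - 1)" by (intro tendsto_intros l\<sigma>)
    then have "norm (\<sigma>0 - 1) \<le> 1 / 2"
      by (rule Lim_bounded[of _ _ 0]) (simp add: \<sigma>1 del: le_divide_eq_numeral1)
    then have \<sigma>0: "norm \<sigma>0 \<ge> 1 / 2" using norm_triangle_ineq2[of 1 "1 - \<sigma>0"] by (simp add: norm_minus_commute)
    then have \<sigma>00: "\<sigma>0 \<noteq> 0" by auto
    have ldiff: "(\<lambda>n. norm (\<zeta> (r' n) - \<sigma> (r' n) *s v)) \<longlonglongrightarrow> norm (\<zeta>0 - \<sigma>0 *s v)"
      by (intro tendsto_intros tendsto_vec_smult l\<zeta> l\<sigma>)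
    have d1: "norm (\<zeta>0 - \<sigma>0 *s v) \<le> \<delta>"
      by (rule Lim_bounded[OF ldiff, of 0]) (simp add: \<zeta>1)
    have d2: "\<delta>' \<le> norm (\<zeta>0 - \<sigma>0 *s v)"
      by (rule Lim_bounded2[OF ldiff, of 0]) (simp add: \<zeta>1)
    define R where "R n = r (r' n)" for n
    have R: "filterlim R at_top sequentially"
      using strict_mono_o[OF r(1) l(1)] by (intro filterlim_subseq) (simp add: R_def comp_def strict_mono_def)
    have inS: "\<zeta>0 $ i = \<sigma>0 * v $ i" if i: "i \<in> S" for i
    proof -
      have "(\<lambda>n. (inverse (x (R n)) *s (p (R n) - x (R n) *s v)) $ i + \<sigma> (r' n) * v $ i) \<longlonglongrightarrow> 0 $ i + \<sigma>0 * v $ i"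
        by (intro tendsto_add tendsto_mult tendsto_const l\<sigma> tendsto_vec_nth filterlim_compose[OF inv_lim R])
      moreover have "(inverse (x (R n)) *s (p (R n) - x (R n) *s v)) $ i + \<sigma> (r' n) * v $ i = \<zeta> (r' n) $ i" for n
        by (simp only: \<zeta>_def \<sigma>_def R_def vector_smult_component sz(2)[OF i] distrib_left mult.assoc)
      ultimately have "(\<lambda>n. \<zeta> (r' n) $ i) \<longlonglongrightarrow> \<sigma>0 * v $ i" by simp
      from LIMSEQ_unique[OF tendsto_vec_nth[OF l\<zeta>] this] show ?thesis .
    qed
    have "\<zeta>0 $ i = \<sigma>0 * v $ i" for i
    proof (cases "i \<in> S")
      case False
      then have iS: "i \<in> -S" by simp
      have xR: "filterlim (\<lambda>n. norm (x (R n))) at_top sequentially"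
        using filterlim_compose[OF x R] .
      have "\<forall>n. x (R n) *s \<zeta> (r' n) \<in> X"
      proof
        fix n
        have "x (R n) *s \<zeta> (r' n) = snd (sz (r' n))"
          using x0[of "r (r' n)"] by (simp add: \<zeta>_def R_def vec_eq_iff)
        then show "x (R n) *s \<zeta> (r' n) \<in> X" using sz(1) by simp
      qed
      from q_lim[OF iS xR l\<zeta> this] have "poly (q i \<zeta>0) (\<zeta>0 $ i) = 0" .
      moreover have "q i \<zeta>0 = q i (\<sigma>0 *s v)"
      proof -
        have "\<forall>i\<in>S. \<zeta>0 $ i = (\<sigma>0 *s v) $ i" using inS by simp
        with iS show ?thesis by (rule q_cong)
      qed
      \<comment> \<open>By homogeneity the parameter \<open>\<sigma>0\<close> can be divided out, so
        that the limit is compared with the roots over the fixed vector \<open>v\<close>.\<close>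
      ultimately have "poly (q i (\<sigma>0 *s v)) (\<sigma>0 * (\<zeta>0 $ i / \<sigma>0)) = 0" using \<sigma>00 by simp
      then have root: "poly (q i v) (\<zeta>0 $ i / \<sigma>0) = 0" by (rule q_hom[OF iS \<sigma>00])
      have "norm (\<zeta>0 $ i - \<sigma>0 * v $ i) \<le> \<delta>"
        using Finite_Cartesian_Product.norm_nth_le[of "\<zeta>0 - \<sigma>0 *s v" i] d1 by simp
      moreover have "dist (v $ i) (\<zeta>0 $ i / \<sigma>0) = norm (\<zeta>0 $ i - \<sigma>0 * v $ i) / norm \<sigma>0"
      proof -
        have "v $ i - \<zeta>0 $ i / \<sigma>0 = - ((\<zeta>0 $ i - \<sigma>0 * v $ i) / \<sigma>0)" using \<sigma>00 by (simp add: field_simps)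
        then show ?thesis by (simp add: dist_norm norm_divide)
      qed
      ultimately have "dist (v $ i) (\<zeta>0 $ i / \<sigma>0) \<le> \<delta> / (1 / 2)"
        using \<sigma>0 \<delta> by (simp only:) (intro frac_le; simp)
      then have "\<not> \<gamma> i \<le> dist (v $ i) (\<zeta>0 $ i / \<sigma>0)" using gap[OF False] by simp
      then have "\<zeta>0 $ i / \<sigma>0 = v $ i" using bspec[OF \<gamma> iS] root by blast
      then show ?thesis using \<sigma>00 by (simp add: field_simps)
    qed (rule inS)
    then have "\<zeta>0 = \<sigma>0 *s v" by (simp add: vec_eq_iff)
    then show False using d2 \<delta>' by simp
  qed
  show ?thesis using \<delta> main unfolding Q_def by (intro exI[of _ \<delta>] conjI allI impI)
qed

text \<open>Points with \<open>D q \<noteq> 0\<close> are regular, so tangent vectors at such points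
  that come arbitrarily close to \<open>v\<close> arbitrarily far away would exhibit
  \<open>v\<close> as an element of \<open>C4_inf X\<close>.\<close>

lemma not_C4_gap:
  assumes "v \<notin> C4_inf X"
  shows "\<exists>\<epsilon>>0. \<exists>R. \<forall>q\<in>X. \<forall>w\<in>tangent_space X q. D q \<noteq> 0 \<longrightarrow> norm q > R \<longrightarrow> \<epsilon> \<le> norm (w - v)"
proof (rule ccontr)
  assume no: "\<not> ?thesis"
  have "\<forall>n::nat. \<exists>qw. fst qw \<in> X \<and> snd qw \<in> tangent_space X (fst qw) \<and> D (fst qw) \<noteq> 0 \<and>
    norm (fst qw) > real n \<and> norm (snd qw - v) < 1 / real (Suc n)"
  proof
    fix n :: nat
    have "\<not> (\<forall>q\<in>X. \<forall>w\<in>tangent_space X q. D q \<noteq> 0 \<longrightarrow> norm q > real n \<longrightarrow> 1 / real (Suc n) \<le> norm (w - v))"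
      using no by (metis of_nat_0_less_iff zero_less_Suc zero_less_divide_1_iff)
    then obtain q w where "q \<in> X" "w \<in> tangent_space X q" "D q \<noteq> 0" "norm q > real n"
      "norm (w - v) < 1 / real (Suc n)" by (auto simp: not_le)
    then show "\<exists>qw. fst qw \<in> X \<and> snd qw \<in> tangent_space X (fst qw) \<and> D (fst qw) \<noteq> 0 \<and>
      norm (fst qw) > real n \<and> norm (snd qw - v) < 1 / real (Suc n)"
      by (intro exI[of _ "(q, w)"]) simp
  qed
  from choice[OF this] obtain qw where
    qw: "\<And>n. fst (qw n) \<in> X" "\<And>n. snd (qw n) \<in> tangent_space X (fst (qw n))" "\<And>n. D (fst (qw n)) \<noteq> 0"
    "\<And>n. norm (fst (qw n)) > real n" "\<And>n. norm (snd (qw n) - v) < 1 / real (Suc n)" by blast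
  have "filterlim (\<lambda>n. norm (fst (qw n))) at_top sequentially"
    by (rule filterlim_at_top_mono[OF filterlim_real_sequentially]) (use qw(4) less_imp_le in \<open>auto intro: always_eventually\<close>)
  moreover have "(\<lambda>n. snd (qw n)) \<longlonglongrightarrow> v"
  proof (rule LIM_zero_cancel, rule tendsto_norm_zero_cancel,
      rule tendsto_sandwich[of "\<lambda>_. 0" _ _ "\<lambda>n. 1 / real (Suc n)"])
    show "(\<lambda>n. 1 / real (Suc n)) \<longlonglongrightarrow> 0" using LIMSEQ_inverse_real_of_nat by (simp add: inverse_eq_divide)
    show "\<forall>\<^sub>F n in sequentially. norm (snd (qw n) - v) \<le> 1 / real (Suc n)"
      using qw(5) less_imp_le by (intro always_eventually allI) blast
  qed simp_all
  ultimately have "v \<in> C4_inf X"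
    unfolding C4_inf_def using qw(1-3) not_Sing
    by (intro CollectI exI[of _ "\<lambda>n. fst (qw n)"] exI[of _ "\<lambda>n. snd (qw n)"]) auto
  then show False using assms by simp
qed

text \<open>Each bound guards one part of the boundary. With the size of \<open>x\<close>,
  \<open>\<delta> \<le> norm v / 4\<close> and \<open>norm (s - x) \<le> norm x / 2\<close> keep the
  points at norm above \<open>R\<close>, where the gap holds; \<open>\<delta>' < \<delta>\<close>
  keeps the maximum inside in \<open>z\<close>; and \<open>\<delta>'\<^sup>2 < \<eta> / 4\<close>
  makes the exponent negative where \<open>norm (s - x) = norm x / 2\<close>.\<close>

lemma weighted_max_contradiction:
  assumes gap: "\<And>q w. q \<in> X \<Longrightarrow> w \<in> tangent_space X q \<Longrightarrow> D q \<noteq> 0 \<Longrightarrow> norm q > R \<Longrightarrow> \<epsilon> \<le> norm (w - v)"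
    and \<epsilon>: "\<epsilon> > 0" and p: "p \<in> X" "D p \<noteq> 0" and \<delta>: "\<delta> > 0" "\<delta> \<le> norm v / 4"
    and x: "x \<noteq> 0" "norm v / 4 * norm x > R" and \<eta>: "8 * \<eta> = \<epsilon>\<^sup>2"
    and close: "norm (p - x *s v) \<le> \<delta> * norm x"
    and \<delta>': "\<delta>' < \<delta>" "\<delta>' \<ge> 0" "\<delta>'\<^sup>2 < \<eta> / 4"
    and isolated: "\<And>s z. z \<in> X \<Longrightarrow> (\<And>i. i \<in> S \<Longrightarrow> z $ i = (p - x *s v) $ i + s * v $ i) \<Longrightarrow>
      norm (s - x) \<le> norm x / 2 \<Longrightarrow> norm (z - s *s v) \<le> \<delta> * norm x \<Longrightarrow> norm (z - s *s v) \<le> \<delta>' * norm x"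
  shows False
proof -
  define a where "a = p - x *s v"
  define Y where "Y = {(s, z). z \<in> X \<and> (\<forall>i\<in>S. z $ i = a $ i + s * v $ i) \<and> norm (s - x) \<le> norm x / 2 \<and>
    norm (z - s *s v) \<le> \<delta> * norm x}"
  have nx: "norm x > 0" using x(1) by simp
  have cont_smult: "continuous_on A (\<lambda>y. snd y - fst y *s v)" for A :: "(complex \<times> (complex ^ 'n)) set"
  proof -
    have "snd y - fst y *s v = (\<chi> i. snd y $ i - fst y * v $ i)" for y :: "complex \<times> (complex ^ 'n)"
      by (simp add: vec_eq_iff)
    then show ?thesis by (simp only:) (intro continuous_on_vec_lambda continuous_intros)
  qed
  have "compact Y"
  proof -
    define M where "M = \<delta> * norm x + 3 / 2 * norm x * norm v"
    have "Y = (cball x (norm x / 2) \<times> cball 0 M) \<inter> (UNIV \<times> X) \<inter>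
      (\<Inter>i\<in>S. {y. snd y $ i = a $ i + fst y * v $ i}) \<inter> {y. norm (snd y - fst y *s v) \<le> \<delta> * norm x}"
    proof -
      have "norm z \<le> M" if "norm (s - x) \<le> norm x / 2" "norm (z - s *s v) \<le> \<delta> * norm x" for s z
      proof -
        have "norm s \<le> 3 / 2 * norm x" using norm_triangle_ineq[of "s - x" x] that(1) by simp
        then have "norm (s *s v) \<le> 3 / 2 * norm x * norm v"
          unfolding norm_vec_smult by (intro mult_right_mono) auto
        then show ?thesis using norm_triangle_ineq[of "z - s *s v" "s *s v"] that(2) by (simp add: M_def)
      qed
      then show ?thesis unfolding Y_def by (auto simp: dist_norm norm_minus_commute)
    qed
    moreover have "closed {y :: complex \<times> (complex ^ 'n). snd y $ i = a $ i + fst y * v $ i}" for i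
      by (intro closed_Collect_eq continuous_intros)
    moreover have "closed {y. norm (snd y - fst y *s v) \<le> \<delta> * norm x}"
      by (intro closed_Collect_le continuous_intros cont_smult)
    moreover have "closed (UNIV \<times> X :: (complex \<times> (complex ^ 'n)) set)" using X_closed by (intro closed_Times) auto
    ultimately show ?thesis
      by (auto intro!: compact_Int_closed compact_Times)
  qed
  have pY: "(x, p) \<in> Y" using p(1) close nx by (auto simp: Y_def a_def)
  then have Y_ne: "Y \<noteq> {}" by blast
  have cont_D: "continuous_on A (\<lambda>y. D (snd y))" for A :: "(complex \<times> (complex ^ 'n)) set"
    by (rule continuous_on_compose2[OF is_poly_continuous[OF D_poly, of UNIV]]) (auto intro!: continuous_intros)
  have "continuous_on Y (\<lambda>y. norm (D (snd y)))" by (intro continuous_intros cont_D)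
  from continuous_attains_sup[OF \<open>compact Y\<close> Y_ne this] obtain y1 where
    "y1 \<in> Y" and y1': "\<forall>y\<in>Y. norm (D (snd y)) \<le> norm (D (snd y1))" by (rule bexE)
  have y1: "norm (D (snd y)) \<le> norm (D (snd y1))" if "y \<in> Y" for y using y1' that by (rule bspec)
  define B where "B = norm (D (snd y1))"
  have B: "B > 0" using y1[OF pY] p(2) unfolding B_def snd_conv by (meson less_le_trans zero_less_norm_iff)
  \<comment> \<open>On the rim the exponent is at most
    \<open>(\<delta>' * norm x)\<^sup>2 - \<eta> * (norm x / 2)\<^sup>2\<close>, which is
    \<open>- \<beta>\<close>.\<close>
  define \<beta> where "\<beta> = (norm x)\<^sup>2 * (\<eta> / 4 - \<delta>'\<^sup>2)"
  have \<beta>: "\<beta> > 0" using nx \<delta>'(3) by (simp add: \<beta>_def)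
  \<comment> \<open>The choice gives \<open>\<kappa> * \<beta> = B / norm (D p)\<close>, and
    \<open>t < exp t\<close> then puts every value on the rim below
    \<open>norm (D p)\<close>.\<close>
  define \<kappa> where "\<kappa> = B / (norm (D p) * \<beta>)"
  have \<kappa>: "\<kappa> > 0" using B \<beta> p(2) by (simp add: \<kappa>_def)
  have small: "B * exp (- (\<kappa> * \<beta>)) < norm (D p)"
  proof -
    have "B / norm (D p) < exp (\<kappa> * \<beta>)"
    proof -
      have "\<kappa> * \<beta> < exp (\<kappa> * \<beta>)" using exp_ge_add_one_self[of "\<kappa> * \<beta>"] by linarith
      moreover have "\<kappa> * \<beta> = B / norm (D p)" using \<beta> by (simp add: \<kappa>_def)
      ultimately show ?thesis by simp
    qed
    then show ?thesis using p(2) by (simp add: exp_minus field_simps)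
  qed
  define E where "E y = (norm (snd y - fst y *s v))\<^sup>2 - \<eta> * (norm (fst y - x))\<^sup>2" for y :: "complex \<times> (complex ^ 'n)"
  define \<Theta> where "\<Theta> y = norm (D (snd y)) * exp (\<kappa> * E y)" for y
  have "continuous_on Y \<Theta>"
    unfolding \<Theta>_def E_def by (intro continuous_intros cont_D cont_smult)
  from continuous_attains_sup[OF \<open>compact Y\<close> Y_ne this] obtain y0 where
    y0': "y0 \<in> Y" "\<forall>y\<in>Y. \<Theta> y \<le> \<Theta> y0" by (rule bexE)
  note y0 = y0'(1) bspec[OF y0'(2)]
  obtain s z where sz: "y0 = (s, z)" by (cases y0)
  have zY: "z \<in> X" "\<And>i. i \<in> S \<Longrightarrow> z $ i = a $ i + s * v $ i" "norm (s - x) \<le> norm x / 2"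
    "norm (z - s *s v) \<le> \<delta> * norm x" using y0(1) by (auto simp: Y_def sz)
  have iso: "norm (z - s *s v) \<le> \<delta>' * norm x"
    using isolated[OF zY(1) _ zY(3,4)] zY(2) by (simp add: a_def)
  \<comment> \<open>At \<open>s = x\<close> the penalty vanishes and the exponent is nonnegative, so
    \<open>(x, p)\<close> competes with a value of at least \<open>norm (D p)\<close>. Hence the
    maximum is positive and \<open>D z \<noteq> 0\<close> there.\<close>
  have "norm (D p) * 1 \<le> \<Theta> (x, p)" unfolding \<Theta>_def E_def using \<kappa> by (intro mult_mono) auto
  then have low: "norm (D p) \<le> \<Theta> (s, z)" using y0(2)[OF pY] by (simp add: sz)
  then have Dz: "D z \<noteq> 0" using p(2) by (auto simp: \<Theta>_def)
  have inner_s: "norm (s - x) < norm x / 2"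
  proof (rule ccontr)
    assume "\<not> ?thesis"
    then have eq: "norm (s - x) = norm x / 2" using zY(3) by simp
    have "(norm (z - s *s v))\<^sup>2 \<le> (\<delta>' * norm x)\<^sup>2" using iso by (intro power_mono) auto
    moreover have eq2: "(norm (s - x))\<^sup>2 = (norm x)\<^sup>2 / 4" unfolding eq by (simp add: power_divide)
    ultimately have "E (s, z) \<le> - \<beta>" unfolding E_def \<beta>_def fst_conv snd_conv eq2
      by (simp add: power_mult_distrib algebra_simps)
    then have "\<kappa> * E (s, z) \<le> \<kappa> * (- \<beta>)" using \<kappa> by (intro mult_left_mono) auto
    then have "\<Theta> (s, z) \<le> B * exp (- (\<kappa> * \<beta>))"
      unfolding \<Theta>_def using y1[OF y0(1)] B by (intro mult_mono) (auto simp: sz B_def)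
    then show False using low small by simp
  qed
  have inner_z: "norm (z - s *s v) < \<delta> * norm x"
    using iso \<delta>'(1) nx by (meson le_less_trans mult_strict_right_mono)
  have "norm z > R"
  proof -
    have "norm x \<le> norm s + norm (s - x)" using norm_triangle_ineq4[of s "s - x"] by simp
    then have "norm x / 2 \<le> norm s" using zY(3) by simp
    then have "norm x / 2 * norm v \<le> norm (s *s v)" unfolding norm_vec_smult by (intro mult_right_mono) auto
    moreover have "norm (s *s v) \<le> norm z + norm (z - s *s v)" using norm_triangle_ineq4[of z "z - s *s v"] by simp
    moreover have "\<delta> * norm x \<le> norm v / 4 * norm x" using \<delta>(2) by (intro mult_right_mono) auto
    ultimately have "norm v / 4 * norm x \<le> norm z" using zY(4) by (simp add: mult.commute)
    then show ?thesis using x(2) by simp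
  qed
  obtain r g w where r: "r > 0" and g: "g 0 = z" "\<And>c. c \<in> ball 0 r \<Longrightarrow> g c \<in> X \<and> pr (g c) = pr z + c *s pr v"
    "\<And>f. is_poly UNIV f \<Longrightarrow> (\<lambda>c. f (g c)) holomorphic_on ball 0 r"
    "w \<in> tangent_space X z" "(g has_derivative (\<lambda>c. c *s w)) (at 0)"
    using tangent_disc[OF zY(1) Dz, of v] by blast
  have w: "\<epsilon> \<le> norm (w - v)" using gap[OF zY(1) g(4) Dz \<open>norm z > R\<close>] .
  have g_holo: "(\<lambda>c. g c $ i) holomorphic_on ball 0 r" for i
    by (rule g(3)) (simp add: is_poly_coord)
  have D_holo: "(\<lambda>c. D (g c)) holomorphic_on ball 0 r"
    by (rule g(3)) (rule is_poly_mono_set[OF D_poly], simp)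
  have contg: "isCont g 0" using has_derivative_continuous[OF g(5)] .
  have t1: "((\<lambda>c. norm (s + c - x)) \<longlongrightarrow> norm (s + 0 - x)) (at 0)" by (intro tendsto_intros)
  have t2: "((\<lambda>c. norm (g c - (s + c) *s v)) \<longlongrightarrow> norm (g 0 - (s + 0) *s v)) (at 0)"
    using contg by (intro tendsto_intros tendsto_vec_smult) (simp add: isCont_def)
  have "\<forall>\<^sub>F c in at 0. norm (s + c - x) < norm x / 2 \<and> norm (g c - (s + c) *s v) < \<delta> * norm x"
    using order_tendstoD(2)[OF t1, of "norm x / 2"] order_tendstoD(2)[OF t2, of "\<delta> * norm x"] inner_s inner_z
    by (auto simp: g(1) eventually_conj_iff)
  then obtain r' where r': "r' > 0" "\<And>c. c \<noteq> 0 \<Longrightarrow> dist c 0 < r' \<Longrightarrow>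
      norm (s + c - x) < norm x / 2 \<and> norm (g c - (s + c) *s v) < \<delta> * norm x"
    unfolding eventually_at by auto
  define \<rho> where "\<rho> = min r r'"
  have \<rho>: "\<rho> > 0" "ball 0 \<rho> \<subseteq> ball (0::complex) r" using r r'(1) by (auto simp: \<rho>_def)
  \<comment> \<open>The disc lies in \<open>X\<close> over the line, and the two strict inequalities
    persist near \<open>0\<close> by continuity. So the maximum over \<open>Y\<close> is a local
    maximum along the disc.\<close>
  have inY: "(s + c, g c) \<in> Y" if c: "c \<in> ball 0 \<rho>" for c
  proof (cases "c = 0")
    case True
    then show ?thesis using y0(1) by (simp add: g(1) sz)
  next
    case False
    have gc: "g c \<in> X" "pr (g c) = pr z + c *s pr v" using g(2)[of c] c \<rho>(2) by auto
    have "g c $ i = a $ i + (s + c) * v $ i" if i: "i \<in> S" for i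
      using arg_cong[OF gc(2), of "\<lambda>z. z $ i"] zY(2)[OF i] i by (simp add: pr_def algebra_simps)
    then show ?thesis using gc(1) r'(2)[OF False] c by (auto simp: Y_def \<rho>_def less_imp_le)
  qed
  show False
  proof (rule no_weighted_local_max[OF \<rho>(1) _ _ _ g(5) w \<epsilon> \<kappa> \<eta>, of "\<lambda>c. D (g c)" s x])
    show "(\<lambda>c. g c $ i) holomorphic_on ball 0 \<rho>" for i using g_holo \<rho>(2) by (rule holomorphic_on_subset)
    show "(\<lambda>c. D (g c)) holomorphic_on ball 0 \<rho>" using D_holo \<rho>(2) by (rule holomorphic_on_subset)
    show "D (g 0) \<noteq> 0" using Dz g(1) by simp
    show "norm (D (g c)) * exp (\<kappa> * ((norm (g c - (s + c) *s v))\<^sup>2 - \<eta> * (norm (s + c - x))\<^sup>2)) \<le>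
      norm (D (g 0)) * exp (\<kappa> * ((norm (g 0 - s *s v))\<^sup>2 - \<eta> * (norm (s - x))\<^sup>2))"
      if "c \<in> ball 0 \<rho>" for c
      using y0(2)[OF inY[OF that]] by (simp add: \<Theta>_def E_def sz g(1))
  qed
qed

lemma C3_subset_C4: "C3_inf X \<subseteq> C4_inf X"
proof
  fix v assume "v \<in> C3_inf X"
  then obtain p0 t where p0: "\<And>j. p0 j \<in> X" "filterlim (\<lambda>j. norm (p0 j)) at_top sequentially"
    "(\<lambda>j. t j *s p0 j) \<longlonglongrightarrow> v" unfolding C3_inf_def by blast
  show "v \<in> C4_inf X"
  proof (rule ccontr)
    assume "v \<notin> C4_inf X"
    then obtain \<epsilon> R where \<epsilon>: "\<epsilon> > 0" and
      gap0: "\<forall>q\<in>X. \<forall>w\<in>tangent_space X q. D q \<noteq> 0 \<longrightarrow> norm q > R \<longrightarrow> \<epsilon> \<le> norm (w - v)"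
      using not_C4_gap by blast
    have gap: "\<epsilon> \<le> norm (w - v)" if "q \<in> X" "w \<in> tangent_space X q" "D q \<noteq> 0" "norm q > R" for q w
      using gap0 that by blast
    \<comment> \<open>The weight needs a comparison point with \<open>D\<close> nonzero. A
      displacement below \<open>1\<close> does not change the limit, since the scalars
      \<open>t j\<close> tend to \<open>0\<close>.\<close>
    have "\<forall>j. \<exists>q. q \<in> X \<and> dist q (p0 j) < 1 \<and> D q \<noteq> 0" using dense_D[OF p0(1), of 1] by auto
    from choice[OF this] obtain p where p: "\<And>j. p j \<in> X" "\<And>j. dist (p j) (p0 j) < 1" "\<And>j. D (p j) \<noteq> 0"
      by blast
    \<comment> \<open>The zero vector is tangent at every regular point, so \<open>v = 0\<close>
      contradicts the gap. Nonzero \<open>v\<close> makes the scalars \<open>t j\<close> eventually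
      nonzero, so that \<open>x\<close> can be their inverse.\<close>
    have "v \<noteq> 0"
    proof
      assume v0: "v = 0"
      obtain j where j: "norm (p0 j) > R + 1"
        using filterlim_at_top_dense[THEN iffD1, OF p0(2), rule_format, of "R + 1"]
        by (auto simp: eventually_sequentially)
      have "norm (p0 j) \<le> norm (p j) + dist (p j) (p0 j)"
        using norm_triangle_ineq4[of "p j" "p j - p0 j"] by (simp add: dist_norm)
      then have "norm (p j) > R" using j p(2)[of j] by simp
      moreover have "0 \<in> tangent_space X (p j)"
        using regular_chart[OF p(1) p(3)] zero_in_tangent_space by blast
      ultimately show False using gap[OF p(1) _ p(3)] v0 \<epsilon> by fastforce
    qed
    have t0: "(\<lambda>j. norm (t j)) \<longlonglongrightarrow> 0"
    proof -
      have "(\<lambda>j. norm (t j *s p0 j) * inverse (norm (p0 j))) \<longlonglongrightarrow> norm v * 0"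
        by (intro tendsto_mult tendsto_norm p0(3) tendsto_inverse_0_at_top p0(2))
      moreover have "\<forall>\<^sub>F j in sequentially. norm (t j *s p0 j) * inverse (norm (p0 j)) = norm (t j)"
        using filterlim_at_top_dense[THEN iffD1, OF p0(2), rule_format, of 0]
        by eventually_elim (auto simp: norm_vec_smult)
      ultimately show ?thesis using Lim_transform_eventually[of _ "norm v * 0"] by simp
    qed
    have "\<forall>\<^sub>F j in sequentially. t j *s p0 j \<noteq> 0"
      using tendsto_imp_eventually_ne[OF p0(3) \<open>v \<noteq> 0\<close>] .
    then obtain J where J: "\<And>j. j \<ge> J \<Longrightarrow> t j *s p0 j \<noteq> 0" by (auto simp: eventually_sequentially)
    define x where "x j = inverse (t (j + J))" for j
    define P where "P j = p (j + J)" for j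
    have tJ: "t (j + J) \<noteq> 0" for j using J[of "j + J"] by auto
    then have x0: "x j \<noteq> 0" for j by (simp add: x_def)
    have xinf: "filterlim (\<lambda>j. norm (x j)) at_top sequentially"
      unfolding x_def norm_inverse
      using LIMSEQ_ignore_initial_segment[OF t0, of J] tJ
      by (intro filterlim_inverse_at_top) auto
    have "(\<lambda>j. t j *s (p j - p0 j)) \<longlonglongrightarrow> 0"
    proof (rule tendsto_norm_zero_cancel, rule tendsto_sandwich[OF _ _ tendsto_const t0])
      show "\<forall>\<^sub>F j in sequentially. norm (t j *s (p j - p0 j)) \<le> norm (t j)"
        unfolding norm_vec_smult using p(2) by (intro always_eventually allI mult_left_le) (auto simp: dist_norm less_imp_le)
    qed simp
    then have "(\<lambda>j. t j *s p0 j + t j *s (p j - p0 j)) \<longlonglongrightarrow> v + 0" by (intro tendsto_add p0(3))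
    then have "(\<lambda>j. t j *s p j) \<longlonglongrightarrow> v" by (simp add: vector_ssub_ldistrib)
    then have lim: "(\<lambda>j. inverse (x j) *s P j) \<longlonglongrightarrow> v"
      unfolding x_def P_def inverse_inverse_eq by (rule LIMSEQ_ignore_initial_segment)
    have PX: "P j \<in> X" for j using p(1) by (simp add: P_def)
    obtain \<delta>0 where \<delta>0: "\<delta>0 > 0" "\<And>\<delta>'. \<delta>' > 0 \<Longrightarrow> \<forall>\<^sub>F j in sequentially. \<forall>s z. z \<in> X \<longrightarrow>
      (\<forall>i\<in>S. z $ i = (P j - x j *s v) $ i + s * v $ i) \<longrightarrow> norm (s - x j) \<le> norm (x j) / 2 \<longrightarrow>
      norm (z - s *s v) \<le> \<delta>0 * norm (x j) \<longrightarrow> norm (z - s *s v) \<le> \<delta>' * norm (x j)"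
      using isolated_direction[OF PX x0 xinf lim] by blast
    define \<delta> where "\<delta> = min \<delta>0 (norm v / 4)"
    have \<delta>: "\<delta> > 0" "\<delta> \<le> norm v / 4" "\<delta> \<le> \<delta>0" using \<delta>0(1) \<open>v \<noteq> 0\<close> by (auto simp: \<delta>_def)
    define \<eta> where "\<eta> = \<epsilon>\<^sup>2 / 8"
    \<comment> \<open>The bound \<open>\<epsilon> / 8\<close> gives
      \<open>\<delta>'\<^sup>2 \<le> \<epsilon>\<^sup>2 / 64\<close>, which is below
      \<open>\<eta> / 4 = \<epsilon>\<^sup>2 / 32\<close>; the bound \<open>\<delta> / 2\<close>
      gives \<open>\<delta>' < \<delta>\<close>.\<close>
    define \<delta>' where "\<delta>' = min (\<delta> / 2) (\<epsilon> / 8)"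
    have \<delta>': "\<delta>' > 0" "\<delta>' < \<delta>" using \<delta>(1) \<epsilon> by (auto simp: \<delta>'_def)
    have "\<delta>'\<^sup>2 \<le> (\<epsilon> / 8)\<^sup>2" using \<delta>'(1) by (intro power_mono) (auto simp: \<delta>'_def)
    also have "\<dots> < \<eta> / 4" using \<epsilon> by (simp add: \<eta>_def power_divide)
    finally have \<delta>'\<eta>: "\<delta>'\<^sup>2 < \<eta> / 4" .
    have close: "\<forall>\<^sub>F j in sequentially. norm (P j - x j *s v) \<le> \<delta> * norm (x j)"
      using tendstoD[OF lim \<delta>(1)]
    proof eventually_elim
      case (elim j)
      have "P j - x j *s v = x j *s (inverse (x j) *s P j - v)"
        using x0[of j] by (simp add: vector_ssub_ldistrib vector_smult_assoc)
      then have "norm (P j - x j *s v) = norm (x j *s (inverse (x j) *s P j - v))" by (rule arg_cong)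
      also have "\<dots> = norm (x j) * norm (inverse (x j) *s P j - v)" by (rule norm_vec_smult)
      also have "\<dots> \<le> norm (x j) * \<delta>" using elim by (intro mult_left_mono) (auto simp: dist_norm)
      finally show ?case by (simp add: mult.commute)
    qed
    have far: "\<forall>\<^sub>F j in sequentially. norm v / 4 * norm (x j) > R"
      using filterlim_at_top_dense[THEN iffD1, OF xinf, rule_format, of "R / (norm v / 4)"]
    proof eventually_elim
      case (elim j)
      then show ?case using \<open>v \<noteq> 0\<close> by (simp add: field_simps)
    qed
    have "\<exists>j. norm (P j - x j *s v) \<le> \<delta> * norm (x j) \<and> norm v / 4 * norm (x j) > R \<and> (\<forall>s z. z \<in> X \<longrightarrow>
      (\<forall>i\<in>S. z $ i = (P j - x j *s v) $ i + s * v $ i) \<longrightarrow> norm (s - x j) \<le> norm (x j) / 2 \<longrightarrow>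
      norm (z - s *s v) \<le> \<delta>0 * norm (x j) \<longrightarrow> norm (z - s *s v) \<le> \<delta>' * norm (x j))"
      using eventually_happens'[OF sequentially_bot eventually_conj[OF close eventually_conj[OF far \<delta>0(2)[OF \<delta>'(1)]]]] .
    then obtain j where j: "norm (P j - x j *s v) \<le> \<delta> * norm (x j)" "norm v / 4 * norm (x j) > R"
      "\<And>s z. z \<in> X \<Longrightarrow> (\<forall>i\<in>S. z $ i = (P j - x j *s v) $ i + s * v $ i) \<Longrightarrow> norm (s - x j) \<le> norm (x j) / 2 \<Longrightarrow>
      norm (z - s *s v) \<le> \<delta>0 * norm (x j) \<Longrightarrow> norm (z - s *s v) \<le> \<delta>' * norm (x j)" by blast
    show False
    proof (rule weighted_max_contradiction[of R \<epsilon> v "P j" \<delta> "x j" \<eta> \<delta>'])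
      show "\<epsilon> \<le> norm (w - v)" if "q \<in> X" "w \<in> tangent_space X q" "D q \<noteq> 0" "norm q > R" for q w
        using that by (rule gap)
      show "D (P j) \<noteq> 0" using p(3) by (simp add: P_def)
      show "8 * \<eta> = \<epsilon>\<^sup>2" by (simp add: \<eta>_def)
      show "0 \<le> \<delta>'" using \<delta>'(1) by simp
      fix s z
      assume z: "z \<in> X" "\<And>i. i \<in> S \<Longrightarrow> z $ i = (P j - x j *s v) $ i + s * v $ i"
        "norm (s - x j) \<le> norm (x j) / 2" "norm (z - s *s v) \<le> \<delta> * norm (x j)"
      have "\<delta> * norm (x j) \<le> \<delta>0 * norm (x j)" using \<delta>(3) by (intro mult_right_mono) auto
      then show "norm (z - s *s v) \<le> \<delta>' * norm (x j)" using z by (intro j(3)) auto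
    qed (fact \<epsilon> PX \<delta> x0 j(1,2) \<delta>'(2) \<delta>'\<eta>)+
  qed
qed

end

section \<open>Secants\<close>

text \<open>In the chart, the line through the image of \<open>p\<close> in the direction of the
  image of \<open>w\<close> stays in the linear space \<open>L\<close>. Pulled back near
  \<open>p\<close>, it is a curve in \<open>X\<close> with velocity \<open>w\<close>, whose
  difference quotients are multiples of secants.\<close>

lemma secant_approximation:
  assumes p: "p \<in> X" and w: "w \<in> tangent_space X p" and \<epsilon>: "\<epsilon> > 0"
  shows "\<exists>q\<in>X. \<exists>t. norm (q - p) < 1 \<and> norm (t *s (p - q) - w) < \<epsilon>"
proof -
  obtain U \<phi> L where c: "submanifold_chart X p U \<phi> L" and wL: "frechet_derivative \<phi> (at p) w \<in> L"
    using w unfolding tangent_space_def by blast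
  define b where "b = frechet_derivative \<phi> (at p) w"
  obtain \<psi> where U: "open U" "p \<in> U" "open (\<phi> ` U)" "\<forall>z\<in>U. \<psi> (\<phi> z) = z"
    "\<forall>y\<in>\<phi> ` U. \<exists>E. vec_linear E \<and> (\<psi> has_derivative E) (at y)"
    using submanifold_chart_inverse[OF c] by blast
  have L: "vec.subspace L" "\<phi> ` (X \<inter> U) = \<phi> ` U \<inter> L" using c by (auto simp: submanifold_chart_def)
  obtain E where E: "vec_linear E" "(\<psi> has_derivative E) (at (\<phi> p))"
    using U(2,5) by blast
  have Eb: "E b = w"
  proof -
    have "((\<lambda>z. \<psi> (\<phi> z)) has_derivative (\<lambda>h. E (frechet_derivative \<phi> (at p) h))) (at p)"
      by (rule has_derivative_compose[OF submanifold_chart_derivative[OF c] E(2)])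
    then have "((\<lambda>z. z) has_derivative (\<lambda>h. E (frechet_derivative \<phi> (at p) h))) (at p)"
      by (rule has_derivative_transform_within_open[OF _ U(1,2)]) (use U(4) in auto)
    from has_derivative_unique[OF this has_derivative_ident]
    have "(\<lambda>h. E (frechet_derivative \<phi> (at p) h)) = (\<lambda>h. h)" .
    from fun_cong[OF this, of w] show ?thesis by (simp add: b_def)
  qed
  define g where "g c = \<psi> (\<phi> p + c *s b)" for c
  have g0: "g 0 = p" using U(2,4) by (simp add: g_def)
  have "(\<psi> has_derivative E) (at (\<phi> p + 0 *s b))" using E(2) by simp
  from has_derivative_compose[OF has_derivative_line this]
  have der: "(g has_derivative (\<lambda>c. c *s w)) (at 0)"
    using vec_linearD(2)[OF E(1)] Eb by (simp add: g_def[abs_def])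
  have "open ((\<lambda>c. \<phi> p + c *s b) -` (\<phi> ` U))"
    using has_derivative_continuous[OF has_derivative_line]
    by (intro open_vimage U(3) continuous_at_imp_continuous_on ballI)
  moreover have "0 \<in> (\<lambda>c. \<phi> p + c *s b) -` (\<phi> ` U)" using U(2) by simp
  ultimately obtain r where r: "r > 0" "ball 0 r \<subseteq> (\<lambda>c. \<phi> p + c *s b) -` (\<phi> ` U)"
    by (meson openE)
  have "\<phi> p \<in> \<phi> ` (X \<inter> U)" using p U(2) by blast
  then have pL: "\<phi> p \<in> L" unfolding L(2) by blast
  have gX: "g c \<in> X" if "c \<in> ball 0 r" for c
  proof -
    have "\<phi> p + c *s b \<in> L" using pL wL L(1) unfolding b_def
      by (intro vec.subspace_add vec.subspace_scale) auto
    moreover have "\<phi> p + c *s b \<in> \<phi> ` U" using r(2) that by blast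
    ultimately have "\<phi> p + c *s b \<in> \<phi> ` (X \<inter> U)" unfolding L(2) by blast
    then obtain x where "x \<in> X" "x \<in> U" "\<phi> p + c *s b = \<phi> x" by blast
    then show ?thesis using U(4) by (simp add: g_def)
  qed
  have "\<exists>e>0. \<forall>c. norm (c - 0) < e \<longrightarrow> norm (g c - g 0 - (c - 0) *s w) \<le> \<epsilon> / 2 * norm (c - 0)"
    using der \<epsilon> unfolding has_derivative_at_alt by (meson half_gt_zero)
  then obtain e where e: "e > 0" "\<And>c. norm c < e \<Longrightarrow> norm (g c - p - c *s w) \<le> \<epsilon> / 2 * norm c"
    by (auto simp: g0)
  have "\<forall>\<^sub>F c in nhds 0. dist (g c) (g 0) < 1"
    using has_derivative_continuous[OF der] by (intro tendstoD) (auto simp: continuous_at tendsto_at_iff_tendsto_nhds)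
  then obtain e' where e': "e' > 0" "\<And>c. dist c 0 < e' \<Longrightarrow> dist (g c) (g 0) < 1"
    unfolding eventually_nhds_metric by blast
  define c where "c = complex_of_real (min r (min e e') / 2)"
  have cs: "c \<noteq> 0" "norm c < r" "norm c < e" "norm c < e'" using r(1) e(1) e'(1) by (auto simp: c_def)
  \<comment> \<open>The secant is written from the moving point to \<open>p\<close>, which accounts
    for the sign of the scalar.\<close>
  have "(- inverse c) *s (p - g c) - w = inverse c *s (g c - p - c *s w)"
    using cs(1) by (simp add: vec_eq_iff field_simps)
  then have "norm ((- inverse c) *s (p - g c) - w) = norm (inverse c *s (g c - p - c *s w))" by (rule arg_cong)
  also have "\<dots> = norm (g c - p - c *s w) / norm c"
    unfolding norm_vec_smult norm_inverse by (simp add: divide_inverse mult.commute)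
  also have "\<dots> \<le> \<epsilon> / 2" using e(2)[OF cs(3)] cs(1) by (simp add: pos_divide_le_eq)
  finally have "norm ((- inverse c) *s (p - g c) - w) < \<epsilon>" using \<epsilon> by simp
  moreover have "norm (g c - p) < 1" using e'(2)[of c] cs(4) g0 by (simp add: dist_norm)
  moreover have "g c \<in> X" using cs(2) by (intro gX) simp
  ultimately show ?thesis by blast
qed

text \<open>Each tangent vector is replaced by a secant with error below
  \<open>1 / real (Suc j)\<close>; as its endpoints are less than \<open>1\<close> apart, the second
  one goes to infinity with the first.\<close>

lemma C4_subset_C5: "C4_inf X \<subseteq> C5_inf X"
proof
  fix v assume "v \<in> C4_inf X"
  then obtain p w where p: "\<And>j. p j \<in> X" "\<And>j. w j \<in> tangent_space X (p j)"
    "filterlim (\<lambda>j. norm (p j)) at_top sequentially" "w \<longlonglongrightarrow> v"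
    unfolding C4_inf_def by blast
  have "\<forall>j. \<exists>q. q \<in> X \<and> (\<exists>t. norm (q - p j) < 1 \<and> norm (t *s (p j - q) - w j) < 1 / real (Suc j))"
    using secant_approximation[OF p(1,2)] by (metis of_nat_0_less_iff zero_less_Suc zero_less_divide_1_iff)
  from choice[OF this] obtain q where
    q: "\<forall>j. q j \<in> X \<and> (\<exists>t. norm (q j - p j) < 1 \<and> norm (t *s (p j - q j) - w j) < 1 / real (Suc j))" ..
  then have "\<forall>j. \<exists>t. norm (t *s (p j - q j) - w j) < 1 / real (Suc j)" by blast
  from choice[OF this] obtain t where t: "\<And>j. norm (t j *s (p j - q j) - w j) < 1 / real (Suc j)" by blast
  have "filterlim (\<lambda>j. norm (q j)) at_top sequentially"
  proof (rule filterlim_at_top_mono)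
    show "filterlim (\<lambda>j. -1 + norm (p j)) at_top sequentially"
      by (intro filterlim_tendsto_add_at_top[OF tendsto_const p(3)])
    show "\<forall>\<^sub>F j in sequentially. -1 + norm (p j) \<le> norm (q j)"
    proof (intro always_eventually allI)
      fix j
      have "norm (q j - p j) < 1" using q by blast
      then show "-1 + norm (p j) \<le> norm (q j)" using norm_triangle_ineq2[of "p j" "q j"]
        by (simp add: norm_minus_commute)
    qed
  qed
  moreover have "(\<lambda>j. t j *s (p j - q j)) \<longlonglongrightarrow> v"
  proof -
    have "(\<lambda>j. t j *s (p j - q j) - w j) \<longlonglongrightarrow> 0"
    proof (rule tendsto_norm_zero_cancel, rule tendsto_sandwich[of "\<lambda>_. 0" _ _ "\<lambda>n. 1 / real (Suc n)"])
      show "(\<lambda>n. 1 / real (Suc n)) \<longlonglongrightarrow> 0" using LIMSEQ_inverse_real_of_nat by (simp add: inverse_eq_divide)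
      show "\<forall>\<^sub>F j in sequentially. norm (t j *s (p j - q j) - w j) \<le> 1 / real (Suc j)"
        using t less_imp_le by (intro always_eventually allI) blast
    qed simp_all
    from tendsto_add[OF this p(4)] show ?thesis by simp
  qed
  ultimately show "v \<in> C5_inf X" unfolding C5_inf_def using p(1,3) q by blast
qed

section \<open>Linear changes of coordinates\<close>

lemma lin_isoD:
  assumes "lin_iso A B"
  shows "vec_linear A" "vec_linear B" "A (B z) = z" "B (A z) = z"
  using assms by (auto simp: lin_iso_def)

lemma lin_iso_bounded_linear:
  assumes "lin_iso A B" shows "bounded_linear A"
  using vec_linear_imp_linear[OF lin_isoD(1)[OF assms]] by (simp add: linear_conv_bounded_linear)

lemma lin_iso_has_derivative: "lin_iso A B \<Longrightarrow> (A has_derivative A) (at z)"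
  by (intro bounded_linear_imp_has_derivative lin_iso_bounded_linear)

lemma lin_iso_continuous: "lin_iso A B \<Longrightarrow> continuous_on T A"
  by (rule linear_continuous_on[OF lin_iso_bounded_linear])

lemma vec_linear_compose:
  fixes A B :: "complex ^ 'n \<Rightarrow> complex ^ 'n"
  assumes "vec_linear A" "vec_linear B"
  shows "vec_linear (\<lambda>z. A (B z))"
  by (rule vec_linearI) (simp_all add: vec_linearD[OF assms(1)] vec_linearD[OF assms(2)])

lemma lin_iso_image_eq_vimage: "lin_iso A B \<Longrightarrow> A ` U = B -` U"
  by (auto simp: lin_iso_def image_iff) metis

text \<open>The chart of the image is \<open>\<phi>\<close> preceded by \<open>B\<close>, with the
  same model space \<open>L\<close>; so dimensions and, by the chain rule, tangent spaces are
  transported.\<close>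

lemma submanifold_chart_image:
  assumes iso: "lin_iso A B" and c: "submanifold_chart X p U \<phi> L"
  shows "submanifold_chart (A ` X) (A p) (A ` U) (\<lambda>z. \<phi> (B z)) L"
proof -
  note AB = lin_isoD[OF iso]
  obtain \<psi> where \<psi>: "holomorphic_map_on \<phi> U" "holomorphic_map_on \<psi> (\<phi> ` U)" "\<forall>z\<in>U. \<psi> (\<phi> z) = z"
    using c unfolding submanifold_chart_def biholomorphic_on_def by blast
  have im: "(\<lambda>z. \<phi> (B z)) ` (A ` V) = \<phi> ` V" for V by (simp add: image_image AB(4))
  have "holomorphic_map_on (\<lambda>z. \<phi> (B z)) (A ` U)"
    unfolding holomorphic_map_on_def
  proof (intro conjI ballI)
    show "open (A ` U)"
      unfolding lin_iso_image_eq_vimage[OF iso] using \<psi>(1) lin_iso_continuous[OF lin_iso_sym[OF iso]]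
      by (intro open_vimage) (auto simp: holomorphic_map_on_def)
    fix z assume "z \<in> A ` U"
    then have "B z \<in> U" using AB(4) by auto
    then obtain E where E: "vec_linear E" "(\<phi> has_derivative E) (at (B z))"
      using \<psi>(1) unfolding holomorphic_map_on_def by blast
    show "\<exists>D. vec_linear D \<and> ((\<lambda>z. \<phi> (B z)) has_derivative D) (at z)"
      using vec_linear_compose[OF E(1) AB(2)]
        has_derivative_compose[OF lin_iso_has_derivative[OF lin_iso_sym[OF iso]] E(2)] by blast
  qed
  moreover have "holomorphic_map_on (\<lambda>y. A (\<psi> y)) ((\<lambda>z. \<phi> (B z)) ` (A ` U))"
    unfolding holomorphic_map_on_def im
  proof (intro conjI ballI)
    show "open (\<phi> ` U)" using \<psi>(2) by (simp add: holomorphic_map_on_def)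
    fix y assume "y \<in> \<phi> ` U"
    then obtain E where E: "vec_linear E" "(\<psi> has_derivative E) (at y)"
      using \<psi>(2) unfolding holomorphic_map_on_def by blast
    show "\<exists>D. vec_linear D \<and> ((\<lambda>y. A (\<psi> y)) has_derivative D) (at y)"
      using vec_linear_compose[OF AB(1) E(1)] has_derivative_compose[OF E(2) lin_iso_has_derivative[OF iso]]
      by blast
  qed
  moreover have "\<forall>z\<in>A ` U. A (\<psi> (\<phi> (B z))) = z" using \<psi>(3) AB(4) by auto
  moreover have "(\<lambda>z. \<phi> (B z)) ` (A ` X \<inter> A ` U) = (\<lambda>z. \<phi> (B z)) ` A ` U \<inter> L"
  proof -
    have "inj A" using AB(4) by (metis injI)
    then have "A ` X \<inter> A ` U = A ` (X \<inter> U)" by (simp add: image_Int)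
    then show ?thesis using c by (simp only: im submanifold_chart_def)
  qed
  ultimately show ?thesis
    using c unfolding submanifold_chart_def biholomorphic_on_def by blast
qed

lemma regular_point_image:
  "lin_iso A B \<Longrightarrow> regular_point_of_dim X d p \<Longrightarrow> regular_point_of_dim (A ` X) d (A p)"
  unfolding regular_point_of_dim_def using submanifold_chart_image by blast

lemma lin_iso_image_image: "lin_iso A B \<Longrightarrow> B ` A ` X = X"
  by (auto simp: lin_iso_def image_image)

lemma lin_iso_ball:
  assumes "lin_iso A B" "r > 0"
  shows "\<exists>r'>0. \<forall>z\<in>ball a r'. A z \<in> ball (A a) r"
proof -
  have "open (A -` ball (A a) r)" using lin_iso_continuous[OF assms(1)] by (intro open_vimage) auto
  moreover have "a \<in> A -` ball (A a) r" using assms(2) by simp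
  ultimately show ?thesis by (meson openE subsetD vimageD)
qed

lemma pure_dimensional_image:
  assumes iso: "lin_iso A B" and pure: "pure_dimensional k X"
  shows "pure_dimensional k (A ` X)"
  unfolding pure_dimensional_def
proof
  fix a' assume "a' \<in> A ` X"
  then obtain a where a: "a \<in> X" "a' = A a" by blast
  have loc: "has_local_dim X a k" using pure a(1) by (simp add: pure_dimensional_def)
  note iso' = lin_iso_sym[OF iso]
  have Ba: "B a' = a" using lin_isoD(4)[OF iso] a(2) by simp
  have "\<exists>r>0. \<forall>z\<in>ball a' r. \<forall>e. regular_point_of_dim (A ` X) e z \<longrightarrow> e \<le> k"
  proof -
    obtain r where r: "r > 0" "\<forall>z\<in>ball a r. \<forall>e. regular_point_of_dim X e z \<longrightarrow> e \<le> k"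
      using loc unfolding has_local_dim_def by blast
    obtain r' where r': "r' > 0" "\<forall>z\<in>ball a' r'. B z \<in> ball (B a') r" using lin_iso_ball[OF iso' r(1)] by blast
    have "e \<le> k" if "z \<in> ball a' r'" "regular_point_of_dim (A ` X) e z" for z e
    proof -
      have "B z \<in> ball a r" using r'(2) that(1) Ba by auto
      moreover have "regular_point_of_dim X e (B z)"
        using regular_point_image[OF iso' that(2)] lin_iso_image_image[OF iso] by simp
      ultimately show ?thesis using r(2) by blast
    qed
    then show ?thesis using r'(1) by blast
  qed
  moreover have "\<exists>z\<in>ball a' r. regular_point_of_dim (A ` X) k z" if rpos: "r > 0" for r
  proof -
    obtain r' where r': "r' > 0" "\<forall>z\<in>ball a r'. A z \<in> ball (A a) r" using lin_iso_ball[OF iso rpos] by blast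
    obtain z where z: "z \<in> ball a r'" "regular_point_of_dim X k z"
      using loc r'(1) unfolding has_local_dim_def by blast
    have "A z \<in> ball a' r" using r'(2) z(1) a(2) by auto
    then show ?thesis using regular_point_image[OF iso z(2)] by blast
  qed
  ultimately show "has_local_dim (A ` X) a' k" unfolding has_local_dim_def by blast
qed

lemma tangent_space_image:
  assumes iso: "lin_iso A B" and w: "w \<in> tangent_space X p"
  shows "A w \<in> tangent_space (A ` X) (A p)"
proof -
  obtain U \<phi> L where c: "submanifold_chart X p U \<phi> L" "frechet_derivative \<phi> (at p) w \<in> L"
    using w unfolding tangent_space_def by blast
  have "(\<phi> has_derivative frechet_derivative \<phi> (at p)) (at (B (A p)))"
    using submanifold_chart_derivative[OF c(1)] lin_isoD(4)[OF iso] by simp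
  from has_derivative_compose[OF lin_iso_has_derivative[OF lin_iso_sym[OF iso]] this]
  have "frechet_derivative (\<lambda>z. \<phi> (B z)) (at (A p)) = (\<lambda>h. frechet_derivative \<phi> (at p) (B h))"
    by (rule frechet_derivative_at[symmetric])
  then have "frechet_derivative (\<lambda>z. \<phi> (B z)) (at (A p)) (A w) \<in> L"
    using c(2) lin_isoD(4)[OF iso] by simp
  then show ?thesis unfolding tangent_space_def using submanifold_chart_image[OF iso c(1)] by blast
qed

lemma filterlim_norm_lin_iso:
  assumes iso: "lin_iso A B" and p: "filterlim (\<lambda>j. norm (p j)) at_top F"
  shows "filterlim (\<lambda>j. norm (A (p j))) at_top F"
proof -
  obtain C where C: "C > 0" "\<And>y. norm (B y) \<le> norm y * C"
    using bounded_linear.pos_bounded[OF lin_iso_bounded_linear[OF lin_iso_sym[OF iso]]] by blast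
  have "norm (p j) * inverse C \<le> norm (A (p j))" for j
    using C(2)[of "A (p j)"] C(1) lin_isoD(4)[OF iso] by (simp add: field_simps)
  moreover have "filterlim (\<lambda>j. norm (p j) * inverse C) at_top F"
    using p C(1) by (intro filterlim_at_top_mult_tendsto_pos[OF tendsto_const]) auto
  ultimately show ?thesis by (intro filterlim_at_top_mono[of _ F "\<lambda>j. norm (A (p j))"]) auto
qed

lemma C3_inf_image:
  assumes iso: "lin_iso A B" and v: "v \<in> C3_inf X" shows "A v \<in> C3_inf (A ` X)"
proof -
  obtain p t where p: "\<And>j. p j \<in> X" "filterlim (\<lambda>j. norm (p j)) at_top sequentially"
    "(\<lambda>j. t j *s p j) \<longlonglongrightarrow> v" using v unfolding C3_inf_def by blast
  have "(\<lambda>j. A (t j *s p j)) \<longlonglongrightarrow> A v"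
    by (rule bounded_linear.tendsto[OF lin_iso_bounded_linear[OF iso] p(3)])
  then have "(\<lambda>j. t j *s A (p j)) \<longlonglongrightarrow> A v" by (simp add: vec_linearD(2)[OF lin_isoD(1)[OF iso]])
  then show ?thesis unfolding C3_inf_def using p(1) filterlim_norm_lin_iso[OF iso p(2)]
    by (intro CollectI exI[of _ "\<lambda>j. A (p j)"] exI[of _ t]) auto
qed

lemma C4_inf_image:
  assumes iso: "lin_iso A B" and v: "v \<in> C4_inf X" shows "A v \<in> C4_inf (A ` X)"
proof -
  obtain p w where p: "\<And>j. p j \<in> X" "\<And>j. p j \<notin> Sing X" "\<And>j. w j \<in> tangent_space X (p j)"
    "filterlim (\<lambda>j. norm (p j)) at_top sequentially" "w \<longlonglongrightarrow> v"
    using v unfolding C4_inf_def by blast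
  have "A (p j) \<notin> Sing (A ` X)" for j
    using p(1,2)[of j] regular_point_image[OF iso] unfolding Sing_def by blast
  moreover have "(\<lambda>j. A (w j)) \<longlonglongrightarrow> A v"
    by (rule bounded_linear.tendsto[OF lin_iso_bounded_linear[OF iso] p(5)])
  ultimately show ?thesis
    unfolding C4_inf_def using p(1) tangent_space_image[OF iso p(3)] filterlim_norm_lin_iso[OF iso p(4)]
    by (intro CollectI exI[of _ "\<lambda>j. A (p j)"] exI[of _ "\<lambda>j. A (w j)"]) auto
qed

lemma vec_linear_deg_le:
  fixes A :: "complex ^ 'n \<Rightarrow> complex ^ 'n"
  assumes "vec_linear A" shows "deg_le UNIV 1 (\<lambda>z. A z $ i)"
proof -
  have eq: "(\<lambda>z. A z $ i) = (\<lambda>z. \<Sum>j\<in>UNIV. A (axis j 1) $ i * z $ j)"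
  proof
    fix z
    have "A z = A (\<Sum>j\<in>UNIV. z $ j *s axis j 1)" by (simp add: basis_expansion)
    also have "\<dots> = (\<Sum>j\<in>UNIV. z $ j *s A (axis j 1))"
      using assms by (simp add: vec.linear_sum vec.linear_scale)
    finally show "A z $ i = (\<Sum>j\<in>UNIV. A (axis j 1) $ i * z $ j)" by (simp add: mult.commute)
  qed
  have "deg_le UNIV 1 (\<lambda>z. \<Sum>j\<in>UNIV. A (axis j 1) $ i * z $ j)"
    by (intro deg_le_sum deg_le_cmult deg_le_coord1) simp
  then show ?thesis by (rule ssubst[OF eq])
qed

lemma is_poly_lin_iso:
  assumes "lin_iso A B" "is_poly UNIV f" shows "is_poly UNIV (\<lambda>z. f (A z))"
proof -
  obtain d where "deg_le UNIV d f" using assms(2) by (auto simp: is_poly_def)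
  then have "deg_le UNIV d (\<lambda>z. f (A z))"
    by (rule deg_le_compose) (rule vec_linear_deg_le[OF lin_isoD(1)[OF assms(1)]])
  then show ?thesis by (rule is_polyI)
qed

lemma exists_normalized_variety:
  assumes "algebraic_set X" "X \<noteq> {}" "pure_dimensional k X"
  shows "\<exists>A B F S D K e. lin_iso A B \<and> normalized_variety (A ` X) F k S D K e"
proof -
  obtain F where F: "\<And>f. f \<in> F \<Longrightarrow> polynomial_fun f" "X = {z. \<forall>f\<in>F. f z = 0}"
    using assms(1) unfolding algebraic_set_def by blast
  have Fp: "is_poly UNIV f" if "f \<in> F" for f using F(1)[OF that] by (rule polynomial_fun_is_poly)
  have "finite_projection X UNIV" by (rule finite_projection_UNIV[OF F(2) Fp])
  from noether_normalization[OF this assms(2)] obtain A B S where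
    A: "lin_iso A B" "finite_projection (A ` X) S" "\<forall>y. \<exists>z\<in>A ` X. \<forall>i\<in>S. z $ i = y $ i" by blast
  have int: "integral_over (A ` X) S i" if "i \<notin> S" for i
    using A(2) that by (simp add: finite_projection_def)
  have "\<forall>i\<in>-S. \<exists>D. \<exists>K e. is_poly S D \<and> (\<exists>z. D z \<noteq> 0) \<and> poly_family S e K \<and>
    (\<forall>z\<in>A ` X. D z \<noteq> 0 \<longrightarrow> poly (K z) (z $ i) = 0 \<and> poly (pderiv (K z)) (z $ i) \<noteq> 0)"
  proof
    fix i assume "i \<in> -S"
    then obtain d H where H: "monic_family S d H" "\<forall>z\<in>A ` X. poly (H z) (z $ i) = 0"
      using int[of i] by (auto simp: integral_over_def)
    from radical_family[OF H(1)] obtain D K e where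
      "is_poly S D" "\<exists>z. D z \<noteq> 0" "poly_family S e K"
      "\<forall>z t. D z \<noteq> 0 \<longrightarrow> poly (H z) t = 0 \<longrightarrow> poly (K z) t = 0 \<and> poly (pderiv (K z)) t \<noteq> 0" by blast
    then show "\<exists>D K e. is_poly S D \<and> (\<exists>z. D z \<noteq> 0) \<and> poly_family S e K \<and>
      (\<forall>z\<in>A ` X. D z \<noteq> 0 \<longrightarrow> poly (K z) (z $ i) = 0 \<and> poly (pderiv (K z)) (z $ i) \<noteq> 0)"
      using H(2) by (intro exI[of _ D] exI[of _ K] exI[of _ e]) auto
  qed
  from bchoice[OF this] obtain D where "\<forall>i\<in>-S. \<exists>K e. is_poly S (D i) \<and> (\<exists>z. D i z \<noteq> 0) \<and> poly_family S e K \<and>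
    (\<forall>z\<in>A ` X. D i z \<noteq> 0 \<longrightarrow> poly (K z) (z $ i) = 0 \<and> poly (pderiv (K z)) (z $ i) \<noteq> 0)" ..
  from bchoice[OF this] obtain K where "\<forall>i\<in>-S. \<exists>e. is_poly S (D i) \<and> (\<exists>z. D i z \<noteq> 0) \<and> poly_family S e (K i) \<and>
    (\<forall>z\<in>A ` X. D i z \<noteq> 0 \<longrightarrow> poly (K i z) (z $ i) = 0 \<and> poly (pderiv (K i z)) (z $ i) \<noteq> 0)" ..
  from bchoice[OF this] obtain e where
    DK: "\<forall>i\<in>-S. is_poly S (D i) \<and> (\<exists>z. D i z \<noteq> 0) \<and> poly_family S (e i) (K i) \<and>
    (\<forall>z\<in>A ` X. D i z \<noteq> 0 \<longrightarrow> poly (K i z) (z $ i) = 0 \<and> poly (pderiv (K i z)) (z $ i) \<noteq> 0)" ..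
  \<comment> \<open>One denominator serves all coordinates: where the product is nonzero each
    \<open>D i\<close> is, and it is not identically zero because no factor is.\<close>
  define D0 where "D0 z = (\<Prod>i\<in>-S. D i z)" for z
  have D0: "D i z \<noteq> 0" if "D0 z \<noteq> 0" "i \<notin> S" for i z
    using that by (simp add: D0_def)
  have "normalized_variety (A ` X) ((\<lambda>f z. f (B z)) ` F) k S D0 K e"
  proof
    show "A ` X = {z. \<forall>f\<in>(\<lambda>f z. f (B z)) ` F. f z = 0}"
      unfolding lin_iso_image_eq_vimage[OF A(1)] F(2) by auto
    show "is_poly UNIV f" if "f \<in> (\<lambda>f z. f (B z)) ` F" for f
      using that Fp is_poly_lin_iso[OF lin_iso_sym[OF A(1)]] by auto
    show "pure_dimensional k (A ` X)" using A(1) assms(3) by (rule pure_dimensional_image)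
    show "\<exists>z\<in>A ` X. \<forall>i\<in>S. z $ i = y $ i" for y using A(3) by blast
    show "integral_over (A ` X) S i" if "i \<notin> S" for i using that by (rule int)
    show "is_poly S D0" unfolding D0_def using DK by (intro is_poly_prod) blast
    show "\<exists>y. D0 y \<noteq> 0" unfolding D0_def by (rule is_poly_prod_nonzero[of "-S" S D]) (use DK in auto)
    show "poly_family S (e i) (K i)" if "i \<notin> S" for i using DK that by blast
    show "poly (K i z) (z $ i) = 0" "poly (pderiv (K i z)) (z $ i) \<noteq> 0"
      if "i \<notin> S" "z \<in> A ` X" "D0 z \<noteq> 0" for i z
      using DK that D0[OF that(3,1)] by blast+
  qed
  then show ?thesis using A(1) by blast
qed

theorem proposition2p1:
  fixes X :: "(complex ^ 'n) set" and k :: nat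
  assumes "algebraic_set X"
    and "\<not> bounded X"
    and "pure_dimensional k X"
  shows "C3_inf X \<subseteq> C4_inf X \<and> C4_inf X \<subseteq> C5_inf X"
proof
  have "X \<noteq> {}" using assms(2) by auto
  then obtain A B F S D K e where iso: "lin_iso A B" and "normalized_variety (A ` X) F k S D K e"
    using exists_normalized_variety[OF assms(1) _ assms(3)] by blast
  \<comment> \<open>The first inclusion is available for the image of \<open>X\<close> under
    \<open>A\<close>; \<open>A\<close> carries the asymptotic vectors there and \<open>B\<close>
    carries the limits of tangent vectors back.\<close>
  then interpret normalized_variety "A ` X" F k S D K e by blast
  show "C3_inf X \<subseteq> C4_inf X"
  proof
    fix v assume "v \<in> C3_inf X"
    then have "A v \<in> C3_inf (A ` X)" by (rule C3_inf_image[OF iso])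
    then have "A v \<in> C4_inf (A ` X)" using C3_subset_C4 by blast
    then have "B (A v) \<in> C4_inf (B ` A ` X)" by (rule C4_inf_image[OF lin_iso_sym[OF iso]])
    then show "v \<in> C4_inf X" using lin_isoD(4)[OF iso] lin_iso_image_image[OF iso] by simp
  qed
  show "C4_inf X \<subseteq> C5_inf X" by (rule C4_subset_C5)
qed

end
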